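(* Let $V$ and $V_1$ be any two highest weight modules (not necessarily simple) over the Virasoro algebra $\mathrm{Vir}$, and let $\alpha,\beta,\alpha_1,\beta_1\in\mathbb{C}$ with $0\le\mathfrak{Re}\,\alpha<1$, $0\le\mathfrak{Re}\,\alpha_1<1$, $\beta\ne1$ and $\beta_1\ne1$. Then $V\otimes V'_{\alpha,\beta}\cong V_1\otimes V'_{\alpha_1,\beta_1}$ as $\mathrm{Vir}$-modules if and only if $V\cong V_1$ and $V'_{\alpha,\beta}\cong V'_{\alpha_1,\beta_1}$ as $\mathrm{Vir}$-modules.
   Context: The Virasoro algebra $\mathrm{Vir}$ is the complex Lie algebra with basis $\{d_n, C : n\in\mathbb{Z}\}$ and brackets $[d_m,d_n]=(n-m)d_{m+n}+\delta_{n,-m}\frac{m^3-m}{12}C$, $[C,d_m]=0$. Put $\mathrm{Vir}_{+}=\sum_{i\ge1}\mathbb{C}d_{i}$. For $c,h\in\mathbb{C}$ let $\mathbb{C}u$ be the one-dimensional module over $\mathrm{Vir}_+\oplus\mathbb{C}d_0\oplus\mathbb{C}C$ with $\mathrm{Vir}_+u=0$, $d_0u=hu$, $Cu=cu$; the Verma module is $M(c,h)=U(\mathrm{Vir})\otimes_{U(\mathrm{Vir}_+\oplus\mathbb{C}d_0\oplus\mathbb{C}C)}\mathbb{C}u$. A highest weight module (with highest weight $(c,h)$) is any nonzero quotient module of $M(c,h)$. Intermediate series modules: $V_{\alpha,\beta}=\bigoplus_{n\in\mathbb{Z}}\mathbb{C}v_n$ with $d_m v_n=(\alpha+n+m\beta)v_{m+n}$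 and $Cv_n=0$. When $0\le\mathfrak{Re}\,\alpha<1$ and $\beta\ne1$, $V_{\alpha,\beta}$ is simple unless $(\alpha,\beta)=(0,0)$, in which case $\mathbb{C}v_0$ is its unique nonzero proper submodule. Set $V'_{0,0}=V_{0,0}/\mathbb{C}v_0$ and $V'_{\alpha,\beta}=V_{\alpha,\beta}$ otherwise. *)

theory Defs
  imports "HOL-Algebra.QuotRing" "HOL-Algebra.Module" "HOL-Algebra.Algebraic_Closure_Type"
    "HOL-Library.Poly_Mapping" Complex_Main
begin

section \<open>Formal linear combinations\<close>

text \<open>The complex vector space with basis \<^typ>\<open>'a\<close> is the type \<open>'a \<Rightarrow>\<^sub>0 complex\<close>.\<close>

type_synonym 'a lincomb = "'a \<Rightarrow>\<^sub>0 complex"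

abbreviation complex_ring :: "complex ring"
  where "complex_ring \<equiv> ring_of_type_algebra"

definition bvec :: "'a \<Rightarrow> 'a lincomb"
  where "bvec a = Poly_Mapping.single a 1"

definition scal :: "complex \<Rightarrow> 'a lincomb \<Rightarrow> 'a lincomb"
  where "scal a p = Poly_Mapping.map ((*) a) p"

definition lin_ext :: "('a \<Rightarrow> 'b lincomb) \<Rightarrow> 'a lincomb \<Rightarrow> 'b lincomb"
  where "lin_ext f p = (\<Sum>a\<in>Poly_Mapping.keys p. scal (Poly_Mapping.lookup p a) (f a))"


section \<open>The Virasoro algebra and its modules\<close>

datatype vir_basis = gen_d int | gen_C

type_synonym vir = "vir_basis lincomb"

abbreviation vd :: "int \<Rightarrow> vir" where "vd n \<equiv> bvec (gen_d n)"

abbreviation vC :: vir where "vC \<equiv> bvec gen_C"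

fun basis_bracket :: "vir_basis \<Rightarrow> vir_basis \<Rightarrow> vir" where
  "basis_bracket (gen_d m) (gen_d n) =
     scal (of_int (n - m)) (vd (m + n))
     + (if n = - m then scal (of_int (m ^ 3 - m) / 12) vC else 0)"
| "basis_bracket gen_C b = 0"
| "basis_bracket a gen_C = 0"

definition vir_bracket :: "vir \<Rightarrow> vir \<Rightarrow> vir"
  where "vir_bracket x y = lin_ext (\<lambda>a. lin_ext (\<lambda>b. basis_bracket a b) y) x"

text \<open>
  A structure of type \<open>'a vir_rep\<close> is a complex vector space, given as a module over the field of
  complex numbers, together with an action of the elements of the Virasoro algebra. The ring
  fields \<^const>\<open>monoid.mult\<close> and \<^const>\<open>one\<close> inherited from \<^typ>\<open>(complex, 'a) module\<close> are meaningful
  only for the associative algebras below.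
\<close>

record 'a vir_rep = "(complex, 'a) module" +
  act :: "vir \<Rightarrow> 'a \<Rightarrow> 'a"

locale vir_module = module complex_ring M for M :: "('a, 'm) vir_rep_scheme" (structure) +
  assumes act_closed: "v \<in> carrier M \<Longrightarrow> act M x v \<in> carrier M"
    and act_add: "\<lbrakk>v \<in> carrier M; w \<in> carrier M\<rbrakk> \<Longrightarrow> act M x (v \<oplus> w) = act M x v \<oplus> act M x w"
    and act_smult: "v \<in> carrier M \<Longrightarrow> act M x (a \<odot>\<^bsub>M\<^esub> v) = a \<odot>\<^bsub>M\<^esub> act M x v"
    and add_act: "v \<in> carrier M \<Longrightarrow> act M (x + y) v = act M x v \<oplus> act M y v"
    and scal_act: "v \<in> carrier M \<Longrightarrow> act M (scal a x) v = a \<odot>\<^bsub>M\<^esub> act M x v"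
    and bracket_act: "v \<in> carrier M \<Longrightarrow>
      act M (vir_bracket x y) v = act M x (act M y v) \<ominus> act M y (act M x v)"

definition vir_submodule :: "'a set \<Rightarrow> ('a, 'm) vir_rep_scheme \<Rightarrow> bool"
  where "vir_submodule N M \<longleftrightarrow>
    N \<subseteq> carrier M \<and> submodule N complex_ring M \<and> (\<forall>x. \<forall>v\<in>N. act M x v \<in> N)"

definition vir_hom :: "('a, 'm) vir_rep_scheme \<Rightarrow> ('b, 'n) vir_rep_scheme \<Rightarrow> ('a \<Rightarrow> 'b) set"
  where "vir_hom M N = {f \<in> carrier M \<rightarrow> carrier N.
    (\<forall>v\<in>carrier M. \<forall>w\<in>carrier M. f (v \<oplus>\<^bsub>M\<^esub> w) = f v \<oplus>\<^bsub>N\<^esub> f w) \<and>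
    (\<forall>a. \<forall>v\<in>carrier M. f (a \<odot>\<^bsub>M\<^esub> v) = a \<odot>\<^bsub>N\<^esub> f v) \<and>
    (\<forall>x. \<forall>v\<in>carrier M. f (act M x v) = act N x (f v))}"

definition vir_iso :: "('a, 'm) vir_rep_scheme \<Rightarrow> ('b, 'n) vir_rep_scheme \<Rightarrow> bool"
  where "vir_iso M N \<longleftrightarrow> (\<exists>f\<in>vir_hom M N. bij_betw f (carrier M) (carrier N))"

text \<open>
  The quotient by \<open>N\<close>, on the set of additive cosets: a quotient algebra if \<open>N\<close> is an ideal, a
  quotient module if \<open>N\<close> is a submodule.
\<close>

definition quot :: "('a, 'm) vir_rep_scheme \<Rightarrow> 'a set \<Rightarrow> 'a set vir_rep"
  where "quot M N =
    \<lparr>carrier = a_rcosets\<^bsub>M\<^esub> N, monoid.mult = rcoset_mult M N, one = N +>\<^bsub>M\<^esub> \<one>\<^bsub>M\<^esub>, zero = N,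
     add = set_add M,
     module.smult = (\<lambda>a A. \<Union>v\<in>A. N +>\<^bsub>M\<^esub> (a \<odot>\<^bsub>M\<^esub> v)),
     act = (\<lambda>x A. \<Union>v\<in>A. N +>\<^bsub>M\<^esub> act M x v)\<rparr>"


section \<open>Tensor products\<close>

text \<open>The space with basis \<open>S\<close> and with the action that \<open>\<rho>\<close> prescribes on basis vectors.\<close>

definition free_rep :: "'a set \<Rightarrow> (vir \<Rightarrow> 'a \<Rightarrow> 'a lincomb) \<Rightarrow> 'a lincomb vir_rep"
  where "free_rep S \<rho> =
    \<lparr>carrier = {p. Poly_Mapping.keys p \<subseteq> S}, monoid.mult = undefined, one = undefined, zero = 0,
     add = (+), module.smult = scal, act = (\<lambda>x. lin_ext (\<rho> x))\<rparr>"

definition subspace_gen :: "('a, 'm) vir_rep_scheme \<Rightarrow> 'a set \<Rightarrow> 'a set"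
  where "subspace_gen M A = \<Inter>{H. submodule H complex_ring M \<and> A \<subseteq> H}"

definition tensor_rels ::
  "('a, 'm) vir_rep_scheme \<Rightarrow> ('b, 'n) vir_rep_scheme \<Rightarrow> ('a \<times> 'b) lincomb set"
  where "tensor_rels V W =
    {bvec (v \<oplus>\<^bsub>V\<^esub> v', w) - bvec (v, w) - bvec (v', w) | v v' w.
       v \<in> carrier V \<and> v' \<in> carrier V \<and> w \<in> carrier W}
    \<union> {bvec (v, w \<oplus>\<^bsub>W\<^esub> w') - bvec (v, w) - bvec (v, w') | v w w'.
       v \<in> carrier V \<and> w \<in> carrier W \<and> w' \<in> carrier W}
    \<union> {bvec (a \<odot>\<^bsub>V\<^esub> v, w) - scal a (bvec (v, w)) | a v w. v \<in> carrier V \<and> w \<in> carrier W}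
    \<union> {bvec (v, a \<odot>\<^bsub>W\<^esub> w) - scal a (bvec (v, w)) | a v w. v \<in> carrier V \<and> w \<in> carrier W}"

definition vir_tensor ::
  "('a, 'm) vir_rep_scheme \<Rightarrow> ('b, 'n) vir_rep_scheme \<Rightarrow> ('a \<times> 'b) lincomb set vir_rep"
  where "vir_tensor V W =
    (let F = free_rep (carrier V \<times> carrier W)
               (\<lambda>x (v, w). bvec (act V x v, w) + bvec (v, act W x w))
     in quot F (subspace_gen F (tensor_rels V W)))"


section \<open>Universal enveloping algebras\<close>

datatype 'a free_word = Free_Word (letters: "'a list")

instantiation free_word :: (type) monoid_add
begin

definition zero_free_word :: "'a free_word"
  where "0 = Free_Word []"

definition plus_free_word :: "'a free_word \<Rightarrow> 'a free_word \<Rightarrow> 'a free_word"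
  where "u + v = Free_Word (letters u @ letters v)"

instance
  by standard (simp_all add: zero_free_word_def plus_free_word_def)

end

abbreviation letter :: "vir \<Rightarrow> vir free_word lincomb"
  where "letter x \<equiv> bvec (Free_Word [x])"

text \<open>
  For a Lie subalgebra \<open>g\<close> of the Virasoro algebra, the free associative algebra on the
  underlying set of \<open>g\<close>. Its product is the convolution product of \<^typ>\<open>vir free_word lincomb\<close>.
  Dividing out the relations that make \<^const>\<open>letter\<close> linear gives the tensor algebra of \<open>g\<close>;
  the remaining relations in \<open>env_rels\<close> then give the universal enveloping algebra.
\<close>

definition free_alg :: "vir set \<Rightarrow> vir free_word lincomb vir_rep"
  where "free_alg g =
    \<lparr>carrier = {p. \<forall>w\<in>Poly_Mapping.keys p. set (letters w) \<subseteq> g},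
     monoid.mult = (*), one = 1, zero = 0, add = (+), module.smult = scal,
     act = (\<lambda>x p. letter x * p)\<rparr>"

definition env_rels :: "vir set \<Rightarrow> vir free_word lincomb set"
  where "env_rels g =
    {letter (x + y) - letter x - letter y | x y. x \<in> g \<and> y \<in> g}
    \<union> {letter (scal a x) - scal a (letter x) | a x. x \<in> g}
    \<union> {letter x * letter y - letter y * letter x - letter (vir_bracket x y) | x y. x \<in> g \<and> y \<in> g}"

definition env_ideal :: "vir set \<Rightarrow> vir free_word lincomb set"
  where "env_ideal g = Idl\<^bsub>free_alg g\<^esub> (env_rels g)"

definition env :: "vir set \<Rightarrow> vir free_word lincomb set vir_rep"
  where "env g = quot (free_alg g) (env_ideal g)"

text \<open>The homomorphism from \<open>env g\<close> to \<open>env UNIV\<close> induced by the inclusion of \<open>g\<close>.\<close>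

definition env_incl :: "vir free_word lincomb set \<Rightarrow> vir free_word lincomb set"
  where "env_incl A = (\<Union>p\<in>A. env_ideal UNIV +>\<^bsub>free_alg UNIV\<^esub> p)"

definition free_alg_act :: "('a, 'm) vir_rep_scheme \<Rightarrow> vir free_word lincomb \<Rightarrow> 'a \<Rightarrow> 'a"
  where "free_alg_act W p v =
    (\<Oplus>\<^bsub>W\<^esub>w\<in>Poly_Mapping.keys p. Poly_Mapping.lookup p w \<odot>\<^bsub>W\<^esub> foldr (act W) (letters w) v)"

text \<open>
  The action of \<open>env g\<close> on a \<open>g\<close>-module \<open>W\<close>; all representatives of a coset act in the same way.
\<close>

definition env_act :: "('a, 'm) vir_rep_scheme \<Rightarrow> vir free_word lincomb set \<Rightarrow> 'a \<Rightarrow> 'a"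
  where "env_act W A v = the_elem ((\<lambda>p. free_alg_act W p v) ` A)"

text \<open>
  The induced module \<open>U(Vir) \<otimes>\<^bsub>U(g)\<^esub> W\<close> for a \<open>g\<close>-module \<open>W\<close>, as the quotient of the complex
  tensor product by the relations that identify \<open>y b \<otimes> w\<close> with \<open>y \<otimes> b w\<close> for \<open>b\<close> in \<open>U(g)\<close>.
  Only the action of \<open>g\<close> on \<open>W\<close> enters.
\<close>

definition balance_rels ::
  "vir set \<Rightarrow> ('a, 'm) vir_rep_scheme \<Rightarrow> (vir free_word lincomb set \<times> 'a) lincomb set"
  where "balance_rels g W =
    {bvec (y \<otimes>\<^bsub>env UNIV\<^esub> env_incl b, w) - bvec (y, env_act W b w) | y b w.
       y \<in> carrier (env UNIV) \<and> b \<in> carrier (env g) \<and> w \<in> carrier W}"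

definition induced ::
  "vir set \<Rightarrow> ('a, 'm) vir_rep_scheme \<Rightarrow> (vir free_word lincomb set \<times> 'a) lincomb set vir_rep"
  where "induced g W =
    (let F = free_rep (carrier (env UNIV) \<times> carrier W) (\<lambda>x (y, w). bvec (act (env UNIV) x y, w))
     in quot F (subspace_gen F (tensor_rels (env UNIV) W \<union> balance_rels g W)))"


section \<open>Highest weight modules\<close>

definition borel :: "vir set"
  where "borel = {x. Poly_Mapping.keys x \<subseteq> insert gen_C (gen_d ` {0..})}"

text \<open>The module \<open>\<complex>u\<close> over \<^const>\<open>borel\<close>, with \<open>u = 1\<close>.\<close>

definition borel_line :: "complex \<Rightarrow> complex \<Rightarrow> complex vir_rep"
  where "borel_line c h =
    \<lparr>carrier = UNIV, monoid.mult = (*), one = 1, zero = 0, add = (+), module.smult = (*),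
     act = (\<lambda>x z. (h * Poly_Mapping.lookup x (gen_d 0) + c * Poly_Mapping.lookup x gen_C) * z)\<rparr>"

type_synonym verma_carrier = "(vir free_word lincomb set \<times> complex) lincomb set"

definition verma :: "complex \<Rightarrow> complex \<Rightarrow> verma_carrier vir_rep"
  where "verma c h = induced borel (borel_line c h)"

definition highest_weight_module :: "'a vir_rep \<Rightarrow> bool"
  where "highest_weight_module V \<longleftrightarrow>
    vir_module V \<and> carrier V \<noteq> {\<zero>\<^bsub>V\<^esub>} \<and>
    (\<exists>c h N. vir_submodule N (verma c h) \<and> vir_iso V (quot (verma c h) N))"


section \<open>Intermediate series modules\<close>

text \<open>The vector \<open>v\<^sub>n\<close> is \<open>bvec n\<close>.\<close>

fun series_basis_act :: "complex \<Rightarrow> complex \<Rightarrow> vir_basis \<Rightarrow> int \<Rightarrow> int lincomb" where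
  "series_basis_act \<alpha> \<beta> (gen_d m) n = scal (\<alpha> + of_int n + of_int m * \<beta>) (bvec (m + n))"
| "series_basis_act \<alpha> \<beta> gen_C n = 0"

definition int_series :: "complex \<Rightarrow> complex \<Rightarrow> int lincomb vir_rep"
  where "int_series \<alpha> \<beta> = free_rep UNIV (\<lambda>x n. lin_ext (\<lambda>g. series_basis_act \<alpha> \<beta> g n) x)"

text \<open>
  So that all the modules \<open>V'\<^bsub>\<alpha>,\<beta>\<^esub>\<close> have the same type, for \<open>(\<alpha>, \<beta>) \<noteq> (0, 0)\<close> the module
  \<^term>\<open>int_series \<alpha> \<beta>\<close> is replaced by its quotient by the zero submodule, to which it is
  isomorphic (\<open>int_series_iso_int_series'\<close> below).
\<close>

definition int_series' :: "complex \<Rightarrow> complex \<Rightarrow> int lincomb set vir_rep"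
  where "int_series' \<alpha> \<beta> =
    quot (int_series \<alpha> \<beta>) (if \<alpha> = 0 \<and> \<beta> = 0 then {scal z (bvec 0) | z. True} else {0})"

lemma int_series_iso_int_series':
  assumes "(\<alpha>, \<beta>) \<noteq> (0, 0)"
  shows "vir_iso (int_series \<alpha> \<beta>) (int_series' \<alpha> \<beta>)"
  unfolding vir_iso_def
proof
  have Q: "int_series' \<alpha> \<beta> = quot (int_series \<alpha> \<beta>) {0}"
    using assms by (auto simp: int_series'_def)
  show "(\<lambda>v. {v}) \<in> vir_hom (int_series \<alpha> \<beta>) (int_series' \<alpha> \<beta>)"
    unfolding Q vir_hom_def
    by (auto simp: quot_def int_series_def free_rep_def A_RCOSETS_def' a_r_coset_def' set_add_def')
  show "bij_betw (\<lambda>v. {v}) (carrier (int_series \<alpha> \<beta>)) (carrier (int_series' \<alpha> \<beta>))"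
    unfolding Q
    by (auto simp: bij_betw_def inj_on_def quot_def int_series_def free_rep_def A_RCOSETS_def'
        a_r_coset_def')
qed

end

theory Submission
  imports Defs
begin

section \<open>Tensor products of highest weight and intermediate series modules\<close>

text \<open>
  Let \<open>u\<close> be a highest weight vector of \<open>V\<close> and let \<open>f\<close> be an isomorphism of the tensor products.
  Write \<open>f (u \<otimes> v\<^sub>k)\<close> as the sum of \<open>x\<^sub>k\<^sub>j \<otimes> v\<^sub>k\<^sub>+\<^sub>j\<close> over \<open>j\<close>. Every vector of a highest weight
  module is killed by \<open>d\<^sub>n\<close> for large \<open>n\<close>, so applying such a \<open>d\<^sub>n\<close> gives
  \<open>(\<alpha> + k + n \<beta>) x\<^sub>k\<^sub>+\<^sub>n\<^sub>,\<^sub>j = (\<alpha>\<^sub>1 + k + j + n \<beta>\<^sub>1) x\<^sub>k\<^sub>j\<close>. Comparing the step \<open>n + m\<close> with the steps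
  \<open>n\<close> and \<open>m\<close> yields a polynomial identity that forces \<open>\<alpha> = \<alpha>\<^sub>1\<close>, \<open>\<beta> = \<beta>\<^sub>1\<close> and \<open>j = 0\<close>; then
  \<open>x\<^sub>k\<^sub>0\<close> does not depend on \<open>k\<close>. The vectors \<open>y\<close> of \<open>V\<close> for which some \<open>z\<close> satisfies
  \<open>f (y \<otimes> w) = z \<otimes> w\<close> for all \<open>w\<close> form a submodule containing \<open>u\<close>, hence all of \<open>V\<close>, and
  \<open>y \<mapsto> z\<close> is an isomorphism.
\<close>

subsection \<open>Linear algebra\<close>

text \<open>Of \<open>V\<close> only a generating vector is at hand, no basis and no control of
  weights. Tensors are therefore analysed along the second factor alone, by the maps id \<otimes>
  \<open>coef i\<close> from \<open>V\<close> \<otimes> \<open>W\<close> to \<open>V\<close>; for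
  large n the operator d_n acts through \<open>W\<close> only, and this is what separates the two
  factors. The coefficients in the recursion may vanish, so it cannot be solved for the later
  components; the comparison of steps multiplies across instead of dividing. It yields \<alpha> + k
  = \<alpha>_1 + k + j, and the strip 0 \<le> Re < 1 splits this into \<alpha> = \<alpha>_1 and j =
  0. Excluding \<beta> = 1 is essential for recovering the parameters: for nonintegral \<alpha> the
  map v_n \<mapsto> (\<alpha> + n) v_n is an isomorphism from V_{\<alpha>,0} to V_{\<alpha>,1}. In
  V'_{0,0} the vector v_0 becomes zero. It is kept as a zero vector so that all modules are indexed
  by the integers, and index 1, which is never affected, serves as the reference index. Once the
  parameters agree, the two series modules are equal. The converse is functoriality of the tensor
  product.\<close>

lemma lookup_scal [simp]: "Poly_Mapping.lookup (scal a p) k = a * Poly_Mapping.lookup p k"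
  unfolding scal_def by (simp add: map.rep_eq when_def)

lemma scal_simps [simp]:
  "scal 1 p = p" "scal 0 p = 0" "scal a 0 = 0" "scal a (scal b p) = scal (a * b) p"
  by (auto intro!: poly_mapping_eqI)

lemma scal_add: "scal a (p + q) = scal a p + scal a q" "scal (a + b) p = scal a p + scal b p"
  by (auto intro!: poly_mapping_eqI simp: lookup_add algebra_simps)

lemma scal_minus_one: "scal (- 1) p = - p"
  by (auto intro!: poly_mapping_eqI)

lemma keys_scal_subset: "Poly_Mapping.keys (scal a p) \<subseteq> Poly_Mapping.keys p"
  by (auto simp: in_keys_iff)

lemma lookup_bvec: "Poly_Mapping.lookup (bvec a) b = (if a = b then 1 else 0)"
  by (simp add: bvec_def lookup_single when_def)

lemma keys_bvec [simp]: "Poly_Mapping.keys (bvec a) = {a}"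
  by (simp add: bvec_def)

lemma single_eq_scal_bvec: "Poly_Mapping.single s a = scal a (bvec s)"
  by (auto intro!: poly_mapping_eqI simp: lookup_bvec lookup_single when_def)

text \<open>Deleting one basis vector lowers the cardinality of the support. The support stays
  inside a fixed \<open>S\<close>, so the rule applies to elements of
  \<open>free_rep S\<close>.\<close>

lemma lincomb_induct [consumes 1, case_names zero add basis]:
  assumes "Poly_Mapping.keys p \<subseteq> S" and "P 0"
    and "\<And>p q. \<lbrakk>Poly_Mapping.keys p \<subseteq> S; Poly_Mapping.keys q \<subseteq> S; P p; P q\<rbrakk> \<Longrightarrow> P (p + q)"
    and "\<And>a s. s \<in> S \<Longrightarrow> P (scal a (bvec s))"
  shows "P p"
  using assms(1)
proof (induction "card (Poly_Mapping.keys p)" arbitrary: p)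
  case 0
  then have "Poly_Mapping.keys p = {}" by simp
  then show ?case using assms(2) by simp
next
  case (Suc n)
  then obtain s where s: "s \<in> Poly_Mapping.keys p" by fastforce
  define q where "q = p - Poly_Mapping.single s (Poly_Mapping.lookup p s)"
  have kq: "Poly_Mapping.keys q = Poly_Mapping.keys p - {s}"
    by (auto simp: q_def in_keys_iff lookup_minus lookup_single when_def split: if_splits)
  then have "n = card (Poly_Mapping.keys q)" "Poly_Mapping.keys q \<subseteq> S"
    using Suc s by auto
  then have "P q" using Suc by blast
  moreover have "p = q + scal (Poly_Mapping.lookup p s) (bvec s)"
    by (simp add: q_def single_eq_scal_bvec)
  ultimately show ?case
    using assms(3,4) s Suc.prems kq keys_scal_subset[of _ "bvec s"]
    by (metis Diff_subset dual_order.trans empty_subsetI insert_subset keys_bvec subsetD)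
qed

lemma lincomb_UNIV_induct [case_names zero add basis]:
  assumes "P 0" "\<And>p q. \<lbrakk>P p; P q\<rbrakk> \<Longrightarrow> P (p + q)" "\<And>a s. P (scal a (bvec s))"
  shows "P p"
  using lincomb_induct[of p UNIV P] assms by simp

text \<open>Supports shrink under cancellation; summing over a common finite superset makes
  additivity a termwise matter.\<close>

lemma lin_ext_superset:
  assumes "finite A" and "Poly_Mapping.keys p \<subseteq> A"
  shows "lin_ext f p = (\<Sum>a\<in>A. scal (Poly_Mapping.lookup p a) (f a))"
  unfolding lin_ext_def using assms
  by (intro sum.mono_neutral_left) (auto simp: in_keys_iff)

lemma lin_ext_zero [simp]: "lin_ext f 0 = 0"
  by (simp add: lin_ext_def)

lemma lin_ext_add: "lin_ext f (p + q) = lin_ext f p + lin_ext f q"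
proof -
  let ?A = "Poly_Mapping.keys p \<union> Poly_Mapping.keys q"
  have "lin_ext f (p + q) = (\<Sum>a\<in>?A. scal (Poly_Mapping.lookup (p + q) a) (f a))"
    by (intro lin_ext_superset) (auto simp: Poly_Mapping.keys_add)
  then show ?thesis
    by (simp add: lin_ext_superset[of ?A p] lin_ext_superset[of ?A q] lookup_add scal_add
        sum.distrib)
qed

lemma scal_sum: "scal a (sum f A) = (\<Sum>i\<in>A. scal a (f i))"
  by (induction A rule: infinite_finite_induct) (auto simp: scal_add)

lemma lin_ext_scal: "lin_ext f (scal a p) = scal a (lin_ext f p)"
  by (subst lin_ext_superset[of "Poly_Mapping.keys p"])
    (auto simp: keys_scal_subset lin_ext_def scal_sum)

lemma lin_ext_bvec [simp]: "lin_ext f (bvec a) = f a"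
  by (simp add: lin_ext_def lookup_bvec)

lemma lin_ext_diff: "lin_ext f (p - q) = lin_ext f p - lin_ext f q"
  using lin_ext_add[of f p "- q"] lin_ext_scal[of f "- 1" q] by (simp add: scal_minus_one)

lemma keys_lin_ext:
  assumes "\<And>s. s \<in> Poly_Mapping.keys p \<Longrightarrow> Poly_Mapping.keys (f s) \<subseteq> S"
  shows "Poly_Mapping.keys (lin_ext f p) \<subseteq> S"
  unfolding lin_ext_def using assms keys_scal_subset keys_sum by fastforce

section \<open>Vector spaces with a linear operator for each element of Vir\<close>

lemma complex_ring_simps [simp]:
  "carrier complex_ring = UNIV" "monoid.mult complex_ring = (*)" "one complex_ring = 1"
  "add complex_ring = (+)" "zero complex_ring = 0"
  by (simp_all add: ring_of_type_algebra_def)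

text \<open>Keeps of \<open>vir_module\<close> only the linearity of each operator. Quotients and
  tensor products can then be formed and compared without checking linearity in \<open>x\<close> or
  the bracket relation for every constructed space.\<close>

locale linear_rep = module complex_ring M for M :: "('a, 'm) vir_rep_scheme" (structure) +
  assumes act_closed: "v \<in> carrier M \<Longrightarrow> act M x v \<in> carrier M"
    and act_add: "\<lbrakk>v \<in> carrier M; w \<in> carrier M\<rbrakk> \<Longrightarrow> act M x (v \<oplus> w) = act M x v \<oplus> act M x w"
    and act_smult: "v \<in> carrier M \<Longrightarrow> act M x (a \<odot>\<^bsub>M\<^esub> v) = a \<odot>\<^bsub>M\<^esub> act M x v"

lemma (in vir_module) linear_rep: "linear_rep M"
  by unfold_locales (simp_all add: act_closed act_add act_smult)

context linear_rep
begin

lemmas smult_closed' = smult_closed[simplified]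

lemma smult_minus: "x \<in> carrier M \<Longrightarrow> (- 1) \<odot>\<^bsub>M\<^esub> x = \<ominus> x"
  using smult_l_distr[of 1 "- 1" x] smult_one[of x] smult_l_null[of x] smult_closed[of "- 1" x]
  by (metis M.minus_equality M.a_comm UNIV_I add.right_inverse complex_ring_simps)

text \<open>Closure under negatives is scaling by -1, so it drops out of the criterion.\<close>

lemma submodule_iff: "submodule H complex_ring M \<longleftrightarrow>
    H \<subseteq> carrier M \<and> \<zero> \<in> H \<and> (\<forall>a\<in>H. \<forall>b\<in>H. a \<oplus> b \<in> H) \<and> (\<forall>c. \<forall>a\<in>H. c \<odot>\<^bsub>M\<^esub> a \<in> H)"
  (is "?L \<longleftrightarrow> ?R")
proof
  assume L: ?L
  then have "\<zero> \<in> H"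
    using subgroup.one_closed[OF submodule.axioms(1)[OF L]] by simp
  with submoduleE[OF L] show ?R by auto
next
  assume R: ?R
  show ?L
  proof (rule submoduleI)
    fix a assume "a \<in> H"
    with R have "(- 1) \<odot>\<^bsub>M\<^esub> a \<in> H" "a \<in> carrier M" by auto
    then show "\<ominus> a \<in> H" using smult_minus by metis
  qed (use R in auto)
qed

lemma subspace_gen_submodule:
  assumes "A \<subseteq> carrier M"
  shows "submodule (subspace_gen M A) complex_ring M" and "A \<subseteq> subspace_gen M A"
proof -
  have "carrier M \<in> {H. submodule H complex_ring M \<and> A \<subseteq> H}"
    using carrier_is_submodule assms by blast
  then show "submodule (subspace_gen M A) complex_ring M"
    unfolding subspace_gen_def submodule_iff by blast
  show "A \<subseteq> subspace_gen M A"
    unfolding subspace_gen_def by blast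
qed

lemma subspace_gen_least: "\<lbrakk>submodule H complex_ring M; A \<subseteq> H\<rbrakk> \<Longrightarrow> subspace_gen M A \<subseteq> H"
  unfolding subspace_gen_def by blast

lemma act_zero: "act M x \<zero> = \<zero>"
  using act_smult[of \<zero> x 0] by (simp add: act_closed smult_l_null[simplified])

text \<open>The vectors of the span that every operator sends back into the span form a subspace
  containing \<open>A\<close>; by minimality this is the whole span. So invariance has to be checked
  on generators only.\<close>

lemma subspace_gen_vir_submodule:
  assumes "A \<subseteq> carrier M" and "\<And>x a. a \<in> A \<Longrightarrow> act M x a \<in> subspace_gen M A"
  shows "vir_submodule (subspace_gen M A) M"
proof -
  let ?K = "subspace_gen M A"
  have K: "submodule ?K complex_ring M" "A \<subseteq> ?K"
    using subspace_gen_submodule assms by auto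
  have "submodule {a \<in> ?K. \<forall>x. act M x a \<in> ?K} complex_ring M"
    using K(1) unfolding submodule_iff
    by (auto simp: act_zero act_add act_smult subset_eq)
  then have "?K \<subseteq> {a \<in> ?K. \<forall>x. act M x a \<in> ?K}"
    using assms K by (intro subspace_gen_least) auto
  with K show ?thesis unfolding vir_submodule_def submodule_iff by blast
qed

end

context linear_rep
begin

lemma smult_left_cancel: "\<lbrakk>v \<in> carrier M; w \<in> carrier M; c \<noteq> 0; c \<odot>\<^bsub>M\<^esub> v = c \<odot>\<^bsub>M\<^esub> w\<rbrakk> \<Longrightarrow> v = w"
proof -
  assume *: "v \<in> carrier M" "w \<in> carrier M" "c \<noteq> 0" "c \<odot>\<^bsub>M\<^esub> v = c \<odot>\<^bsub>M\<^esub> w"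
  then have "(inverse c * c) \<odot>\<^bsub>M\<^esub> v = (inverse c * c) \<odot>\<^bsub>M\<^esub> w"
    using smult_assoc1[of "inverse c" c] by simp
  with * show "v = w" using smult_one by simp
qed

text \<open>Turns an identity between multiples of one nonzero vector into an identity of
  scalars.\<close>

lemma smult_right_cancel:
  assumes "v \<in> carrier M" "v \<noteq> \<zero>" "a \<odot>\<^bsub>M\<^esub> v = b \<odot>\<^bsub>M\<^esub> v"
  shows "a = b"
proof (rule ccontr)
  assume "a \<noteq> b"
  have "(a - b) \<odot>\<^bsub>M\<^esub> v \<oplus> b \<odot>\<^bsub>M\<^esub> v = a \<odot>\<^bsub>M\<^esub> v"
    using smult_l_distr[of "a - b" b v] assms(1) by simp
  then have "(a - b) \<odot>\<^bsub>M\<^esub> v = (a - b) \<odot>\<^bsub>M\<^esub> \<zero>"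
    using assms smult_closed' smult_r_null by simp
  then show False
    using smult_left_cancel[of v \<zero> "a - b"] assms \<open>a \<noteq> b\<close> by simp
qed

end

section \<open>Linear maps and equivariant maps\<close>

definition lin_hom :: "('a, 'm) vir_rep_scheme \<Rightarrow> ('b, 'n) vir_rep_scheme \<Rightarrow> ('a \<Rightarrow> 'b) set"
  where "lin_hom M N = {f \<in> carrier M \<rightarrow> carrier N.
    (\<forall>v\<in>carrier M. \<forall>w\<in>carrier M. f (v \<oplus>\<^bsub>M\<^esub> w) = f v \<oplus>\<^bsub>N\<^esub> f w) \<and>
    (\<forall>a. \<forall>v\<in>carrier M. f (a \<odot>\<^bsub>M\<^esub> v) = a \<odot>\<^bsub>N\<^esub> f v)}"

lemma lin_homD:
  assumes "f \<in> lin_hom M N"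
  shows "v \<in> carrier M \<Longrightarrow> f v \<in> carrier N"
    and "\<lbrakk>v \<in> carrier M; w \<in> carrier M\<rbrakk> \<Longrightarrow> f (v \<oplus>\<^bsub>M\<^esub> w) = f v \<oplus>\<^bsub>N\<^esub> f w"
    and "v \<in> carrier M \<Longrightarrow> f (a \<odot>\<^bsub>M\<^esub> v) = a \<odot>\<^bsub>N\<^esub> f v"
  using assms by (auto simp: lin_hom_def)

lemma vir_hom_iff: "f \<in> vir_hom M N \<longleftrightarrow>
    f \<in> lin_hom M N \<and> (\<forall>x. \<forall>v\<in>carrier M. f (act M x v) = act N x (f v))"
  by (auto simp: vir_hom_def lin_hom_def)

lemma lin_hom_zero:
  assumes "linear_rep M" "linear_rep N" "f \<in> lin_hom M N"
  shows "f \<zero>\<^bsub>M\<^esub> = \<zero>\<^bsub>N\<^esub>"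
proof -
  interpret M: linear_rep M by fact
  interpret N: linear_rep N by fact
  have "f (0 \<odot>\<^bsub>M\<^esub> \<zero>\<^bsub>M\<^esub>) = 0 \<odot>\<^bsub>N\<^esub> f \<zero>\<^bsub>M\<^esub>"
    using lin_homD[OF assms(3)] by blast
  then show ?thesis
    using M.smult_l_null[of "\<zero>\<^bsub>M\<^esub>"] N.smult_l_null[of "f \<zero>\<^bsub>M\<^esub>"] lin_homD[OF assms(3)] by simp
qed

lemma lin_hom_vimage:
  assumes "linear_rep M" "linear_rep N" "f \<in> lin_hom M N" "submodule H complex_ring N"
  shows "submodule {v \<in> carrier M. f v \<in> H} complex_ring M"
proof -
  interpret M: linear_rep M by fact
  interpret N: linear_rep N by fact
  show ?thesis
    using assms(4) lin_homD[OF assms(3)] lin_hom_zero[OF assms(1-3)]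
    unfolding M.submodule_iff N.submodule_iff
    by (auto simp: M.smult_closed')
qed

text \<open>Two linear maps are shown to agree by exhibiting a spanning set inside this
  subspace.\<close>

lemma lin_hom_equalizer:
  assumes "linear_rep M" "linear_rep N" "f \<in> lin_hom M N" "g \<in> lin_hom M N"
  shows "submodule {v \<in> carrier M. f v = g v} complex_ring M"
proof -
  interpret M: linear_rep M by fact
  show ?thesis
    using lin_homD[OF assms(3)] lin_hom_zero[OF assms(1-3)]
      lin_homD[OF assms(4)] lin_hom_zero[OF assms(1,2,4)]
    unfolding M.submodule_iff by (auto simp: M.smult_closed')
qed

lemma lin_hom_id: "(\<lambda>v. v) \<in> lin_hom M M"
  by (simp add: lin_hom_def)

lemma lin_hom_comp:
  "\<lbrakk>f \<in> lin_hom M N; g \<in> lin_hom N P\<rbrakk> \<Longrightarrow> (\<lambda>v. g (f v)) \<in> lin_hom M P"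
  by (auto simp: lin_hom_def Pi_iff)

lemma vir_hom_comp:
  "\<lbrakk>f \<in> vir_hom M N; g \<in> vir_hom N P\<rbrakk> \<Longrightarrow> (\<lambda>v. g (f v)) \<in> vir_hom M P"
  by (auto simp: vir_hom_def Pi_iff)

lemma vir_iso_inverse:
  assumes "linear_rep M" "vir_iso M N"
  obtains f g where "f \<in> vir_hom M N" "g \<in> vir_hom N M"
    "\<And>v. v \<in> carrier M \<Longrightarrow> g (f v) = v" "\<And>v. v \<in> carrier N \<Longrightarrow> f (g v) = v"
proof -
  interpret M: linear_rep M by fact
  obtain f where f: "f \<in> vir_hom M N" "bij_betw f (carrier M) (carrier N)"
    using assms by (auto simp: vir_iso_def)
  define g where "g = inv_into (carrier M) f"
  have gf: "g (f v) = v" if "v \<in> carrier M" for v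
    using f that by (auto simp: g_def bij_betw_def)
  have fg: "f (g v) = v" "g v \<in> carrier M" if "v \<in> carrier N" for v
    using f that by (auto simp: g_def bij_betw_def f_inv_into_f inv_into_into)
  have "g \<in> vir_hom N M"
    unfolding vir_hom_def
  proof (intro CollectI conjI ballI allI Pi_I)
    fix v w assume v: "v \<in> carrier N" and w: "w \<in> carrier N"
    have "f (g v \<oplus>\<^bsub>M\<^esub> g w) = v \<oplus>\<^bsub>N\<^esub> w"
      using f(1) v w fg by (auto simp: vir_hom_def)
    then show "g (v \<oplus>\<^bsub>N\<^esub> w) = g v \<oplus>\<^bsub>M\<^esub> g w"
      using gf v w fg by (metis M.add.m_closed)
  next
    fix a v assume v: "v \<in> carrier N"
    have "f (a \<odot>\<^bsub>M\<^esub> g v) = a \<odot>\<^bsub>N\<^esub> v"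
      using f(1) v fg by (auto simp: vir_hom_def)
    then show "g (a \<odot>\<^bsub>N\<^esub> v) = a \<odot>\<^bsub>M\<^esub> g v"
      using gf v fg by (metis M.smult_closed')
  next
    fix x v assume v: "v \<in> carrier N"
    have "f (act M x (g v)) = act N x v"
      using f(1) v fg by (auto simp: vir_hom_def)
    then show "g (act N x v) = act M x (g v)"
      using gf v fg by (metis M.act_closed)
  qed (use fg in auto)
  with f gf fg show ?thesis using that by blast
qed

lemma vir_isoI:
  assumes "f \<in> vir_hom M N" "g \<in> vir_hom N M"
    "\<And>v. v \<in> carrier M \<Longrightarrow> g (f v) = v" "\<And>v. v \<in> carrier N \<Longrightarrow> f (g v) = v"
  shows "vir_iso M N"
  unfolding vir_iso_def
proof (rule bexI[OF _ assms(1)])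
  show "bij_betw f (carrier M) (carrier N)"
    using assms by (intro bij_betw_byWitness[where f' = g]) (auto simp: vir_hom_def)
qed

section \<open>Linear extension from a free space to an abstract module\<close>

definition mlift :: "('a, 'm) vir_rep_scheme \<Rightarrow> ('b \<Rightarrow> 'a) \<Rightarrow> 'b lincomb \<Rightarrow> 'a"
  where "mlift M f p = (\<Oplus>\<^bsub>M\<^esub>b\<in>Poly_Mapping.keys p. Poly_Mapping.lookup p b \<odot>\<^bsub>M\<^esub> f b)"

context linear_rep
begin

lemma mlift_superset:
  assumes "finite A" "Poly_Mapping.keys p \<subseteq> A" "f \<in> A \<rightarrow> carrier M"
  shows "mlift M f p = (\<Oplus>b\<in>A. Poly_Mapping.lookup p b \<odot>\<^bsub>M\<^esub> f b)"
  unfolding mlift_def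
proof (rule M.add.finprod_mono_neutral_cong_left)
  fix i assume "i \<in> A - Poly_Mapping.keys p"
  then have "Poly_Mapping.lookup p i = 0" "f i \<in> carrier M"
    using assms by (auto simp: in_keys_iff)
  then show "Poly_Mapping.lookup p i \<odot>\<^bsub>M\<^esub> f i = \<zero>"
    using smult_l_null by simp
qed (use assms in \<open>auto intro!: smult_closed'\<close>)

lemma mlift_closed:
  assumes "f \<in> S \<rightarrow> carrier M" "Poly_Mapping.keys p \<subseteq> S"
  shows "mlift M f p \<in> carrier M"
  unfolding mlift_def using assms by (intro M.finsum_closed) (auto intro!: smult_closed')

lemma mlift_add:
  assumes "f \<in> S \<rightarrow> carrier M" "Poly_Mapping.keys p \<subseteq> S" "Poly_Mapping.keys q \<subseteq> S"
  shows "mlift M f (p + q) = mlift M f p \<oplus> mlift M f q"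
proof -
  let ?A = "Poly_Mapping.keys p \<union> Poly_Mapping.keys q"
  have f: "f \<in> ?A \<rightarrow> carrier M" using assms by auto
  then have "(\<Oplus>b\<in>?A. Poly_Mapping.lookup (p + q) b \<odot>\<^bsub>M\<^esub> f b) =
      (\<Oplus>b\<in>?A. Poly_Mapping.lookup p b \<odot>\<^bsub>M\<^esub> f b \<oplus> Poly_Mapping.lookup q b \<odot>\<^bsub>M\<^esub> f b)"
    by (intro M.add.finprod_cong')
      (auto simp: lookup_add smult_l_distr[simplified] Pi_iff intro!: smult_closed' M.add.m_closed)
  also have "\<dots> = (\<Oplus>b\<in>?A. Poly_Mapping.lookup p b \<odot>\<^bsub>M\<^esub> f b)
      \<oplus> (\<Oplus>b\<in>?A. Poly_Mapping.lookup q b \<odot>\<^bsub>M\<^esub> f b)"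
    using f by (intro M.finsum_addf) (auto intro!: smult_closed')
  finally show ?thesis
    using f Poly_Mapping.keys_add[of p q] by (simp add: mlift_superset[of ?A])
qed

lemma mlift_scal:
  assumes "f \<in> S \<rightarrow> carrier M" "Poly_Mapping.keys p \<subseteq> S"
  shows "mlift M f (scal a p) = a \<odot>\<^bsub>M\<^esub> mlift M f p"
proof -
  let ?A = "Poly_Mapping.keys p"
  have f: "f \<in> ?A \<rightarrow> carrier M" using assms by auto
  have "mlift M f (scal a p) = (\<Oplus>b\<in>?A. Poly_Mapping.lookup (scal a p) b \<odot>\<^bsub>M\<^esub> f b)"
    using f by (intro mlift_superset) (auto simp: keys_scal_subset)
  also have "\<dots> = (\<Oplus>b\<in>?A. a \<odot>\<^bsub>M\<^esub> (Poly_Mapping.lookup p b \<odot>\<^bsub>M\<^esub> f b))"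
    using f smult_assoc1
    by (intro M.add.finprod_cong') (auto intro!: smult_closed')
  also have "\<dots> = a \<odot>\<^bsub>M\<^esub> mlift M f p"
    unfolding mlift_def using f
    by (intro finsum_smult_ldistr[symmetric]) (auto intro!: smult_closed')
  finally show ?thesis .
qed

lemma mlift_bvec: "f b \<in> carrier M \<Longrightarrow> mlift M f (bvec b) = f b"
  unfolding mlift_def by (simp add: lookup_bvec smult_closed' smult_one[simplified])

lemma mlift_zero [simp]: "mlift M f 0 = \<zero>"
  by (simp add: mlift_def)

end

lemma free_rep_simps [simp]:
  "carrier (free_rep S \<rho>) = {p. Poly_Mapping.keys p \<subseteq> S}" "zero (free_rep S \<rho>) = 0"
  "add (free_rep S \<rho>) = (+)" "module.smult (free_rep S \<rho>) = scal"
  "act (free_rep S \<rho>) = (\<lambda>x. lin_ext (\<rho> x))"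
  by (simp_all add: free_rep_def)

lemma cring_complex_ring: "cring complex_ring"
  by (rule cring_from_type_algebra)

lemma module_lincomb:
  fixes M :: "('b lincomb, 'm) vir_rep_scheme"
  assumes "add M = (+)" "zero M = 0" "module.smult M = scal" "0 \<in> carrier M"
    "\<And>p q. \<lbrakk>p \<in> carrier M; q \<in> carrier M\<rbrakk> \<Longrightarrow> p + q \<in> carrier M"
    "\<And>a p. p \<in> carrier M \<Longrightarrow> scal a p \<in> carrier M"
  shows "module complex_ring M"
proof (rule moduleI)
  show "abelian_group M"
  proof (rule abelian_groupI)
    fix p assume "p \<in> carrier M"
    then show "\<exists>q\<in>carrier M. q \<oplus>\<^bsub>M\<^esub> p = \<zero>\<^bsub>M\<^esub>"
      using assms by (intro bexI[of _ "scal (- 1) p"]) (simp add: assms scal_minus_one, metis assms(6) scal_minus_one)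
  qed (auto simp: assms add_ac)
qed (auto simp: assms scal_add cring_complex_ring)

lemma linear_rep_free_rep:
  assumes "\<And>x s. s \<in> S \<Longrightarrow> Poly_Mapping.keys (\<rho> x s) \<subseteq> S"
  shows "linear_rep (free_rep S \<rho>)"
proof (intro linear_rep.intro linear_rep_axioms.intro)
  show "module complex_ring (free_rep S \<rho>)"
    by (rule module_lincomb)
      (auto simp: dest: subsetD[OF Poly_Mapping.keys_add] subsetD[OF keys_scal_subset])
next
  fix x p assume "p \<in> carrier (free_rep S \<rho>)"
  then show "act (free_rep S \<rho>) x p \<in> carrier (free_rep S \<rho>)"
    using keys_lin_ext[of p "\<rho> x" S] assms by auto
qed (auto simp: lin_ext_add lin_ext_scal)

lemma (in linear_rep) mlift_lin_hom:
  assumes "f \<in> S \<rightarrow> carrier M"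
  shows "mlift M f \<in> lin_hom (free_rep S \<rho>) M"
  using mlift_closed[OF assms] mlift_add[OF assms] mlift_scal[OF assms]
  by (auto simp: lin_hom_def)

subsection \<open>Quotients\<close>

locale quot_rep = linear_rep M for M :: "('a, 'm) vir_rep_scheme" (structure) +
  fixes N
  assumes N: "vir_submodule N M"
begin

lemma N_closed: "N \<subseteq> carrier M" "\<zero> \<in> N" "\<lbrakk>a \<in> N; b \<in> N\<rbrakk> \<Longrightarrow> a \<oplus> b \<in> N" "a \<in> N \<Longrightarrow> c \<odot>\<^bsub>M\<^esub> a \<in> N"
  "a \<in> N \<Longrightarrow> act M x a \<in> N"
  using N unfolding vir_submodule_def submodule_iff by auto

sublocale abelian_subgroup N M
proof (rule abelian_subgroupI3)
  show "additive_subgroup N M"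
    using N by (auto simp: vir_submodule_def additive_subgroup_def intro: submodule.axioms)
  show "abelian_group M" by (rule M.abelian_group_axioms)
qed

lemma in_coset_iff: "p \<in> carrier M \<Longrightarrow> q \<in> N +> p \<longleftrightarrow> (\<exists>n\<in>N. q = n \<oplus> p)"
  by (auto simp: a_r_coset_def')

lemma coset_eqI: "\<lbrakk>p \<in> carrier M; q \<in> N +> p\<rbrakk> \<Longrightarrow> N +> q = N +> p"
  by (metis a_repr_independence' )

lemma coset_eq_iff:
  "\<lbrakk>p \<in> carrier M; q \<in> carrier M\<rbrakk> \<Longrightarrow> N +> p = N +> q \<longleftrightarrow> p \<in> N +> q"
  using coset_eqI a_rcos_self by metis

lemma quot_simps:
  "carrier (quot M N) = a_rcosets N" "zero (quot M N) = N" "add (quot M N) = set_add M"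
  by (simp_all add: quot_def)

lemma quot_cases:
  assumes "A \<in> carrier (quot M N)"
  obtains p where "p \<in> carrier M" "A = N +> p"
  using assms by (auto simp: quot_simps A_RCOSETS_def')

lemma coset_closed: "p \<in> carrier M \<Longrightarrow> N +> p \<in> carrier (quot M N)"
  by (auto simp: quot_simps A_RCOSETS_def')

lemma coset_add: "\<lbrakk>p \<in> carrier M; q \<in> carrier M\<rbrakk> \<Longrightarrow>
    N +> (p \<oplus> q) = (N +> p) \<oplus>\<^bsub>quot M N\<^esub> (N +> q)"
  by (simp add: quot_simps a_rcos_sum)

text \<open>The operations of \<open>quot\<close> are unions over all representatives of a coset. If
  the map respects cosets, every member of the union is the same coset.\<close>

lemma coset_union_const:
  assumes "p \<in> carrier M" "\<And>q. q \<in> N +> p \<Longrightarrow> f q \<in> N +> f p" "f p \<in> carrier M"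
  shows "(\<Union>q\<in>N +> p. N +> f q) = N +> f p"
proof -
  have "N +> f q = N +> f p" if "q \<in> N +> p" for q
    using coset_eqI assms that by metis
  then show ?thesis using a_rcos_self[OF assms(1)] by blast
qed

lemma coset_smult: "p \<in> carrier M \<Longrightarrow> N +> (a \<odot>\<^bsub>M\<^esub> p) = a \<odot>\<^bsub>quot M N\<^esub> (N +> p)"
  unfolding quot_def using N_closed smult_r_distr
  by (simp, intro coset_union_const[symmetric])
    (auto simp: in_coset_iff smult_closed' intro!: bexI[where P="\<lambda>n. _ n"] subsetD[OF N_closed(1)])

lemma coset_act: "p \<in> carrier M \<Longrightarrow> N +> (act M x p) = act (quot M N) x (N +> p)"
  unfolding quot_def using N_closed
  by (simp, intro coset_union_const[symmetric])
    (auto simp: in_coset_iff act_closed act_add subset_eq)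

lemma coset_zero_iff: "p \<in> carrier M \<Longrightarrow> N +> p = zero (quot M N) \<longleftrightarrow> p \<in> N"
  using coset_eq_iff[of p \<zero>] N_closed by (auto simp: quot_simps in_coset_iff subset_eq)

lemma linear_rep_quot: "linear_rep (quot M N)"
proof (intro linear_rep.intro linear_rep_axioms.intro moduleI)
  let ?Q = "quot M N"
  show "cring complex_ring" by (rule cring_complex_ring)
  have z: "\<zero>\<^bsub>?Q\<^esub> = N +> \<zero>"
    using N_closed(1) by (simp add: quot_simps)
  show "abelian_group ?Q"
  proof (rule abelian_groupI)
    fix A B assume "A \<in> carrier ?Q" "B \<in> carrier ?Q"
    then obtain a b where ab: "a \<in> carrier M" "b \<in> carrier M" "A = N +> a" "B = N +> b"
      by (metis quot_cases)
    then show "A \<oplus>\<^bsub>?Q\<^esub> B \<in> carrier ?Q"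
      by (simp add: coset_add[symmetric] coset_closed)
    show "A \<oplus>\<^bsub>?Q\<^esub> B = B \<oplus>\<^bsub>?Q\<^esub> A"
      using ab by (simp add: coset_add[symmetric] M.a_comm)
    fix C assume "C \<in> carrier ?Q"
    then obtain c where "c \<in> carrier M" "C = N +> c" by (metis quot_cases)
    then show "A \<oplus>\<^bsub>?Q\<^esub> B \<oplus>\<^bsub>?Q\<^esub> C = A \<oplus>\<^bsub>?Q\<^esub> (B \<oplus>\<^bsub>?Q\<^esub> C)"
      using ab by (simp add: coset_add[symmetric] M.a_assoc)
  next
    show "\<zero>\<^bsub>?Q\<^esub> \<in> carrier ?Q"
      unfolding z by (simp add: coset_closed)
    fix A assume "A \<in> carrier ?Q"
    then obtain a where a: "a \<in> carrier M" "A = N +> a" by (metis quot_cases)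
    then show "\<zero>\<^bsub>?Q\<^esub> \<oplus>\<^bsub>?Q\<^esub> A = A"
      unfolding z by (simp add: coset_add[symmetric])
    show "\<exists>B\<in>carrier ?Q. B \<oplus>\<^bsub>?Q\<^esub> A = \<zero>\<^bsub>?Q\<^esub>"
      unfolding z using a
      by (intro bexI[of _ "N +> (\<ominus> a)"]) (auto simp: coset_add[symmetric] coset_closed M.l_neg)
  qed
  fix a b :: complex and x A B assume "A \<in> carrier ?Q" "B \<in> carrier ?Q"
  then obtain p q where pq: "p \<in> carrier M" "q \<in> carrier M" "A = N +> p" "B = N +> q"
    by (metis quot_cases)
  show "act ?Q x (A \<oplus>\<^bsub>?Q\<^esub> B) = act ?Q x A \<oplus>\<^bsub>?Q\<^esub> act ?Q x B"
    using pq by (simp add: coset_add[symmetric] coset_act[symmetric] act_add act_closed)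
  show "a \<odot>\<^bsub>?Q\<^esub> (A \<oplus>\<^bsub>?Q\<^esub> B) = a \<odot>\<^bsub>?Q\<^esub> A \<oplus>\<^bsub>?Q\<^esub> a \<odot>\<^bsub>?Q\<^esub> B"
    using pq smult_r_distr[of a p q]
    by (simp add: coset_add[symmetric] coset_smult[symmetric] smult_closed')
next
  let ?Q = "quot M N"
  fix a b :: complex and x A assume "A \<in> carrier ?Q"
  then obtain p where p: "p \<in> carrier M" "A = N +> p"
    by (metis quot_cases)
  show "a \<odot>\<^bsub>?Q\<^esub> A \<in> carrier ?Q" "act ?Q x A \<in> carrier ?Q"
    using p by (simp_all add: coset_smult[symmetric] coset_act[symmetric] coset_closed smult_closed'
      act_closed)
  show "act ?Q x (a \<odot>\<^bsub>?Q\<^esub> A) = a \<odot>\<^bsub>?Q\<^esub> act ?Q x A"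
    using p by (simp add: coset_smult[symmetric] coset_act[symmetric] smult_closed' act_closed act_smult)
  show "(a \<oplus>\<^bsub>complex_ring\<^esub> b) \<odot>\<^bsub>?Q\<^esub> A = a \<odot>\<^bsub>?Q\<^esub> A \<oplus>\<^bsub>?Q\<^esub> b \<odot>\<^bsub>?Q\<^esub> A"
    using p smult_l_distr[of a b p]
    by (simp add: coset_smult[symmetric] coset_add[symmetric] smult_closed')
  show "(a \<otimes>\<^bsub>complex_ring\<^esub> b) \<odot>\<^bsub>?Q\<^esub> A = a \<odot>\<^bsub>?Q\<^esub> (b \<odot>\<^bsub>?Q\<^esub> A)"
    using p smult_assoc1[of a b p]
    by (simp add: coset_smult[symmetric] smult_closed')
  show "\<one>\<^bsub>complex_ring\<^esub> \<odot>\<^bsub>?Q\<^esub> A = A"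
    using p smult_one[of p] by (simp add: coset_smult[symmetric])
qed

lemma coset_hom: "(\<lambda>p. N +> p) \<in> vir_hom M (quot M N)"
  by (auto simp: vir_hom_def coset_closed coset_add coset_smult coset_act)

text \<open>Since \<open>f\<close> vanishes on \<open>N\<close>, it takes one value on each coset,
  so evaluating at any chosen representative is well defined.\<close>

lemma lin_hom_factor:
  assumes "linear_rep P" "f \<in> lin_hom M P" "\<And>n. n \<in> N \<Longrightarrow> f n = \<zero>\<^bsub>P\<^esub>"
  obtains g where "g \<in> lin_hom (quot M N) P" "\<And>p. p \<in> carrier M \<Longrightarrow> g (N +> p) = f p"
proof -
  interpret P: linear_rep P by fact
  define g where "g A = f (SOME p. p \<in> A)" for A
  have g: "g (N +> p) = f p" if p: "p \<in> carrier M" for p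
  proof -
    have "(SOME q. q \<in> N +> p) \<in> N +> p"
      using a_rcos_self[OF p] by (rule someI)
    then obtain n where "n \<in> N" "(SOME q. q \<in> N +> p) = n \<oplus> p"
      unfolding in_coset_iff[OF p] by blast
    then show ?thesis
      using assms p N_closed(1) lin_homD[OF assms(2)] by (auto simp: g_def subset_eq)
  qed
  have "g \<in> lin_hom (quot M N) P"
    unfolding lin_hom_def using lin_homD[OF assms(2)]
    by (auto elim!: quot_cases simp: g coset_add[symmetric] coset_smult[symmetric] smult_closed')
  with g show ?thesis using that by blast
qed

end

subsection \<open>Tensor products\<close>

lemma tensor_rels_intros:
  "\<lbrakk>v \<in> carrier V; v' \<in> carrier V; w \<in> carrier W\<rbrakk> \<Longrightarrow>
    bvec (v \<oplus>\<^bsub>V\<^esub> v', w) - bvec (v, w) - bvec (v', w) \<in> tensor_rels V W"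
  "\<lbrakk>v \<in> carrier V; w \<in> carrier W; w' \<in> carrier W\<rbrakk> \<Longrightarrow>
    bvec (v, w \<oplus>\<^bsub>W\<^esub> w') - bvec (v, w) - bvec (v, w') \<in> tensor_rels V W"
  "\<lbrakk>v \<in> carrier V; w \<in> carrier W\<rbrakk> \<Longrightarrow> bvec (a \<odot>\<^bsub>V\<^esub> v, w) - scal a (bvec (v, w)) \<in> tensor_rels V W"
  "\<lbrakk>v \<in> carrier V; w \<in> carrier W\<rbrakk> \<Longrightarrow> bvec (v, a \<odot>\<^bsub>W\<^esub> w) - scal a (bvec (v, w)) \<in> tensor_rels V W"
  unfolding tensor_rels_def by blast+

text \<open>Common form of the two constructions made from pairs: the tensor product (Leibniz
  action, \<open>R\<close> empty) and the Verma module (action on the left factor, \<open>R\<close>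
  the balancing relations). The last assumption makes the span of the relations invariant.\<close>

locale tensor_quot = V: linear_rep V + W: linear_rep W
  for V :: "('a, 'm) vir_rep_scheme" and W :: "('b, 'n) vir_rep_scheme" +
  fixes \<rho> :: "vir \<Rightarrow> 'a \<times> 'b \<Rightarrow> ('a \<times> 'b) lincomb" and R :: "('a \<times> 'b) lincomb set"
  assumes \<rho>_closed: "s \<in> carrier V \<times> carrier W \<Longrightarrow>
      Poly_Mapping.keys (\<rho> x s) \<subseteq> carrier V \<times> carrier W"
    and R_closed: "r \<in> R \<Longrightarrow> Poly_Mapping.keys r \<subseteq> carrier V \<times> carrier W"
    and rels_act: "r \<in> tensor_rels V W \<union> R \<Longrightarrow> lin_ext (\<rho> x) r \<in>
      subspace_gen (free_rep (carrier V \<times> carrier W) \<rho>) (tensor_rels V W \<union> R)"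
begin

definition F where "F = free_rep (carrier V \<times> carrier W) \<rho>"

definition K where "K = subspace_gen F (tensor_rels V W \<union> R)"

definition T where "T = quot F K"

text \<open>The pure tensor v \<otimes> w. Together with \<open>T_submodule_eq\<close> it hides the
  cosets of formal combinations from everything that follows.\<close>

definition t where "t v w = K +>\<^bsub>F\<^esub> bvec (v, w)"

lemma rels_closed: "tensor_rels V W \<union> R \<subseteq> carrier F"
proof -
  have "tensor_rels V W \<subseteq> carrier F"
    unfolding tensor_rels_def F_def
    by (auto simp: in_keys_iff lookup_minus lookup_bvec W.smult_closed' V.smult_closed'
        split: if_splits)
  then show ?thesis using R_closed by (auto simp: F_def)
qed

sublocale F: linear_rep F
  unfolding F_def using \<rho>_closed by (rule linear_rep_free_rep)

sublocale quot_rep F K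
  unfolding K_def using rels_closed rels_act
  by unfold_locales (intro F.subspace_gen_vir_submodule, auto simp: F_def)

lemma F_simps [simp]: "carrier F = {p. Poly_Mapping.keys p \<subseteq> carrier V \<times> carrier W}"
  "zero F = 0" "add F = (+)" "module.smult F = scal" "act F = (\<lambda>x. lin_ext (\<rho> x))"
  by (simp_all add: F_def)

lemma rels_subset: "tensor_rels V W \<subseteq> K"
  using F.subspace_gen_submodule(2)[OF rels_closed] by (auto simp: K_def)

lemma R_subset: "R \<subseteq> K"
  using F.subspace_gen_submodule(2)[OF rels_closed] by (auto simp: K_def)

sublocale T: linear_rep T
  unfolding T_def by (rule linear_rep_quot)

lemma coset_eq_diff:
  assumes "p - q \<in> K" "p \<in> carrier F" "q \<in> carrier F"
  shows "K +>\<^bsub>F\<^esub> p = K +>\<^bsub>F\<^esub> q"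
  using assms by (subst coset_eq_iff) (auto simp: in_coset_iff intro!: bexI[of _ "p - q"])

lemma t_closed: "\<lbrakk>v \<in> carrier V; w \<in> carrier W\<rbrakk> \<Longrightarrow> t v w \<in> carrier T"
  unfolding t_def T_def by (rule coset_closed) simp

lemma t_add_left:
  assumes "v \<in> carrier V" "v' \<in> carrier V" "w \<in> carrier W"
  shows "t (v \<oplus>\<^bsub>V\<^esub> v') w = t v w \<oplus>\<^bsub>T\<^esub> t v' w"
proof -
  have "bvec (v \<oplus>\<^bsub>V\<^esub> v', w) - bvec (v, w) - bvec (v', w) \<in> tensor_rels V W"
    by (rule tensor_rels_intros(1)[OF assms])
  then have "bvec (v \<oplus>\<^bsub>V\<^esub> v', w) - (bvec (v, w) + bvec (v', w)) \<in> K"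
    using rels_subset by (auto simp: diff_diff_eq)
  then have "K +>\<^bsub>F\<^esub> bvec (v \<oplus>\<^bsub>V\<^esub> v', w) = K +>\<^bsub>F\<^esub> (bvec (v, w) + bvec (v', w))"
    using assms Poly_Mapping.keys_add[of "bvec (v, w)" "bvec (v', w)"]
    by (intro coset_eq_diff) auto
  then show ?thesis
    using assms coset_add[of "bvec (v, w)" "bvec (v', w)"] by (simp add: t_def T_def)
qed

lemma t_add_right:
  assumes "v \<in> carrier V" "w \<in> carrier W" "w' \<in> carrier W"
  shows "t v (w \<oplus>\<^bsub>W\<^esub> w') = t v w \<oplus>\<^bsub>T\<^esub> t v w'"
proof -
  have "bvec (v, w \<oplus>\<^bsub>W\<^esub> w') - bvec (v, w) - bvec (v, w') \<in> tensor_rels V W"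
    by (rule tensor_rels_intros(2)[OF assms])
  then have "bvec (v, w \<oplus>\<^bsub>W\<^esub> w') - (bvec (v, w) + bvec (v, w')) \<in> K"
    using rels_subset by (auto simp: diff_diff_eq)
  then have "K +>\<^bsub>F\<^esub> bvec (v, w \<oplus>\<^bsub>W\<^esub> w') = K +>\<^bsub>F\<^esub> (bvec (v, w) + bvec (v, w'))"
    using assms Poly_Mapping.keys_add[of "bvec (v, w)" "bvec (v, w')"]
    by (intro coset_eq_diff) auto
  then show ?thesis
    using assms coset_add[of "bvec (v, w)" "bvec (v, w')"] by (simp add: t_def T_def)
qed

lemma t_smult_left:
  assumes "v \<in> carrier V" "w \<in> carrier W"
  shows "t (a \<odot>\<^bsub>V\<^esub> v) w = a \<odot>\<^bsub>T\<^esub> t v w"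
proof -
  have "bvec (a \<odot>\<^bsub>V\<^esub> v, w) - scal a (bvec (v, w)) \<in> tensor_rels V W"
    by (rule tensor_rels_intros(3)[OF assms])
  then have "K +>\<^bsub>F\<^esub> bvec (a \<odot>\<^bsub>V\<^esub> v, w) = K +>\<^bsub>F\<^esub> scal a (bvec (v, w))"
    using assms rels_subset keys_scal_subset[of a "bvec (v, w)"]
    by (intro coset_eq_diff) (auto simp: V.smult_closed')
  then show ?thesis
    using assms coset_smult[of "bvec (v, w)"] by (simp add: t_def T_def)
qed

lemma t_smult_right:
  assumes "v \<in> carrier V" "w \<in> carrier W"
  shows "t v (a \<odot>\<^bsub>W\<^esub> w) = a \<odot>\<^bsub>T\<^esub> t v w"
proof -
  have "bvec (v, a \<odot>\<^bsub>W\<^esub> w) - scal a (bvec (v, w)) \<in> tensor_rels V W"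
    by (rule tensor_rels_intros(4)[OF assms])
  then have "K +>\<^bsub>F\<^esub> bvec (v, a \<odot>\<^bsub>W\<^esub> w) = K +>\<^bsub>F\<^esub> scal a (bvec (v, w))"
    using assms rels_subset keys_scal_subset[of a "bvec (v, w)"]
    by (intro coset_eq_diff) (auto simp: W.smult_closed')
  then show ?thesis
    using assms coset_smult[of "bvec (v, w)"] by (simp add: t_def T_def)
qed

lemma t_zero_left: "w \<in> carrier W \<Longrightarrow> t \<zero>\<^bsub>V\<^esub> w = \<zero>\<^bsub>T\<^esub>"
  using t_smult_left[of "\<zero>\<^bsub>V\<^esub>" w 0] t_closed[of "\<zero>\<^bsub>V\<^esub>" w]
  by (simp add: V.smult_l_null[simplified] T.smult_l_null[simplified])

lemma t_zero_right: "v \<in> carrier V \<Longrightarrow> t v \<zero>\<^bsub>W\<^esub> = \<zero>\<^bsub>T\<^esub>"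
  using t_smult_right[of v "\<zero>\<^bsub>W\<^esub>" 0] t_closed[of v "\<zero>\<^bsub>W\<^esub>"]
  by (simp add: W.smult_l_null[simplified] T.smult_l_null[simplified])

lemma act_t: "\<lbrakk>v \<in> carrier V; w \<in> carrier W\<rbrakk> \<Longrightarrow> act T x (t v w) = K +>\<^bsub>F\<^esub> \<rho> x (v, w)"
  using coset_act[of "bvec (v, w)" x] by (simp add: t_def T_def)

text \<open>Every class is represented by a finite combination of pairs, so the pure tensors span.
  This serves as the induction principle for tensors: a linear condition need only be checked on
  pure ones.\<close>

lemma T_submodule_eq:
  assumes H: "submodule H complex_ring T"
    and t: "\<And>v w. \<lbrakk>v \<in> carrier V; w \<in> carrier W\<rbrakk> \<Longrightarrow> t v w \<in> H"
  shows "H = carrier T"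
proof (rule antisym)
  show "H \<subseteq> carrier T" using H by (simp add: T.submodule_iff)
  show "carrier T \<subseteq> H"
  proof
    fix z assume "z \<in> carrier T"
    then obtain p where p: "Poly_Mapping.keys p \<subseteq> carrier V \<times> carrier W" "z = K +>\<^bsub>F\<^esub> p"
      by (auto simp: T_def elim: quot_cases)
    from p(1) have "K +>\<^bsub>F\<^esub> p \<in> H"
    proof (induction rule: lincomb_induct)
      case zero
      then show ?case using H[unfolded T.submodule_iff] coset_zero_iff[of 0] N_closed(2) by (auto simp: T_def)
    next
      case (add p q)
      then show ?case using H[unfolded T.submodule_iff] coset_add[of p q] by (auto simp: T_def)
    next
      case (basis a s)
      then show ?case
        using H[unfolded T.submodule_iff] coset_smult[of "bvec s" a] t[of "fst s" "snd s"]
        by (auto simp: T_def t_def)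
    qed
    with p show "z \<in> H" by simp
  qed
qed

end

lemma (in tensor_quot) t_left_hom: "w \<in> carrier W \<Longrightarrow> (\<lambda>v. t v w) \<in> lin_hom V T"
  by (simp add: lin_hom_def t_closed t_add_left t_smult_left)

lemma (in tensor_quot) t_right_hom: "v \<in> carrier V \<Longrightarrow> t v \<in> lin_hom W T"
  by (simp add: lin_hom_def t_closed t_add_right t_smult_right)

abbreviation leibniz ::
  "('a, 'm) vir_rep_scheme \<Rightarrow> ('b, 'n) vir_rep_scheme \<Rightarrow> vir \<Rightarrow> 'a \<times> 'b \<Rightarrow> ('a \<times> 'b) lincomb"
  where "leibniz V W \<equiv> \<lambda>x (v, w). bvec (act V x v, w) + bvec (v, act W x w)"

locale tensor = V: linear_rep V + W: linear_rep W
  for V :: "('a, 'm) vir_rep_scheme" and W :: "('b, 'n) vir_rep_scheme"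

text \<open>Each bilinearity relation is sent by the Leibniz action to a sum of two relations of the
  same kind, one from each Leibniz term.\<close>

sublocale tensor \<subseteq> tensor_quot V W "leibniz V W" "{}"
proof
  fix x and s :: "'a \<times> 'b" assume "s \<in> carrier V \<times> carrier W"
  then show "Poly_Mapping.keys (case s of (v, w) \<Rightarrow> bvec (act V x v, w) + bvec (v, act W x w))
      \<subseteq> carrier V \<times> carrier W"
    by (auto simp: V.act_closed W.act_closed dest!: subsetD[OF Poly_Mapping.keys_add])
next
  fix r x assume r: "r \<in> tensor_rels V W \<union> {}"
  let ?F = "free_rep (carrier V \<times> carrier W) (leibniz V W)"
  let ?K = "subspace_gen ?F (tensor_rels V W \<union> {})"
  interpret F: linear_rep ?F
    by (rule linear_rep_free_rep)
      (auto simp: V.act_closed W.act_closed dest!: subsetD[OF Poly_Mapping.keys_add])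
  have "tensor_rels V W \<subseteq> carrier ?F"
    unfolding tensor_rels_def
    by (auto simp: in_keys_iff lookup_minus lookup_bvec W.smult_closed' V.smult_closed'
        split: if_splits)
  then have K: "submodule ?K complex_ring ?F" "tensor_rels V W \<subseteq> ?K"
    using F.subspace_gen_submodule[of "tensor_rels V W"] by auto
  have sum: "p + q \<in> ?K" if "p \<in> tensor_rels V W" "q \<in> tensor_rels V W" for p q
    using K(1) subsetD[OF K(2) that(1)] subsetD[OF K(2) that(2)] by (auto simp: F.submodule_iff)
  from r consider
    (1) v v' w where "v \<in> carrier V" "v' \<in> carrier V" "w \<in> carrier W"
      "r = bvec (v \<oplus>\<^bsub>V\<^esub> v', w) - bvec (v, w) - bvec (v', w)"
  | (2) v w w' where "v \<in> carrier V" "w \<in> carrier W" "w' \<in> carrier W"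
      "r = bvec (v, w \<oplus>\<^bsub>W\<^esub> w') - bvec (v, w) - bvec (v, w')"
  | (3) a v w where "v \<in> carrier V" "w \<in> carrier W" "r = bvec (a \<odot>\<^bsub>V\<^esub> v, w) - scal a (bvec (v, w))"
  | (4) a v w where "v \<in> carrier V" "w \<in> carrier W" "r = bvec (v, a \<odot>\<^bsub>W\<^esub> w) - scal a (bvec (v, w))"
    unfolding tensor_rels_def by auto
  then have "\<exists>p\<in>tensor_rels V W. \<exists>q\<in>tensor_rels V W.
      lin_ext (\<lambda>(v, w). bvec (act V x v, w) + bvec (v, act W x w)) r = p + q"
  proof cases
    case 1
    show ?thesis
      by (rule bexI[of _ "bvec (act V x v \<oplus>\<^bsub>V\<^esub> act V x v', w) - bvec (act V x v, w) - bvec (act V x v', w)"],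
          rule bexI[of _ "bvec (v \<oplus>\<^bsub>V\<^esub> v', act W x w) - bvec (v, act W x w) - bvec (v', act W x w)"])
        (use 1 in \<open>auto simp: tensor_rels_def lin_ext_diff V.act_add intro: V.act_closed W.act_closed\<close>)
  next
    case 2
    show ?thesis
      by (rule bexI[of _ "bvec (act V x v, w \<oplus>\<^bsub>W\<^esub> w') - bvec (act V x v, w) - bvec (act V x v, w')"],
          rule bexI[of _ "bvec (v, act W x w \<oplus>\<^bsub>W\<^esub> act W x w') - bvec (v, act W x w) - bvec (v, act W x w')"])
        (use 2 in \<open>auto simp: tensor_rels_def lin_ext_diff W.act_add intro: V.act_closed W.act_closed\<close>)
  next
    case 3
    show ?thesis
      by (rule bexI[of _ "bvec (a \<odot>\<^bsub>V\<^esub> act V x v, w) - scal a (bvec (act V x v, w))"],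
          rule bexI[of _ "bvec (a \<odot>\<^bsub>V\<^esub> v, act W x w) - scal a (bvec (v, act W x w))"])
        (use 3 in \<open>auto simp: tensor_rels_def lin_ext_diff lin_ext_scal scal_add V.act_smult
           intro: V.act_closed W.act_closed\<close>)
  next
    case 4
    show ?thesis
      by (rule bexI[of _ "bvec (act V x v, a \<odot>\<^bsub>W\<^esub> w) - scal a (bvec (act V x v, w))"],
          rule bexI[of _ "bvec (v, a \<odot>\<^bsub>W\<^esub> act W x w) - scal a (bvec (v, act W x w))"])
        (use 4 in \<open>auto simp: tensor_rels_def lin_ext_diff lin_ext_scal scal_add W.act_smult
           intro: V.act_closed W.act_closed\<close>)
  qed
  then show "lin_ext (\<lambda>(v, w). bvec (act V x v, w) + bvec (v, act W x w)) r \<in> ?K"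
    using sum by auto
qed auto

context tensor
begin

lemma T_eq: "T = vir_tensor V W"
  by (simp add: T_def vir_tensor_def F_def K_def Let_def)

lemma act_t_leibniz:
  assumes "v \<in> carrier V" "w \<in> carrier W"
  shows "act T x (t v w) = t (act V x v) w \<oplus>\<^bsub>T\<^esub> t v (act W x w)"
  using assms act_t[OF assms] coset_add[of "bvec (act V x v, w)" "bvec (v, act W x w)"]
  by (simp add: t_def T_def V.act_closed W.act_closed)

text \<open>The universal property. Bilinearity of \<open>f\<close> says that its linear extension
  to the free space kills every relation; its kernel is a subspace and therefore contains
  \<open>K\<close>. Equivariance is not demanded, so the lemma also yields coordinate maps, which do
  not commute with the action.\<close>

lemma tensor_lift:
  assumes P: "linear_rep P"
    and f: "\<And>v w. \<lbrakk>v \<in> carrier V; w \<in> carrier W\<rbrakk> \<Longrightarrow> f v w \<in> carrier P"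
    and f_add_left: "\<And>v v' w. \<lbrakk>v \<in> carrier V; v' \<in> carrier V; w \<in> carrier W\<rbrakk> \<Longrightarrow>
      f (v \<oplus>\<^bsub>V\<^esub> v') w = f v w \<oplus>\<^bsub>P\<^esub> f v' w"
    and f_add_right: "\<And>v w w'. \<lbrakk>v \<in> carrier V; w \<in> carrier W; w' \<in> carrier W\<rbrakk> \<Longrightarrow>
      f v (w \<oplus>\<^bsub>W\<^esub> w') = f v w \<oplus>\<^bsub>P\<^esub> f v w'"
    and f_smult_left: "\<And>a v w. \<lbrakk>v \<in> carrier V; w \<in> carrier W\<rbrakk> \<Longrightarrow>
      f (a \<odot>\<^bsub>V\<^esub> v) w = a \<odot>\<^bsub>P\<^esub> f v w"
    and f_smult_right: "\<And>a v w. \<lbrakk>v \<in> carrier V; w \<in> carrier W\<rbrakk> \<Longrightarrow>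
      f v (a \<odot>\<^bsub>W\<^esub> w) = a \<odot>\<^bsub>P\<^esub> f v w"
  obtains g where "g \<in> lin_hom T P"
    "\<And>v w. \<lbrakk>v \<in> carrier V; w \<in> carrier W\<rbrakk> \<Longrightarrow> g (t v w) = f v w"
proof -
  interpret P: linear_rep P by fact
  let ?f = "case_prod f"
  have fS: "?f \<in> carrier V \<times> carrier W \<rightarrow> carrier P" using f by auto
  let ?h = "mlift P ?f"
  have h: "?h \<in> lin_hom F P" unfolding F_def using fS by (rule P.mlift_lin_hom)
  have h_b: "?h (bvec (v, w)) = f v w" if "v \<in> carrier V" "w \<in> carrier W" for v w
    using f that by (simp add: P.mlift_bvec)
  have h_minus: "?h (p - q) = ?h p \<ominus>\<^bsub>P\<^esub> ?h q" if "p \<in> carrier F" "q \<in> carrier F" for p q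
  proof -
    have "?h (p + scal (- 1) q) = ?h p \<oplus>\<^bsub>P\<^esub> (- 1) \<odot>\<^bsub>P\<^esub> ?h q"
      using lin_homD(2)[OF h, of p "scal (- 1) q"] lin_homD(3)[OF h, of q "- 1"]
        F.smult_closed'[of q "- 1"] that by (simp del: F_simps(1))
    then show ?thesis
      using P.smult_minus[of "?h q"] lin_homD(1)[OF h] that
      by (simp add: scal_minus_one a_minus_def)
  qed
  have kd: "Poly_Mapping.keys (p - q) \<subseteq> carrier V \<times> carrier W"
    if "Poly_Mapping.keys p \<subseteq> carrier V \<times> carrier W" "Poly_Mapping.keys q \<subseteq> carrier V \<times> carrier W"
    for p q :: "('a \<times> 'b) lincomb"
    using that Poly_Mapping.keys_diff[of p q] by blast
  have h_s: "?h (scal a (bvec (v, w))) = a \<odot>\<^bsub>P\<^esub> f v w" if "v \<in> carrier V" "w \<in> carrier W" for a v w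
    using lin_homD(3)[OF h, of "bvec (v, w)" a] that by (simp add: h_b)
  have ks: "Poly_Mapping.keys (scal a (bvec (v, w))) \<subseteq> carrier V \<times> carrier W"
    if "v \<in> carrier V" "w \<in> carrier W" for a v w
    using keys_scal_subset[of a "bvec (v, w)"] that by auto
  have add: "x \<oplus>\<^bsub>P\<^esub> y \<ominus>\<^bsub>P\<^esub> x \<ominus>\<^bsub>P\<^esub> y = \<zero>\<^bsub>P\<^esub>" if "x \<in> carrier P" "y \<in> carrier P" for x y
    using that by (simp add: P.a_comm[of x y] a_minus_def P.a_assoc[of y x] P.r_neg)
  have "?h r = \<zero>\<^bsub>P\<^esub>" if "r \<in> tensor_rels V W" for r
    using that unfolding tensor_rels_def
    by (auto simp: h_minus kd ks h_b h_s f f_add_left f_add_right f_smult_left f_smult_right add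
        V.smult_closed' W.smult_closed' P.smult_closed' P.r_neg a_minus_def[of _ "_ \<odot>\<^bsub>_\<^esub> _"])
  moreover have "submodule {\<zero>\<^bsub>P\<^esub>} complex_ring P"
    using P.smult_r_null by (simp add: P.submodule_iff)
  ultimately have "K \<subseteq> {p \<in> carrier F. ?h p \<in> {\<zero>\<^bsub>P\<^esub>}}"
    unfolding K_def using rels_closed
    by (intro F.subspace_gen_least lin_hom_vimage[OF F.linear_rep_axioms P h]) auto
  then obtain g where "g \<in> lin_hom T P" "\<And>p. p \<in> carrier F \<Longrightarrow> g (K +>\<^bsub>F\<^esub> p) = ?h p"
    using lin_hom_factor[OF P h] unfolding T_def by blast
  then show ?thesis using that h_b by (auto simp: t_def)
qed

end

text \<open>Functoriality. The tensors on which the lifted map commutes with all operators form a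
  subspace, and on pure tensors the Leibniz rule on both sides gives the claim.\<close>

lemma tensor_map:
  assumes "tensor V W" "tensor V' W'" "f \<in> vir_hom V V'" "g \<in> vir_hom W W'"
  obtains h where "h \<in> vir_hom (tensor_quot.T V W (leibniz V W) {}) (tensor_quot.T V' W' (leibniz V' W') {})"
    "\<And>v w. \<lbrakk>v \<in> carrier V; w \<in> carrier W\<rbrakk> \<Longrightarrow> h (tensor_quot.t V W (leibniz V W) {} v w) = tensor_quot.t V' W' (leibniz V' W') {} (f v) (g w)"
proof -
  interpret T: tensor V W by fact
  interpret T': tensor V' W' by fact
  note f = assms(3)[unfolded vir_hom_iff] and g = assms(4)[unfolded vir_hom_iff]
  note fD = lin_homD[OF conjunct1[OF f]] and gD = lin_homD[OF conjunct1[OF g]]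
  obtain h where h: "h \<in> lin_hom T.T T'.T"
    "\<And>v w. \<lbrakk>v \<in> carrier V; w \<in> carrier W\<rbrakk> \<Longrightarrow> h (T.t v w) = T'.t (f v) (g w)"
    by (rule T.tensor_lift[of T'.T "\<lambda>v w. T'.t (f v) (g w)"])
      (auto simp: T'.T.linear_rep_axioms T'.t_closed T'.t_add_left T'.t_add_right T'.t_smult_left
        T'.t_smult_right fD gD)
  have "{z \<in> carrier T.T. \<forall>x. h (act T.T x z) = act T'.T x (h z)} = carrier T.T"
  proof (rule T.T_submodule_eq)
    show "submodule {z \<in> carrier T.T. \<forall>x. h (act T.T x z) = act T'.T x (h z)} complex_ring T.T"
      using lin_homD[OF h(1)] lin_hom_zero[OF T.T.linear_rep_axioms T'.T.linear_rep_axioms h(1)]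
      by (auto simp: T.T.submodule_iff T.T.act_zero T'.T.act_zero T.T.act_add T'.T.act_add
          T.T.act_smult T'.T.act_smult T.T.act_closed T.T.smult_closed')
  next
    fix v w assume "v \<in> carrier V" "w \<in> carrier W"
    then show "T.t v w \<in> {z \<in> carrier T.T. \<forall>x. h (act T.T x z) = act T'.T x (h z)}"
      using f g lin_homD(2)[OF h(1)]
      by (auto simp: T.t_closed T.act_t_leibniz T'.act_t_leibniz h(2) T.V.act_closed T.W.act_closed fD gD)
  qed
  then have "h \<in> vir_hom T.T T'.T" using h(1) by (auto simp: vir_hom_iff)
  with h(2) show ?thesis using that by blast
qed

text \<open>The maps induced by two inverse pairs undo each other on pure tensors, hence everywhere.
  This is the direction from the factors to the tensor product.\<close>

lemma vir_iso_tensor: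
  assumes "linear_rep V" "linear_rep W" "linear_rep V'" "linear_rep W'"
    and "vir_iso V V'" "vir_iso W W'"
  shows "vir_iso (vir_tensor V W) (vir_tensor V' W')"
proof -
  interpret T: tensor V W using assms by (intro tensor.intro)
  interpret T': tensor V' W' using assms by (intro tensor.intro)
  obtain f f' where f: "f \<in> vir_hom V V'" "f' \<in> vir_hom V' V"
    "\<And>v. v \<in> carrier V \<Longrightarrow> f' (f v) = v" "\<And>v. v \<in> carrier V' \<Longrightarrow> f (f' v) = v"
    by (rule vir_iso_inverse[OF assms(1,5)]) (rule that)
  obtain g g' where g: "g \<in> vir_hom W W'" "g' \<in> vir_hom W' W"
    "\<And>v. v \<in> carrier W \<Longrightarrow> g' (g v) = v" "\<And>v. v \<in> carrier W' \<Longrightarrow> g (g' v) = v"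
    by (rule vir_iso_inverse[OF assms(2,6)]) (rule that)
  obtain h where h: "h \<in> vir_hom T.T T'.T"
    "\<And>v w. \<lbrakk>v \<in> carrier V; w \<in> carrier W\<rbrakk> \<Longrightarrow> h (T.t v w) = T'.t (f v) (g w)"
    by (rule tensor_map[OF T.tensor_axioms T'.tensor_axioms f(1) g(1)]) (rule that)
  obtain h' where h': "h' \<in> vir_hom T'.T T.T"
    "\<And>v w. \<lbrakk>v \<in> carrier V'; w \<in> carrier W'\<rbrakk> \<Longrightarrow> h' (T'.t v w) = T.t (f' v) (g' w)"
    by (rule tensor_map[OF T'.tensor_axioms T.tensor_axioms f(2) g(2)]) (rule that)
  note hl = conjunct1[OF h(1)[unfolded vir_hom_iff]] and h'l = conjunct1[OF h'(1)[unfolded vir_hom_iff]]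
  have closed: "v \<in> carrier V \<Longrightarrow> f v \<in> carrier V'" "v' \<in> carrier V' \<Longrightarrow> f' v' \<in> carrier V"
    "w \<in> carrier W \<Longrightarrow> g w \<in> carrier W'" "w' \<in> carrier W' \<Longrightarrow> g' w' \<in> carrier W" for v v' w w'
    using f(1,2) g(1,2) by (auto simp: vir_hom_def)
  have "{z \<in> carrier T.T. h' (h z) = z} = carrier T.T"
  proof (rule T.T_submodule_eq)
    show "submodule {z \<in> carrier T.T. h' (h z) = z} complex_ring T.T"
      by (rule lin_hom_equalizer[OF T.T.linear_rep_axioms T.T.linear_rep_axioms
          lin_hom_comp[OF hl h'l] lin_hom_id])
  qed (simp add: T.t_closed h(2) h'(2) f(3) g(3) closed)
  moreover have "{z \<in> carrier T'.T. h (h' z) = z} = carrier T'.T"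
  proof (rule T'.T_submodule_eq)
    show "submodule {z \<in> carrier T'.T. h (h' z) = z} complex_ring T'.T"
      by (rule lin_hom_equalizer[OF T'.T.linear_rep_axioms T'.T.linear_rep_axioms
          lin_hom_comp[OF h'l hl] lin_hom_id])
  qed (simp add: T'.t_closed h(2) h'(2) f(4) g(4) closed)
  ultimately show ?thesis
    unfolding T.T_eq[symmetric] T'.T_eq[symmetric] by (intro vir_isoI[OF h(1) h'(1)]) auto
qed

subsection \<open>Tensor products with intermediate series modules\<close>

text \<open>Target of linear functionals such as \<open>coef i\<close>; with both parameters 0 every
  operator acts by zero.\<close>

abbreviation complex_rep :: "complex vir_rep"
  where "complex_rep \<equiv> borel_line 0 0"

lemma linear_rep_borel_line: "linear_rep (borel_line c h)"
proof (intro linear_rep.intro linear_rep_axioms.intro moduleI)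
  show "abelian_group (borel_line c h)"
    by (rule abelian_groupI) (auto simp: borel_line_def intro: exI[of _ "- _"] add.left_inverse)
qed (auto simp: borel_line_def algebra_simps cring_complex_ring)

lemma borel_line_simps [simp]: "carrier (borel_line c h) = UNIV" "add (borel_line c h) = (+)"
  "zero (borel_line c h) = 0" "module.smult (borel_line c h) = (*)"
  by (simp_all add: borel_line_def)

text \<open>An abstract description of V'_{\<alpha>,\<beta>}: \<open>e i\<close> is the image of v_i
  and \<open>coef i\<close> reads off its coefficient. When \<alpha> = \<beta> = 0 both
  \<open>e 0\<close> and \<open>coef 0\<close> are zero, so one integer-indexed family covers the
  simple modules and the quotient alike.\<close>

locale series = W: linear_rep W for W :: "('b, 'n) vir_rep_scheme" +
  fixes \<alpha> \<beta> :: complex and coef :: "int \<Rightarrow> 'b \<Rightarrow> complex" and e :: "int \<Rightarrow> 'b"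
  assumes e_closed: "e i \<in> carrier W"
    and coef_hom: "coef i \<in> lin_hom W complex_rep"
    and coef_e: "coef i (e j) = (if i = j \<and> (\<alpha>, \<beta>, i) \<noteq> (0, 0, 0) then 1 else 0)"
    and e_0: "\<lbrakk>\<alpha> = 0; \<beta> = 0\<rbrakk> \<Longrightarrow> e 0 = \<zero>\<^bsub>W\<^esub>"
    and coef_0: "\<lbrakk>\<alpha> = 0; \<beta> = 0; w \<in> carrier W\<rbrakk> \<Longrightarrow> coef 0 w = 0"
    and e_span: "\<lbrakk>submodule H complex_ring W; \<And>i. e i \<in> H\<rbrakk> \<Longrightarrow> H = carrier W"
    and act_e: "act W (vd n) (e k) = (\<alpha> + of_int k + of_int n * \<beta>) \<odot>\<^bsub>W\<^esub> e (k + n)"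
begin

lemmas coefD = lin_homD[OF coef_hom, simplified]

text \<open>The bound depends on \<open>w\<close> but not on \<open>i\<close>. It is checked on the
  spanning vectors \<open>e k\<close>; a sum needs only the larger of two bounds.\<close>

lemma coef_act:
  assumes "w \<in> carrier W"
  shows "\<exists>N. \<forall>n\<ge>N. \<forall>i. coef (i + n) (act W (vd n) w) = (\<alpha> + of_int i + of_int n * \<beta>) * coef i w"
proof -
  let ?P = "\<lambda>w N. \<forall>n\<ge>N. \<forall>i. coef (i + n) (act W (vd n) w) = (\<alpha> + of_int i + of_int n * \<beta>) * coef i w"
  have zero: "coef i \<zero>\<^bsub>W\<^esub> = 0" for i
    using lin_hom_zero[OF W.linear_rep_axioms linear_rep_borel_line coef_hom] by simp
  define Q where "Q w \<longleftrightarrow> (\<exists>N. ?P w N)" for w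
  have QI: "Q w" if "?P w N" for w N
    unfolding Q_def using that by (rule exI)
  have "{w \<in> carrier W. Q w} = carrier W"
  proof (rule e_span)
    have "Q \<zero>\<^bsub>W\<^esub>"
      by (rule QI) (simp add: W.act_zero zero)
    moreover have "Q (v \<oplus>\<^bsub>W\<^esub> w)" if vw: "v \<in> carrier W" "w \<in> carrier W" and Q: "Q v" "Q w" for v w
    proof -
      from Q(1) obtain N where "?P v N" unfolding Q_def ..
      moreover from Q(2) obtain N' where "?P w N'" unfolding Q_def ..
      ultimately show ?thesis
        using vw by (intro QI[of "max N N'"]) (simp add: W.act_add W.act_closed coefD algebra_simps)
    qed
    moreover have "Q (c \<odot>\<^bsub>W\<^esub> w)" if w: "w \<in> carrier W" and Q: "Q w" for c w
    proof -
      from Q obtain N where "?P w N" unfolding Q_def ..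
      then show ?thesis
        using w by (intro QI[of N]) (simp add: W.act_smult W.act_closed coefD)
    qed
    ultimately show "submodule {w \<in> carrier W. Q w} complex_ring W"
      by (auto simp: W.submodule_iff W.smult_closed')
  next
    fix k
    \<comment> \<open>For \<alpha> = \<beta> = 0 the formula fails at n = -k with k nonzero: d_n v_k
      is a multiple of v_0 and vanishes in the quotient, while the right-hand side is k at i = k.
      The bound excludes this n.\<close>
    have "Q (e k)"
    proof (rule QI[of "\<bar>k\<bar> + 1"], intro allI impI)
      fix n i :: int assume "n \<ge> \<bar>k\<bar> + 1"
      then show "coef (i + n) (act W (vd n) (e k)) = (\<alpha> + of_int i + of_int n * \<beta>) * coef i (e k)"
        using e_0 by (auto simp: act_e coefD e_closed coef_e)
    qed
    then show "e k \<in> {w \<in> carrier W. Q w}"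
      using e_closed by blast
  qed
  with assms have "Q w" by blast
  then show ?thesis unfolding Q_def .
qed

end

section \<open>Coordinates of a tensor along the second factor\<close>

locale tensor_series = tensor V W + series W \<alpha> \<beta> coef e
  for V :: "('a, 'm) vir_rep_scheme" and W :: "('b, 'n) vir_rep_scheme" and \<alpha> \<beta> coef e
begin

text \<open>The map id \<otimes> \<open>coef i\<close>, followed by the identification of
  \<open>V\<close> \<otimes> \<complex> with \<open>V\<close>.\<close>

definition coord where
  "coord i = (SOME g. g \<in> lin_hom T V \<and>
    (\<forall>v\<in>carrier V. \<forall>w\<in>carrier W. g (t v w) = coef i w \<odot>\<^bsub>V\<^esub> v))"

lemma coord: "coord i \<in> lin_hom T V"
  "\<lbrakk>v \<in> carrier V; w \<in> carrier W\<rbrakk> \<Longrightarrow> coord i (t v w) = coef i w \<odot>\<^bsub>V\<^esub> v"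
proof -
  obtain g where "g \<in> lin_hom T V"
    "\<And>v w. \<lbrakk>v \<in> carrier V; w \<in> carrier W\<rbrakk> \<Longrightarrow> g (t v w) = coef i w \<odot>\<^bsub>V\<^esub> v"
    by (rule tensor_lift[OF V.linear_rep_axioms, of "\<lambda>v w. coef i w \<odot>\<^bsub>V\<^esub> v"])
      (auto simp: V.smult_closed' coefD V.smult_r_distr[simplified] V.smult_l_distr[simplified]
        V.smult_assoc1[simplified, symmetric] mult.commute)
  then have "\<exists>g. g \<in> lin_hom T V \<and>
    (\<forall>v\<in>carrier V. \<forall>w\<in>carrier W. g (t v w) = coef i w \<odot>\<^bsub>V\<^esub> v)" by blast
  from someI_ex[OF this, folded coord_def]
  show "coord i \<in> lin_hom T V"
    "\<lbrakk>v \<in> carrier V; w \<in> carrier W\<rbrakk> \<Longrightarrow> coord i (t v w) = coef i w \<odot>\<^bsub>V\<^esub> v" by auto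
qed

lemmas coordD = lin_homD[OF coord(1)]

lemma coord_zero: "coord i \<zero>\<^bsub>T\<^esub> = \<zero>\<^bsub>V\<^esub>"
  by (rule lin_hom_zero[OF T.linear_rep_axioms V.linear_rep_axioms coord(1)])

lemma coord_t_e: "v \<in> carrier V \<Longrightarrow>
    coord i (t v (e k)) = (if i = k \<and> (\<alpha>, \<beta>, i) \<noteq> (0, 0, 0) then v else \<zero>\<^bsub>V\<^esub>)"
  by (auto simp: coord e_closed coef_e V.smult_one[simplified] V.smult_l_null[simplified])

lemma e_span_eq:
  assumes "f \<in> lin_hom W P" "g \<in> lin_hom W P" "linear_rep P" "\<And>k. f (e k) = g (e k)" "w \<in> carrier W"
  shows "f w = g w"
  using e_span[OF lin_hom_equalizer[OF W.linear_rep_axioms assms(3,1,2)]] assms(4,5) e_closed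
  by blast

lemma coord_0: "\<lbrakk>\<alpha> = 0; \<beta> = 0; z \<in> carrier T\<rbrakk> \<Longrightarrow> coord 0 z = \<zero>\<^bsub>V\<^esub>"
proof -
  assume *: "\<alpha> = 0" "\<beta> = 0" and z: "z \<in> carrier T"
  have "{z \<in> carrier T. coord 0 z \<in> {\<zero>\<^bsub>V\<^esub>}} = carrier T"
  proof (rule T_submodule_eq)
    show "submodule {z \<in> carrier T. coord 0 z \<in> {\<zero>\<^bsub>V\<^esub>}} complex_ring T"
      by (rule lin_hom_vimage[OF T.linear_rep_axioms V.linear_rep_axioms coord(1)])
        (simp add: V.submodule_iff V.smult_r_null[simplified])
  qed (simp add: t_closed coord coef_0[OF *] V.smult_l_null[simplified])
  with z show ?thesis by blast
qed

lemma t_e_span: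
  assumes H: "submodule H complex_ring T" and "\<And>v k. v \<in> carrier V \<Longrightarrow> t v (e k) \<in> H"
  shows "H = carrier T"
proof (rule T_submodule_eq[OF H])
  fix v w assume v: "v \<in> carrier V" and w: "w \<in> carrier W"
  have "{w \<in> carrier W. t v w \<in> H} = carrier W"
  proof (rule e_span)
    show "submodule {w \<in> carrier W. t v w \<in> H} complex_ring W"
      by (rule lin_hom_vimage[OF W.linear_rep_axioms T.linear_rep_axioms _ H])
        (simp add: lin_hom_def v t_closed t_add_right t_smult_right)
  qed (use assms v e_closed in auto)
  with w show "t v w \<in> H" by blast
qed

text \<open>Allowing every finite index set that contains \<open>S\<close> lets two expansions be
  added over the union of their index sets.\<close>

definition expands where
  "expands z S \<longleftrightarrow> finite S \<and>
    (\<forall>U. finite U \<longrightarrow> S \<subseteq> U \<longrightarrow> z = (\<Oplus>\<^bsub>T\<^esub>i\<in>U. t (coord i z) (e i)))"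

lemma expandsD: "\<lbrakk>expands z S; finite U; S \<subseteq> U\<rbrakk> \<Longrightarrow> z = (\<Oplus>\<^bsub>T\<^esub>i\<in>U. t (coord i z) (e i))"
  "expands z S \<Longrightarrow> finite S"
  unfolding expands_def by blast+

lemma coord_expansion:
  assumes "z \<in> carrier T"
  shows "\<exists>S. expands z S"
proof -
  have "{z \<in> carrier T. \<exists>S. expands z S} = carrier T"
  proof (rule t_e_span)
    show "submodule {z \<in> carrier T. \<exists>S. expands z S} complex_ring T"
      unfolding T.submodule_iff
    proof (intro conjI ballI allI)
      have "expands \<zero>\<^bsub>T\<^esub> {}" by (simp add: expands_def coord_zero t_zero_left e_closed)
      then show "\<zero>\<^bsub>T\<^esub> \<in> {z \<in> carrier T. \<exists>S. expands z S}" by blast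
    next
      fix y z assume "y \<in> {z \<in> carrier T. \<exists>S. expands z S}" "z \<in> {z \<in> carrier T. \<exists>S. expands z S}"
      then obtain S S' where *: "y \<in> carrier T" "z \<in> carrier T" "expands y S" "expands z S'" by blast
      have "expands (y \<oplus>\<^bsub>T\<^esub> z) (S \<union> S')"
        unfolding expands_def
      proof (intro conjI allI impI)
        fix U assume U: "finite U" "S \<union> S' \<subseteq> U"
        have "y \<oplus>\<^bsub>T\<^esub> z = (\<Oplus>\<^bsub>T\<^esub>i\<in>U. t (coord i y) (e i)) \<oplus>\<^bsub>T\<^esub> (\<Oplus>\<^bsub>T\<^esub>i\<in>U. t (coord i z) (e i))"
          using expandsD(1)[OF *(3), of U] expandsD(1)[OF *(4), of U] U by simp
        also have "\<dots> = (\<Oplus>\<^bsub>T\<^esub>i\<in>U. t (coord i y) (e i) \<oplus>\<^bsub>T\<^esub> t (coord i z) (e i))"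
          using * by (intro T.finsum_addf[symmetric]) (auto intro!: t_closed coordD e_closed)
        also have "\<dots> = (\<Oplus>\<^bsub>T\<^esub>i\<in>U. t (coord i (y \<oplus>\<^bsub>T\<^esub> z)) (e i))"
          using * by (intro T.add.finprod_cong')
            (auto simp: coordD t_add_left[symmetric] e_closed intro!: t_closed coordD e_closed)
        finally show "y \<oplus>\<^bsub>T\<^esub> z = (\<Oplus>\<^bsub>T\<^esub>i\<in>U. t (coord i (y \<oplus>\<^bsub>T\<^esub> z)) (e i))" .
      qed (use * expandsD(2) in auto)
      then show "y \<oplus>\<^bsub>T\<^esub> z \<in> {z \<in> carrier T. \<exists>S. expands z S}" using *(1,2) by blast
    next
      fix a z assume "z \<in> {z \<in> carrier T. \<exists>S. expands z S}"
      then obtain S where *: "z \<in> carrier T" "expands z S" by blast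
      have "expands (a \<odot>\<^bsub>T\<^esub> z) S"
        unfolding expands_def
      proof (intro conjI allI impI)
        fix U assume U: "finite U" "S \<subseteq> U"
        have "a \<odot>\<^bsub>T\<^esub> z = a \<odot>\<^bsub>T\<^esub> (\<Oplus>\<^bsub>T\<^esub>i\<in>U. t (coord i z) (e i))"
          using expandsD(1)[OF *(2), of U] U by simp
        also have "\<dots> = (\<Oplus>\<^bsub>T\<^esub>i\<in>U. a \<odot>\<^bsub>T\<^esub> t (coord i z) (e i))"
          using * U by (intro T.finsum_smult_ldistr) (auto intro!: t_closed coordD e_closed)
        also have "\<dots> = (\<Oplus>\<^bsub>T\<^esub>i\<in>U. t (coord i (a \<odot>\<^bsub>T\<^esub> z)) (e i))"
          using * by (intro T.add.finprod_cong')
            (auto simp: coordD t_smult_left[symmetric] V.smult_closed' e_closed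
              intro!: t_closed coordD e_closed)
        finally show "a \<odot>\<^bsub>T\<^esub> z = (\<Oplus>\<^bsub>T\<^esub>i\<in>U. t (coord i (a \<odot>\<^bsub>T\<^esub> z)) (e i))" .
      qed (use * expandsD(2) in auto)
      then show "a \<odot>\<^bsub>T\<^esub> z \<in> {z \<in> carrier T. \<exists>S. expands z S}"
        using *(1) by (blast intro: T.smult_closed')
    qed auto
  next
    fix v k assume v: "v \<in> carrier V"
    \<comment> \<open>When \<alpha> = \<beta> = 0 and k = 0 the coordinate at 0 is zero instead of
      \<open>v\<close>, but \<open>e 0\<close> is zero as well and the expansion still
      holds.\<close>
    have "expands (t v (e k)) {k}"
      unfolding expands_def
    proof (intro conjI allI impI)
      fix U :: "int set" assume U: "finite U" "{k} \<subseteq> U"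
      have "(\<Oplus>\<^bsub>T\<^esub>i\<in>U. t (coord i (t v (e k))) (e i)) = (\<Oplus>\<^bsub>T\<^esub>i\<in>U. if k = i then t v (e i) else \<zero>\<^bsub>T\<^esub>)"
        using v by (intro T.add.finprod_cong')
          (auto simp: coord_t_e e_0 t_zero_left t_zero_right e_closed intro!: t_closed e_closed)
      also have "\<dots> = t v (e k)"
        using U v by (intro T.add.finprod_singleton) (auto intro!: t_closed e_closed)
      finally show "t v (e k) = (\<Oplus>\<^bsub>T\<^esub>i\<in>U. t (coord i (t v (e k))) (e i))" by simp
    qed auto
    then show "t v (e k) \<in> {z \<in> carrier T. \<exists>S. expands z S}"
      using v t_closed e_closed by blast
  qed
  with assms show ?thesis by blast
qed

text \<open>Both tensors are recovered from their coordinates over one common finite index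
  set.\<close>

lemma coord_eqI:
  assumes "y \<in> carrier T" "z \<in> carrier T" "\<And>i. coord i y = coord i z"
  shows "y = z"
proof -
  obtain S S' where S: "expands y S" "expands z S'"
    using coord_expansion[OF assms(1)] coord_expansion[OF assms(2)] by blast
  then have "finite (S \<union> S')" using expandsD(2) by blast
  then have "y = (\<Oplus>\<^bsub>T\<^esub>i\<in>S \<union> S'. t (coord i y) (e i))" "z = (\<Oplus>\<^bsub>T\<^esub>i\<in>S \<union> S'. t (coord i z) (e i))"
    using expandsD(1)[OF S(1)] expandsD(1)[OF S(2)] by (meson Un_upper1 Un_upper2)+
  with assms(3) show ?thesis by simp
qed

text \<open>On a pure tensor v \<otimes> w the Leibniz term with d_n v disappears for large n by
  \<open>nil\<close>, and \<open>coef_act\<close> handles the other term. The bound again does not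
  depend on \<open>i\<close>.\<close>

lemma coord_act:
  assumes nil: "\<And>v. v \<in> carrier V \<Longrightarrow> \<exists>N. \<forall>n\<ge>N. act V (vd n) v = \<zero>\<^bsub>V\<^esub>"
    and z: "z \<in> carrier T"
  shows "\<exists>N. \<forall>n\<ge>N. \<forall>i. coord (i + n) (act T (vd n) z) = (\<alpha> + of_int i + of_int n * \<beta>) \<odot>\<^bsub>V\<^esub> coord i z"
proof -
  let ?P = "\<lambda>z N. \<forall>n\<ge>N. \<forall>i. coord (i + n) (act T (vd n) z) = (\<alpha> + of_int i + of_int n * \<beta>) \<odot>\<^bsub>V\<^esub> coord i z"
  define Q where "Q z \<longleftrightarrow> (\<exists>N. ?P z N)" for z
  have QI: "Q z" if "?P z N" for z N
    unfolding Q_def using that by (rule exI)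
  have "{z \<in> carrier T. Q z} = carrier T"
  proof (rule T_submodule_eq)
    have "Q \<zero>\<^bsub>T\<^esub>"
      by (rule QI) (simp add: T.act_zero coord_zero V.smult_r_null[simplified])
    moreover have "Q (v \<oplus>\<^bsub>T\<^esub> w)" if vw: "v \<in> carrier T" "w \<in> carrier T" and Q: "Q v" "Q w" for v w
    proof -
      from Q(1) obtain N where "?P v N" unfolding Q_def ..
      moreover from Q(2) obtain N' where "?P w N'" unfolding Q_def ..
      ultimately show ?thesis
        using vw by (intro QI[of "max N N'"])
          (simp add: T.act_add T.act_closed coordD V.smult_r_distr[simplified])
    qed
    moreover have "Q (c \<odot>\<^bsub>T\<^esub> w)" if w: "w \<in> carrier T" and Q: "Q w" for c w
    proof -
      from Q obtain N where "?P w N" unfolding Q_def ..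
      then show ?thesis
        using w by (intro QI[of N]) (simp add: T.act_smult T.act_closed coordD
          V.smult_assoc1[simplified, symmetric] mult.commute)
    qed
    ultimately show "submodule {z \<in> carrier T. Q z} complex_ring T"
      by (auto simp: T.submodule_iff T.smult_closed')
  next
    fix v w assume vw: "v \<in> carrier V" "w \<in> carrier W"
    obtain N where N: "\<forall>n\<ge>N. act V (vd n) v = \<zero>\<^bsub>V\<^esub>" using nil[OF vw(1)] by blast
    from coef_act[OF vw(2)]
    obtain N' where N': "\<forall>n\<ge>N'. \<forall>i. coef (i + n) (act W (vd n) w) = (\<alpha> + of_int i + of_int n * \<beta>) * coef i w" ..
    have "Q (t v w)"
      using vw N N' by (intro QI[of "max N N'"])
        (simp add: act_t_leibniz t_zero_left t_closed W.act_closed coord V.smult_assoc1[simplified])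
    then show "t v w \<in> {z \<in> carrier T. Q z}"
      using vw t_closed by blast
  qed
  with z have "Q z" by blast
  then show ?thesis unfolding Q_def .
qed

end

section \<open>Polynomial identities that determine the parameters\<close>

lemma linear_coeffs_zero:
  fixes p q :: complex
  assumes "\<And>n::int. n \<ge> N \<Longrightarrow> p + of_int n * q = 0"
  shows "p = 0" "q = 0"
proof -
  have "p + of_int N * q = 0" "p + of_int (N + 1) * q = 0" using assms[of N] assms[of "N + 1"] by auto
  moreover have "q = (p + of_int (N + 1) * q) - (p + of_int N * q)" by (simp add: algebra_simps)
  ultimately show "q = 0" by simp
  with assms[of N] show "p = 0" by simp
qed

text \<open>Taking the difference of consecutive values reduces the degree to one.\<close>

lemma quadratic_coeffs_zero:
  fixes p q r :: complex
  assumes "\<And>n::int. n \<ge> N \<Longrightarrow> p + of_int n * q + of_int n * of_int n * r = 0"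
  shows "p = 0" "q = 0" "r = 0"
proof -
  have "(q + r) + of_int n * (2 * r) = 0" if "n \<ge> N" for n :: int
  proof -
    have "(q + r) + of_int n * (2 * r) =
        (p + of_int (n + 1) * q + of_int (n + 1) * of_int (n + 1) * r)
        - (p + of_int n * q + of_int n * of_int n * r)"
      by (simp add: algebra_simps)
    then show ?thesis using assms[of n] assms[of "n + 1"] that by simp
  qed
  from linear_coeffs_zero[OF this] have "q + r = 0" "2 * r = 0" by blast+
  then show "q = 0" "r = 0" by auto
  with assms[of N] show "p = 0" by simp
qed

text \<open>The identity holds for all large \<open>m\<close> once \<open>n\<close> is fixed, hence as an identity of
  polynomials in \<open>m\<close>, whose coefficients are then compared as polynomials in \<open>n\<close>.\<close>

lemma series_parameters_eq:
  fixes a b \<beta> \<beta>' :: complex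
  assumes id: "\<And>n. n \<ge> (N::int) \<Longrightarrow> \<exists>M::int. \<forall>m\<ge>M.
      (a + of_int n + of_int m * \<beta>) * (b + of_int (n + m) * \<beta>') * (a + of_int n * \<beta>) =
      (b + of_int n + of_int m * \<beta>') * (b + of_int n * \<beta>') * (a + of_int (n + m) * \<beta>)"
    and "\<beta> \<noteq> 1" "\<beta>' \<noteq> 1" "\<beta> = 0 \<Longrightarrow> a \<noteq> 0" "\<beta>' = 0 \<Longrightarrow> b \<noteq> 0"
  shows "a = b" "\<beta> = \<beta>'"
proof -
  \<comment> \<open>The three conjuncts state that the coefficients of m^2, m and 1 in the
    difference of the two sides vanish.\<close>
  have coeffs: "\<beta> * \<beta>' * (a - b + of_int n * (\<beta> - \<beta>')) = 0 \<and>
      (\<beta> * (b + of_int n * \<beta>') + (a + of_int n) * \<beta>') * (a + of_int n * \<beta>) =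
      (\<beta>' * (a + of_int n * \<beta>) + (b + of_int n) * \<beta>) * (b + of_int n * \<beta>') \<and>
      (a + of_int n) * (b + of_int n * \<beta>') * (a + of_int n * \<beta>) =
      (b + of_int n) * (b + of_int n * \<beta>') * (a + of_int n * \<beta>)" if "n \<ge> N" for n :: int
  proof -
    let ?n = "of_int n :: complex"
    from id[OF that] obtain M where M: "\<forall>m\<ge>M. (a + of_int n + of_int m * \<beta>) * (b + of_int (n + m) * \<beta>') * (a + of_int n * \<beta>) =
      (b + of_int n + of_int m * \<beta>') * (b + of_int n * \<beta>') * (a + of_int (n + m) * \<beta>)"
      ..
    have "((a + ?n) * (b + ?n * \<beta>') * (a + ?n * \<beta>) - (b + ?n) * (b + ?n * \<beta>') * (a + ?n * \<beta>))
      + of_int m * ((\<beta> * (b + ?n * \<beta>') + (a + ?n) * \<beta>') * (a + ?n * \<beta>)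
        - (\<beta>' * (a + ?n * \<beta>) + (b + ?n) * \<beta>) * (b + ?n * \<beta>'))
      + of_int m * of_int m * (\<beta> * \<beta>' * (a - b + ?n * (\<beta> - \<beta>'))) = 0" if "m \<ge> M" for m :: int
    proof -
      have "(a + ?n + of_int m * \<beta>) * (b + (?n + of_int m) * \<beta>') * (a + ?n * \<beta>) =
        (b + ?n + of_int m * \<beta>') * (b + ?n * \<beta>') * (a + (?n + of_int m) * \<beta>)"
        using M that by simp
      then show ?thesis
        unfolding eq_iff_diff_eq_0[of "_ * (a + ?n * \<beta>)"] by (simp add: algebra_simps)
    qed
    from quadratic_coeffs_zero[OF this] show ?thesis by (simp add: algebra_simps)
  qed
  have "a = b \<and> \<beta> = \<beta>'"
  proof (cases "\<beta> * \<beta>' = 0")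
    case False
    then have "(a - b) + of_int n * (\<beta> - \<beta>') = 0" if "n \<ge> N" for n :: int
      using coeffs[OF that] by simp
    from linear_coeffs_zero[of N, OF this] show ?thesis by simp
  next
    case True
    then consider "\<beta> = 0" "\<beta>' = 0" | "\<beta> = 0" "\<beta>' \<noteq> 0" | "\<beta> \<noteq> 0" "\<beta>' = 0" by auto
    then show ?thesis
    proof cases
      case 1
      then show ?thesis using coeffs[of N] assms(4,5) by auto
    next
      case 2
      \<comment> \<open>The coefficient of m alone remains informative here. Its slope in n would
        force \<beta>' = 1, which is the isomorphism between V_{\<alpha>,0} and V_{\<alpha>,1} that
        the hypotheses rule out. The third case is the mirror image.\<close>
      then have "a - b + of_int n * (1 - \<beta>') = 0" if "n \<ge> N" for n :: int
      proof -
        have "\<beta>' * a * (a - b + of_int n * (1 - \<beta>')) = 0"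
          using coeffs[OF that] 2 by (simp add: algebra_simps)
        then show ?thesis using 2 assms(4) by simp
      qed
      from linear_coeffs_zero[of N, OF this] show ?thesis using assms(3) by simp
    next
      case 3
      then have "b - a + of_int n * (1 - \<beta>) = 0" if "n \<ge> N" for n :: int
      proof -
        have "\<beta> * b * (b - a + of_int n * (1 - \<beta>)) = 0"
          using coeffs[OF that] 3 by (simp add: algebra_simps)
        then show ?thesis using 3 assms(5) by simp
      qed
      from linear_coeffs_zero[of N, OF this] show ?thesis using assms(2) by simp
    qed
  qed
  then show "a = b" "\<beta> = \<beta>'" by auto
qed

text \<open>Two reals in [0,1) that differ by an integer are equal. The normalisation of \<alpha>
  enters the argument through this fact.\<close>

lemma eq_of_diff_int:
  fixes \<alpha> \<alpha>' :: complex and k l :: int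
  assumes "\<alpha> + of_int k = \<alpha>' + of_int l" "0 \<le> Re \<alpha>" "Re \<alpha> < 1" "0 \<le> Re \<alpha>'" "Re \<alpha>' < 1"
  shows "\<alpha> = \<alpha>' \<and> k = l"
proof -
  have "Re \<alpha> + of_int k = Re \<alpha>' + of_int l"
    using arg_cong[OF assms(1), of Re] by simp
  with assms(2-) have "k = l" by linarith
  with assms(1) show ?thesis by simp
qed

section \<open>Consequences of an isomorphism between two tensor products\<close>

definition generated_by :: "'a \<Rightarrow> ('a, 'm) vir_rep_scheme \<Rightarrow> bool"
  where "generated_by u V \<longleftrightarrow> u \<in> carrier V \<and> (\<forall>S. vir_submodule S V \<longrightarrow> u \<in> S \<longrightarrow> S = carrier V)"

text \<open>The two sides play different roles: \<open>V\<close> contributes a generator killed by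
  the positive part of Vir, whereas \<open>V'\<close> contributes only that each of its vectors is
  killed by d_n for large n. The series parameters are still unrelated.\<close>

locale tensor_series_iso = T: tensor_series V W \<alpha> \<beta> coef e + T': tensor_series V' W' \<alpha>' \<beta>' coef' e'
  for V :: "('a, 'm) vir_rep_scheme" and W :: "('b, 'n) vir_rep_scheme" and \<alpha> \<beta> coef e
    and V' :: "('c, 'p) vir_rep_scheme" and W' :: "('b, 'n) vir_rep_scheme" and \<alpha>' \<beta>' coef' e' +
  fixes u f
  assumes u: "generated_by u V" "u \<noteq> \<zero>\<^bsub>V\<^esub>" "\<And>n. n \<ge> 1 \<Longrightarrow> act V (vd n) u = \<zero>\<^bsub>V\<^esub>"
    and nil: "\<And>v. v \<in> carrier V' \<Longrightarrow> \<exists>N. \<forall>n\<ge>N. act V' (vd n) v = \<zero>\<^bsub>V'\<^esub>"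
    and parameters: "0 \<le> Re \<alpha>" "Re \<alpha> < 1" "0 \<le> Re \<alpha>'" "Re \<alpha>' < 1" "\<beta> \<noteq> 1" "\<beta>' \<noteq> 1"
    and f: "f \<in> vir_hom T.T T'.T" "bij_betw f (carrier T.T) (carrier T'.T)"
begin

lemma u_closed: "u \<in> carrier V"
  using u(1) by (simp add: generated_by_def)

lemma f_lin: "f \<in> lin_hom T.T T'.T"
  using f(1) by (simp add: vir_hom_iff)

lemmas fD = lin_homD[OF f_lin]

lemma f_act: "z \<in> carrier T.T \<Longrightarrow> f (act T.T x z) = act T'.T x (f z)"
  using f(1) by (simp add: vir_hom_iff)

lemma f_eq_zero: "\<lbrakk>z \<in> carrier T.T; f z = \<zero>\<^bsub>T'.T\<^esub>\<rbrakk> \<Longrightarrow> z = \<zero>\<^bsub>T.T\<^esub>"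
  using inj_onD[OF bij_betw_imp_inj_on[OF f(2)], of z "\<zero>\<^bsub>T.T\<^esub>"]
    lin_hom_zero[OF T.T.linear_rep_axioms T'.T.linear_rep_axioms f_lin] by simp

text \<open>The components of \<open>f (u \<otimes> e\<^sub>k)\<close>, indexed by the shift from \<open>k\<close>.\<close>

definition xi where "xi k j = T'.coord (k + j) (f (T.t u (e k)))"

lemma xi_closed: "xi k j \<in> carrier V'"
  unfolding xi_def by (intro T'.coordD fD T.t_closed u_closed T.e_closed)

text \<open>Both sides are the coordinate at k + n + j of the image under \<open>f\<close> of d_n (u
  \<otimes> e_k). On the source d_n kills \<open>u\<close> once n \<ge> 1; on the target
  \<open>coord_act\<close> applies. The bound depends on \<open>k\<close> only, not on
  \<open>j\<close>.\<close>

lemma xi_rec: "\<exists>N. \<forall>n\<ge>N. \<forall>j. (\<alpha> + of_int k + of_int n * \<beta>) \<odot>\<^bsub>V'\<^esub> xi (k + n) j =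
    (\<alpha>' + of_int (k + j) + of_int n * \<beta>') \<odot>\<^bsub>V'\<^esub> xi k j"
proof -
  let ?z = "f (T.t u (e k))"
  have z: "?z \<in> carrier T'.T" by (intro fD T.t_closed u_closed T.e_closed)
  from T'.coord_act[OF nil z] obtain N where N: "\<forall>n\<ge>N. \<forall>i. T'.coord (i + n) (act T'.T (vd n) ?z) =
      (\<alpha>' + of_int i + of_int n * \<beta>') \<odot>\<^bsub>V'\<^esub> T'.coord i ?z" ..
  have "(\<alpha> + of_int k + of_int n * \<beta>) \<odot>\<^bsub>V'\<^esub> xi (k + n) j =
    (\<alpha>' + of_int (k + j) + of_int n * \<beta>') \<odot>\<^bsub>V'\<^esub> xi k j" if "n \<ge> max N 1" for n j
  proof -
    have "act T'.T (vd n) ?z = f (act T.T (vd n) (T.t u (e k)))"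
      by (simp add: f_act T.t_closed u_closed T.e_closed)
    also have "act T.T (vd n) (T.t u (e k)) = (\<alpha> + of_int k + of_int n * \<beta>) \<odot>\<^bsub>T.T\<^esub> T.t u (e (k + n))"
      using that by (simp add: T.act_t_leibniz u u_closed T.e_closed T.t_zero_left T.act_e T.t_smult_right
          T.W.smult_closed' T.t_closed T.T.smult_closed')
    also have "f \<dots> = (\<alpha> + of_int k + of_int n * \<beta>) \<odot>\<^bsub>T'.T\<^esub> f (T.t u (e (k + n)))"
      by (simp add: fD T.t_closed u_closed T.e_closed)
    finally have "T'.coord (k + n + j) (act T'.T (vd n) ?z) = (\<alpha> + of_int k + of_int n * \<beta>) \<odot>\<^bsub>V'\<^esub> xi (k + n) j"
      by (simp add: xi_def T'.coordD fD T.t_closed u_closed T.e_closed)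
    moreover have eq: "k + j + n = k + n + j" by simp
    ultimately show ?thesis using N[rule_format, of n "k + j"] that unfolding eq by (simp add: xi_def)
  qed
  then show ?thesis by blast
qed

text \<open>A nonzero component converts the vector identities of \<open>xi_rec\<close> into one
  identity of scalars. The excluded triple is the index at which \<open>e k\<close> is itself
  zero.\<close>

lemma xi_nonzero:
  assumes "(\<alpha>, \<beta>, k) \<noteq> (0, 0, 0)" "xi k j \<noteq> \<zero>\<^bsub>V'\<^esub>"
  shows "\<alpha> = \<alpha>' \<and> \<beta> = \<beta>' \<and> j = 0"
proof -
  let ?a = "\<alpha> + of_int k" and ?b = "\<alpha>' + of_int (k + j)"
  obtain N where N: "\<forall>n\<ge>N. \<forall>j. (?a + of_int n * \<beta>) \<odot>\<^bsub>V'\<^esub> xi (k + n) j =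
    (\<alpha>' + of_int (k + j) + of_int n * \<beta>') \<odot>\<^bsub>V'\<^esub> xi k j" using xi_rec[of k] ..
  \<comment> \<open>The second step starts at k + n, so its bound \<open>M\<close> depends on
    \<open>n\<close>; this dictates the order of quantifiers in
    \<open>series_parameters_eq\<close>.\<close>
  have id: "\<exists>M::int. \<forall>m\<ge>M.
      (?a + of_int n + of_int m * \<beta>) * (?b + of_int (n + m) * \<beta>') * (?a + of_int n * \<beta>) =
      (?b + of_int n + of_int m * \<beta>') * (?b + of_int n * \<beta>') * (?a + of_int (n + m) * \<beta>)"
    if "n \<ge> N" for n :: int
  proof -
    obtain M where M: "\<forall>m\<ge>M. \<forall>j. (\<alpha> + of_int (k + n) + of_int m * \<beta>) \<odot>\<^bsub>V'\<^esub> xi (k + n + m) j =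
      (\<alpha>' + of_int (k + n + j) + of_int m * \<beta>') \<odot>\<^bsub>V'\<^esub> xi (k + n) j" using xi_rec[of "k + n"] ..
    have "(?a + of_int n + of_int m * \<beta>) * (?b + of_int (n + m) * \<beta>') * (?a + of_int n * \<beta>) =
      (?b + of_int n + of_int m * \<beta>') * (?b + of_int n * \<beta>') * (?a + of_int (n + m) * \<beta>)"
      if m: "m \<ge> max M 0" for m :: int
    proof (rule T'.V.smult_right_cancel[OF xi_closed assms(2)])
      \<comment> \<open>With X = \<open>xi k j\<close> the three steps read p Y = p' X, q Z = q' Y
        and r Z = r' X. Multiplying through gives q r' p X = q' p' r X without dividing by p, q or
        r, any of which may be zero.\<close>
      define Y Z where "Y = xi (k + n) j" and "Z = xi (k + n + m) j"
      have YZ: "Y \<in> carrier V'" "Z \<in> carrier V'" by (simp_all add: Y_def Z_def xi_closed)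
      define p q r where "p = ?a + of_int n * \<beta>" and "q = ?a + of_int n + of_int m * \<beta>"
        and "r = ?a + of_int (n + m) * \<beta>"
      define p' q' r' where "p' = ?b + of_int n * \<beta>'" and "q' = ?b + of_int n + of_int m * \<beta>'"
        and "r' = ?b + of_int (n + m) * \<beta>'"
      have 1: "p \<odot>\<^bsub>V'\<^esub> Y = p' \<odot>\<^bsub>V'\<^esub> xi k j"
        using N \<open>n \<ge> N\<close> by (simp add: p_def p'_def Y_def)
      have 2: "q \<odot>\<^bsub>V'\<^esub> Z = q' \<odot>\<^bsub>V'\<^esub> Y"
      proof -
        have "(\<alpha> + of_int (k + n) + of_int m * \<beta>) \<odot>\<^bsub>V'\<^esub> xi (k + n + m) j =
          (\<alpha>' + of_int (k + n + j) + of_int m * \<beta>') \<odot>\<^bsub>V'\<^esub> xi (k + n) j" using M m by simp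
        then show ?thesis by (simp add: q_def q'_def Y_def Z_def add_ac)
      qed
      have 3: "r \<odot>\<^bsub>V'\<^esub> Z = r' \<odot>\<^bsub>V'\<^esub> xi k j"
      proof -
        have "(?a + of_int (n + m) * \<beta>) \<odot>\<^bsub>V'\<^esub> xi (k + (n + m)) j = r' \<odot>\<^bsub>V'\<^esub> xi k j"
          using N \<open>n \<ge> N\<close> m unfolding r'_def by (smt (verit))
        then show ?thesis by (simp add: r_def Z_def add_ac)
      qed
      have assoc: "(c * d) \<odot>\<^bsub>V'\<^esub> v = c \<odot>\<^bsub>V'\<^esub> (d \<odot>\<^bsub>V'\<^esub> v)" if "v \<in> carrier V'" for c d v
        using T'.V.smult_assoc1[of c d v] that by simp
      have "(q * r' * p) \<odot>\<^bsub>V'\<^esub> xi k j = (q * p) \<odot>\<^bsub>V'\<^esub> (r' \<odot>\<^bsub>V'\<^esub> xi k j)"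
        by (simp add: assoc[symmetric] xi_closed mult_ac)
      also have "\<dots> = (r * p) \<odot>\<^bsub>V'\<^esub> (q \<odot>\<^bsub>V'\<^esub> Z)"
        by (simp add: 3[symmetric] assoc[symmetric] YZ mult_ac)
      also have "\<dots> = (r * q') \<odot>\<^bsub>V'\<^esub> (p \<odot>\<^bsub>V'\<^esub> Y)"
        by (simp add: 2 assoc[symmetric] YZ mult_ac)
      also have "\<dots> = (q' * p' * r) \<odot>\<^bsub>V'\<^esub> xi k j"
        by (simp add: 1 assoc[symmetric] xi_closed mult_ac)
      finally show "((?a + of_int n + of_int m * \<beta>) * (?b + of_int (n + m) * \<beta>') * (?a + of_int n * \<beta>))
          \<odot>\<^bsub>V'\<^esub> xi k j =
        ((?b + of_int n + of_int m * \<beta>') * (?b + of_int n * \<beta>') * (?a + of_int (n + m) * \<beta>)) \<odot>\<^bsub>V'\<^esub> xi k j"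
        unfolding p_def q_def r_def p'_def q'_def r'_def .
    qed
    then show ?thesis by blast
  qed
  \<comment> \<open>With \<beta> = 0 this number vanishes only for \<alpha> = 0 and k = 0, the
    excluded triple.\<close>
  have "?a \<noteq> 0" if "\<beta> = 0"
  proof
    assume "?a = 0"
    then have "\<alpha> + of_int k = 0 + of_int 0" by simp
    from eq_of_diff_int[OF this] show False using parameters assms(1) that by auto
  qed
  \<comment> \<open>With \<beta>' = 0 it would force \<alpha>' = 0 and k + j = 0, so that
    \<open>xi k j\<close> is a coordinate at 0 in the degenerate case, which is identically
    zero.\<close>
  moreover have "?b \<noteq> 0" if "\<beta>' = 0"
  proof
    assume "?b = 0"
    then have "\<alpha>' + of_int (k + j) = 0 + of_int 0" by simp
    from eq_of_diff_int[OF this] have "\<alpha>' = 0" "k + j = 0" using parameters by auto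
    then show False
      using T'.coord_0[of "f (T.t u (e k))"] assms(2) that
      by (auto simp: xi_def fD T.t_closed u_closed T.e_closed)
  qed
  ultimately have "?a = ?b" "\<beta> = \<beta>'"
    using series_parameters_eq[of N ?a \<beta> ?b \<beta>'] id parameters by blast+
  with eq_of_diff_int[OF this(1)] parameters show ?thesis by auto
qed

text \<open>If all components vanished, injectivity of \<open>f\<close> would give u \<otimes> e_k =
  0, but the coordinate of this tensor at k is \<open>u\<close>.\<close>

lemma xi_ex_nonzero: "(\<alpha>, \<beta>, k) \<noteq> (0, 0, 0) \<Longrightarrow> \<exists>j. xi k j \<noteq> \<zero>\<^bsub>V'\<^esub>"
proof (rule ccontr)
  assume k: "(\<alpha>, \<beta>, k) \<noteq> (0, 0, 0)" and "\<not> (\<exists>j. xi k j \<noteq> \<zero>\<^bsub>V'\<^esub>)"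
  then have "xi k (i - k) = \<zero>\<^bsub>V'\<^esub>" for i by blast
  then have "T'.coord i (f (T.t u (e k))) = T'.coord i \<zero>\<^bsub>T'.T\<^esub>" for i
    by (simp add: xi_def T'.coord_zero)
  then have "f (T.t u (e k)) = \<zero>\<^bsub>T'.T\<^esub>"
    by (intro T'.coord_eqI) (auto intro: fD T.t_closed u_closed T.e_closed)
  then have "T.t u (e k) = \<zero>\<^bsub>T.T\<^esub>"
    by (intro f_eq_zero T.t_closed u_closed T.e_closed)
  then have "u = \<zero>\<^bsub>V\<^esub>"
    using k T.coord_t_e[OF u_closed, of k k] T.coord_zero[of k] by auto
  with u(2) show False ..
qed

text \<open>Index 1 is never the degenerate one, whatever the parameters are.\<close>

lemma parameters_eq: "\<alpha> = \<alpha>'" "\<beta> = \<beta>'"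
  using xi_ex_nonzero[of 1] xi_nonzero[of 1] by auto

lemma xi_other: "j \<noteq> 0 \<Longrightarrow> (\<alpha>, \<beta>, k) \<noteq> (0, 0, 0) \<Longrightarrow> xi k j = \<zero>\<^bsub>V'\<^esub>"
  using xi_nonzero by blast

text \<open>With equal parameters and j = 0 both sides of the recursion carry the same factor
  \<alpha> + k + n \<beta>. It cancels unless it is zero, which happens for at most one n when
  \<beta> is nonzero and for none when \<beta> = 0.\<close>

lemma xi_eventually_const:
  assumes k: "(\<alpha>, \<beta>, k) \<noteq> (0, 0, 0)"
  shows "\<exists>N. \<forall>n\<ge>N. xi (k + n) 0 = xi k 0"
proof -
  obtain N where N: "\<forall>n\<ge>N. \<forall>j. (\<alpha> + of_int k + of_int n * \<beta>) \<odot>\<^bsub>V'\<^esub> xi (k + n) j =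
    (\<alpha>' + of_int (k + j) + of_int n * \<beta>') \<odot>\<^bsub>V'\<^esub> xi k j" using xi_rec[of k] ..
  have *: "xi (k + n) 0 = xi k 0" if "n \<ge> N" "\<alpha> + of_int k + of_int n * \<beta> \<noteq> 0" for n
    using N that parameters_eq by (intro T'.V.smult_left_cancel[OF xi_closed xi_closed that(2)]) simp
  show ?thesis
  proof (cases "\<exists>n0\<ge>N. \<alpha> + of_int k + of_int n0 * \<beta> = 0")
    case False
    then show ?thesis using * by blast
  next
    case True
    then obtain n0 where n0: "\<alpha> + of_int k + of_int n0 * \<beta> = 0" by blast
    have "\<beta> \<noteq> 0"
    proof
      assume "\<beta> = 0"
      with n0 have "\<alpha> + of_int k = 0 + of_int 0" by simp
      from eq_of_diff_int[OF this] show False using parameters k \<open>\<beta> = 0\<close> by auto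
    qed
    have "\<alpha> + of_int k + of_int n * \<beta> \<noteq> 0" if "n > n0" for n
    proof
      assume "\<alpha> + of_int k + of_int n * \<beta> = 0"
      with n0 have "of_int n * \<beta> = of_int n0 * \<beta>" by (metis add_left_cancel)
      with \<open>\<beta> \<noteq> 0\<close> that show False by simp
    qed
    then have "\<forall>n\<ge>max N (n0 + 1). xi (k + n) 0 = xi k 0" using * by simp
    then show ?thesis by blast
  qed
qed

text \<open>Constancy is known only far to the right of each index; the values at k and at 1 are
  compared at a common index \<open>m\<close> beyond both bounds.\<close>

lemma xi_const:
  assumes "(\<alpha>, \<beta>, k) \<noteq> (0, 0, 0)"
  shows "xi k 0 = xi 1 0"
proof -
  obtain N where N: "\<forall>n\<ge>N. xi (k + n) 0 = xi k 0" using xi_eventually_const[OF assms] ..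
  obtain N' where N': "\<forall>n\<ge>N'. xi (1 + n) 0 = xi 1 0" using xi_eventually_const[of 1] by auto
  define m where "m = max (k + N) (1 + N')"
  have "xi m 0 = xi k 0" "xi m 0 = xi 1 0"
    using N[rule_format, of "m - k"] N'[rule_format, of "m - 1"] by (auto simp: m_def)
  then show ?thesis by simp
qed

text \<open>Both tensors have a single possibly nonzero coordinate, at k. In the degenerate case at
  k = 0 both are zero.\<close>

lemma f_t_u_e: "f (T.t u (e k)) = T'.t (xi 1 0) (e' k)"
proof (cases "(\<alpha>, \<beta>, k) = (0, 0, 0)")
  case True
  then show ?thesis
    using T.e_0 T'.e_0 parameters_eq
      lin_hom_zero[OF T.T.linear_rep_axioms T'.T.linear_rep_axioms f_lin]
    by (simp add: T.t_zero_right T'.t_zero_right u_closed xi_closed)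
next
  case False
  have "T'.coord i (f (T.t u (e k))) = xi k (i - k)" for i
    by (simp add: xi_def)
  then show ?thesis
    using False parameters_eq xi_other[of _ k] xi_const[of k]
    by (intro T'.coord_eqI) (auto simp: T'.coord_t_e xi_closed
        intro!: fD T.t_closed u_closed T.e_closed T'.t_closed T'.e_closed)
qed

end

text \<open>After the parameters are identified the second factors are the same module with the same
  \<open>coef\<close> and \<open>e\<close>, so the two sides of \<open>f\<close> can be compared at
  one arbitrary \<open>w\<close>.\<close>

locale tensor_series_iso_same = tensor_series_iso V W \<alpha> \<beta> coef e V' W \<alpha> \<beta> coef e u f
  for V :: "('a, 'm) vir_rep_scheme" and W :: "('b, 'n) vir_rep_scheme" and \<alpha> \<beta> coef e
    and V' :: "('c, 'p) vir_rep_scheme" and u f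
begin

lemma f_t_u: "w \<in> carrier W \<Longrightarrow> f (T.t u w) = T'.t (xi 1 0) w"
  by (rule T.e_span_eq[OF lin_hom_comp[OF T.t_right_hom f_lin] T'.t_right_hom])
    (simp_all add: f_t_u_e u_closed xi_closed T'.T.linear_rep_axioms)

text \<open>In the Leibniz expansion of x (y \<otimes> w) the term y \<otimes> x w is covered by the
  hypothesis applied to x w, and it cancels. This is why the hypothesis must hold for all
  \<open>w\<close> at once.\<close>

lemma f_t_act:
  assumes "y \<in> carrier V" "z \<in> carrier V'" "\<And>w. w \<in> carrier W \<Longrightarrow> f (T.t y w) = T'.t z w" "w \<in> carrier W"
  shows "f (T.t (act V x y) w) = T'.t (act V' x z) w"
proof -
  have "f (T.t (act V x y) w) \<oplus>\<^bsub>T'.T\<^esub> T'.t z (act W x w) = f (act T.T x (T.t y w))"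
    using assms by (simp add: T.act_t_leibniz fD T.t_closed T.V.act_closed T.W.act_closed)
  also have "\<dots> = T'.t (act V' x z) w \<oplus>\<^bsub>T'.T\<^esub> T'.t z (act W x w)"
    using assms by (simp add: f_act T.t_closed T'.act_t_leibniz)
  finally show ?thesis
    using assms by (simp add: fD T.t_closed T'.t_closed T.V.act_closed T'.V.act_closed T.W.act_closed)
qed

text \<open>Since \<open>f\<close> maps y \<otimes> w to z \<otimes> w, the vector z is read off at
  index 1, where \<open>e 1\<close> is nonzero in every V'_{\<alpha>,\<beta>}.\<close>

definition g where "g y = T'.coord 1 (f (T.t y (e 1)))"

lemma f_t:
  assumes "y \<in> carrier V"
  shows "g y \<in> carrier V'" "w \<in> carrier W \<Longrightarrow> f (T.t y w) = T'.t (g y) w"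
proof -
  define P where "P y z \<longleftrightarrow> z \<in> carrier V' \<and> (\<forall>w\<in>carrier W. f (T.t y w) = T'.t z w)" for y z
  define G where "G = {y \<in> carrier V. \<exists>z. P y z}"
  have "P \<zero>\<^bsub>V\<^esub> \<zero>\<^bsub>V'\<^esub>"
    using lin_hom_zero[OF T.T.linear_rep_axioms T'.T.linear_rep_axioms f_lin]
    by (simp add: P_def T.t_zero_left T'.t_zero_left)
  then have "\<zero>\<^bsub>V\<^esub> \<in> G" by (auto simp: G_def)
  moreover have "a \<oplus>\<^bsub>V\<^esub> b \<in> G" if ab: "a \<in> G" "b \<in> G" for a b
  proof -
    from ab obtain c d where "a \<in> carrier V" "b \<in> carrier V" "P a c" "P b d" by (auto simp: G_def)
    then have "P (a \<oplus>\<^bsub>V\<^esub> b) (c \<oplus>\<^bsub>V'\<^esub> d)"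
      by (simp add: P_def T.t_add_left T'.t_add_left fD T.t_closed)
    then show ?thesis using ab by (auto simp: G_def)
  qed
  moreover have "a \<odot>\<^bsub>V\<^esub> b \<in> G" if b: "b \<in> G" for a b
  proof -
    from b obtain d where "b \<in> carrier V" "P b d" by (auto simp: G_def)
    then have "P (a \<odot>\<^bsub>V\<^esub> b) (a \<odot>\<^bsub>V'\<^esub> d)"
      by (simp add: P_def T.t_smult_left T'.t_smult_left fD T.t_closed T'.V.smult_closed')
    then show ?thesis using b by (auto simp: G_def T.V.smult_closed')
  qed
  moreover have "act V x b \<in> G" if b: "b \<in> G" for x b
  proof -
    from b obtain d where "b \<in> carrier V" "P b d" by (auto simp: G_def)
    then have "P (act V x b) (act V' x d)"
      using f_t_act[of b d] by (simp add: P_def T'.V.act_closed)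
    then show ?thesis using b by (auto simp: G_def T.V.act_closed)
  qed
  ultimately have "vir_submodule G V"
    unfolding vir_submodule_def T.V.submodule_iff by (auto simp: G_def)
  moreover have "P u (xi 1 0)"
    by (simp add: P_def xi_closed f_t_u)
  then have "u \<in> G" using u_closed by (auto simp: G_def)
  ultimately have "G = carrier V"
    using u(1) unfolding generated_by_def by blast
  with assms obtain z where z: "P y z" by (auto simp: G_def)
  then have "g y = z"
    by (simp add: P_def g_def T.e_closed T'.coord_t_e)
  with z show "g y \<in> carrier V'" "w \<in> carrier W \<Longrightarrow> f (T.t y w) = T'.t (g y) w"
    by (auto simp: P_def)
qed

lemma g_hom: "g \<in> vir_hom V V'"
proof -
  have g: "g \<in> lin_hom V V'"
    unfolding g_def
    by (rule lin_hom_comp[OF lin_hom_comp[OF T.t_left_hom f_lin] T'.coord(1)]) (rule T.e_closed)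
  have "g (act V x y) = act V' x (g y)" if y: "y \<in> carrier V" for x y
    using f_t_act[OF y f_t[OF y] T.e_closed]
    by (simp add: g_def[of "act V x y"] T'.coord_t_e f_t y T'.V.act_closed)
  with g show ?thesis by (simp add: vir_hom_iff)
qed

text \<open>Says that \<open>f\<close> is \<open>g\<close> \<otimes> id as far as coordinate 1 is
  concerned. It yields surjectivity of \<open>g\<close>: a preimage of v \<otimes> e_1 under
  \<open>f\<close> need not be a pure tensor, but its coordinate at 1 is mapped to v.\<close>

lemma coord_f:
  assumes "z \<in> carrier T.T"
  shows "T'.coord 1 (f z) = g (T.coord 1 z)"
proof -
  have gl: "g \<in> lin_hom V V'" using g_hom by (simp add: vir_hom_iff)
  have "{z \<in> carrier T.T. T'.coord 1 (f z) = g (T.coord 1 z)} = carrier T.T"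
  proof (rule T.T_submodule_eq)
    show "submodule {z \<in> carrier T.T. T'.coord 1 (f z) = g (T.coord 1 z)} complex_ring T.T"
      by (rule lin_hom_equalizer[OF T.T.linear_rep_axioms T'.V.linear_rep_axioms
          lin_hom_comp[OF f_lin T'.coord(1)] lin_hom_comp[OF T.coord(1) gl]])
  qed (simp add: T.t_closed f_t T'.coord T.coord lin_homD[OF gl])
  with assms show ?thesis by blast
qed

lemma vir_iso_factors: "vir_iso V V'"
  unfolding vir_iso_def
proof (rule bexI[OF _ g_hom], unfold bij_betw_def, intro conjI)
  show "inj_on g (carrier V)"
  proof (rule inj_onI)
    fix y y' assume *: "y \<in> carrier V" "y' \<in> carrier V" "g y = g y'"
    then have "f (T.t y (e 1)) = f (T.t y' (e 1))"
      by (simp add: f_t T.e_closed)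
    then have "T.t y (e 1) = T.t y' (e 1)"
      using * by (intro inj_onD[OF bij_betw_imp_inj_on[OF f(2)]]) (auto intro: T.t_closed T.e_closed)
    then have "T.coord 1 (T.t y (e 1)) = T.coord 1 (T.t y' (e 1))" by simp
    then show "y = y'" using * by (simp add: T.coord_t_e)
  qed
  show "g ` carrier V = carrier V'"
  proof (intro antisym image_subsetI subsetI)
    fix v assume v: "v \<in> carrier V'"
    then have "T'.t v (e 1) \<in> f ` carrier T.T"
      using f(2) T'.t_closed T.e_closed by (auto simp: bij_betw_def)
    then obtain z where z: "z \<in> carrier T.T" "T'.t v (e 1) = f z" by blast
    then have "v = g (T.coord 1 z)"
      using coord_f[OF z(1)] v T'.coord_t_e[of v 1 1] by simp
    then show "v \<in> g ` carrier V" using z T.coordD by blast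
  qed (rule f_t)
qed

end

subsection \<open>Intermediate series modules\<close>

lemma act_int_series: "act (int_series \<alpha> \<beta>) x = lin_ext (\<lambda>n. lin_ext (\<lambda>g. series_basis_act \<alpha> \<beta> g n) x)"
  by (simp add: int_series_def)

lemma carrier_int_series [simp]: "carrier (int_series \<alpha> \<beta>) = UNIV"
  and add_int_series [simp]: "add (int_series \<alpha> \<beta>) = (+)"
  and smult_int_series [simp]: "module.smult (int_series \<alpha> \<beta>) = scal"
  and zero_int_series [simp]: "zero (int_series \<alpha> \<beta>) = 0"
  by (simp_all add: int_series_def)

lemma linear_rep_int_series: "linear_rep (int_series \<alpha> \<beta>)"
  unfolding int_series_def by (rule linear_rep_free_rep) simp

definition series_kernel :: "complex \<Rightarrow> complex \<Rightarrow> int lincomb set"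
  where "series_kernel \<alpha> \<beta> = (if \<alpha> = 0 \<and> \<beta> = 0 then {scal z (bvec 0) | z. True} else {0})"

lemma series_basis_act_zero: "series_basis_act 0 0 g 0 = 0"
  by (cases g) auto

lemma lin_ext_const_zero: "lin_ext (\<lambda>_. 0) p = 0"
  by (simp add: lin_ext_def)

lemma quot_rep_int_series: "quot_rep (int_series \<alpha> \<beta>) (series_kernel \<alpha> \<beta>)"
proof -
  interpret M: linear_rep "int_series \<alpha> \<beta>" by (rule linear_rep_int_series)
  have "vir_submodule (series_kernel \<alpha> \<beta>) (int_series \<alpha> \<beta>)"
  proof (cases "\<alpha> = 0 \<and> \<beta> = 0")
    case True
    have *: "scal a (bvec 0) + scal b (bvec 0) = scal (a + b) (bvec (0 :: int))" for a b
      by (simp add: scal_add)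
    have **: "act (int_series 0 0) x (scal a (bvec 0)) = scal 0 (bvec 0)" for x a
      by (simp add: act_int_series lin_ext_scal series_basis_act_zero lin_ext_const_zero)
    show ?thesis
      using True unfolding vir_submodule_def M.submodule_iff series_kernel_def
      by (auto simp: * ** intro: exI[of _ 0])
  next
    case False
    then show ?thesis
      using M.act_zero unfolding vir_submodule_def M.submodule_iff series_kernel_def by auto
  qed
  then show ?thesis by unfold_locales
qed

lemma int_series'_eq: "int_series' \<alpha> \<beta> = quot (int_series \<alpha> \<beta>) (series_kernel \<alpha> \<beta>)"
  by (simp add: int_series'_def series_kernel_def)

text \<open>The coefficient functional at \<open>i\<close> vanishes on the submodule that is divided
  out, except for i = 0 and \<alpha> = \<beta> = 0, where the zero functional replaces it; so all of
  them descend to the quotient.\<close>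

lemma int_series'_series:
  obtains coef e where "series (int_series' \<alpha> \<beta>) \<alpha> \<beta> coef e"
proof -
  let ?N = "series_kernel \<alpha> \<beta>"
  interpret Q: quot_rep "int_series \<alpha> \<beta>" ?N by (rule quot_rep_int_series)
  define coset where "coset p = ?N +>\<^bsub>int_series \<alpha> \<beta>\<^esub> p" for p
  have cosetD: "coset p \<in> carrier (int_series' \<alpha> \<beta>)"
    "coset (p + q) = coset p \<oplus>\<^bsub>int_series' \<alpha> \<beta>\<^esub> coset q"
    "coset (scal a p) = a \<odot>\<^bsub>int_series' \<alpha> \<beta>\<^esub> coset p"
    "coset (act (int_series \<alpha> \<beta>) x p) = act (int_series' \<alpha> \<beta>) x (coset p)"
    "coset p = zero (int_series' \<alpha> \<beta>) \<longleftrightarrow> p \<in> ?N" for p q a x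
    using Q.coset_closed[of p] Q.coset_add[of p q] Q.coset_smult[of p a] Q.coset_act[of p x]
      Q.coset_zero_iff[of p] by (auto simp: coset_def int_series'_eq)
  have coset_cases: "\<exists>p. A = coset p" if "A \<in> carrier (int_series' \<alpha> \<beta>)" for A
    using that by (auto simp: coset_def int_series'_eq elim: Q.quot_cases)
  have "\<exists>g. g \<in> lin_hom (int_series' \<alpha> \<beta>) complex_rep \<and>
      (\<forall>p. g (coset p) = (if (\<alpha>, \<beta>, i) \<noteq> (0, 0, 0) then Poly_Mapping.lookup p i else 0))" for i
  proof -
    let ?f = "\<lambda>p. if (\<alpha>, \<beta>, i) \<noteq> (0, 0, 0) then Poly_Mapping.lookup p i else 0"
    obtain g where "g \<in> lin_hom (quot (int_series \<alpha> \<beta>) ?N) complex_rep"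
      "\<And>p. p \<in> carrier (int_series \<alpha> \<beta>) \<Longrightarrow> g (?N +>\<^bsub>int_series \<alpha> \<beta>\<^esub> p) = ?f p"
    proof (rule Q.lin_hom_factor[of complex_rep ?f])
      show "linear_rep complex_rep" by (rule linear_rep_borel_line)
      show "?f \<in> lin_hom (int_series \<alpha> \<beta>) complex_rep"
        by (auto simp: lin_hom_def lookup_add)
      show "?f n = \<zero>\<^bsub>complex_rep\<^esub>" if "n \<in> ?N" for n
        using that by (auto simp: series_kernel_def lookup_bvec split: if_splits)
    qed (rule that)
    then show ?thesis by (auto simp: coset_def int_series'_eq)
  qed
  then obtain coef where coef: "\<And>i. coef i \<in> lin_hom (int_series' \<alpha> \<beta>) complex_rep"
    "\<And>i p. coef i (coset p) = (if (\<alpha>, \<beta>, i) \<noteq> (0, 0, 0) then Poly_Mapping.lookup p i else 0)"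
    by metis
  interpret W: linear_rep "int_series' \<alpha> \<beta>"
    unfolding int_series'_eq by (rule Q.linear_rep_quot)
  have "series (int_series' \<alpha> \<beta>) \<alpha> \<beta> coef (\<lambda>k. coset (bvec k))"
  proof (unfold_locales)
    fix i j k n :: int
    show "coset (bvec i) \<in> carrier (int_series' \<alpha> \<beta>)" by (rule cosetD)
    show "coef i \<in> lin_hom (int_series' \<alpha> \<beta>) complex_rep" by (rule coef)
    show "coef i (coset (bvec j)) = (if i = j \<and> (\<alpha>, \<beta>, i) \<noteq> (0, 0, 0) then 1 else 0)"
      by (auto simp: coef lookup_bvec)
    show "act (int_series' \<alpha> \<beta>) (vd n) (coset (bvec k)) =
        (\<alpha> + of_int k + of_int n * \<beta>) \<odot>\<^bsub>int_series' \<alpha> \<beta>\<^esub> coset (bvec (k + n))"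
      by (simp add: cosetD(3,4)[symmetric] act_int_series add.commute[of n k])
  next
    assume "\<alpha> = 0" "\<beta> = 0"
    then have "bvec 0 \<in> ?N"
      by (auto simp: series_kernel_def intro: exI[of _ 1])
    then show "coset (bvec 0) = \<zero>\<^bsub>int_series' \<alpha> \<beta>\<^esub>" using cosetD(5) by blast
  next
    fix w assume "\<alpha> = 0" "\<beta> = 0" "w \<in> carrier (int_series' \<alpha> \<beta>)"
    then show "coef 0 w = 0" using coset_cases[of w] coef(2)[of 0] by auto
  next
    fix H assume H: "submodule H complex_ring (int_series' \<alpha> \<beta>)" and e: "\<And>i. coset (bvec i) \<in> H"
    have "coset p \<in> H" for p
      using subset_UNIV
    proof (induction p rule: lincomb_induct)
      case zero
      have "coset 0 = \<zero>\<^bsub>int_series' \<alpha> \<beta>\<^esub>"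
        using Q.N_closed(2) cosetD(5) by simp
      then show ?case using H by (simp add: W.submodule_iff)
    qed (use H e in \<open>auto simp: W.submodule_iff cosetD\<close>)
    then have "carrier (int_series' \<alpha> \<beta>) \<subseteq> H"
      using coset_cases by (metis subsetI)
    then show "H = carrier (int_series' \<alpha> \<beta>)"
      using H unfolding W.submodule_iff by blast
  qed
  then show ?thesis by (rule that)
qed

subsection \<open>Highest weight modules\<close>

lemma free_alg_simps [simp]:
  "carrier (free_alg g) = {p. \<forall>w\<in>Poly_Mapping.keys p. set (letters w) \<subseteq> g}"
  "monoid.mult (free_alg g) = (*)" "one (free_alg g) = 1" "zero (free_alg g) = 0"
  "add (free_alg g) = (+)" "module.smult (free_alg g) = scal"
  "act (free_alg g) = (\<lambda>x p. letter x * p)"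
  by (simp_all add: free_alg_def)

lemma free_alg_scal: "p \<in> carrier (free_alg g) \<Longrightarrow> scal a p \<in> carrier (free_alg g)"
  using keys_scal_subset[of a p] by fastforce

lemma free_alg_closed:
  assumes "p \<in> carrier (free_alg g)" "q \<in> carrier (free_alg g)"
  shows "p + q \<in> carrier (free_alg g)" "p * q \<in> carrier (free_alg g)"
proof -
  show "p + q \<in> carrier (free_alg g)"
    using assms Poly_Mapping.keys_add[of p q] by fastforce
  have "set (letters w) \<subseteq> g" if w: "w \<in> Poly_Mapping.keys (p * q)" for w
  proof -
    obtain a b where "w = a + b" "a \<in> Poly_Mapping.keys p" "b \<in> Poly_Mapping.keys q"
      using w Poly_Mapping.keys_mult[of p q] by blast
    then show ?thesis using assms by (simp add: plus_free_word_def)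
  qed
  then show "p * q \<in> carrier (free_alg g)" by simp
qed

lemma letter_closed: "x \<in> g \<Longrightarrow> letter x \<in> carrier (free_alg g)"
  by simp

lemma module_free_alg: "module complex_ring (free_alg g)"
proof (rule module_lincomb)
  fix p q assume "p \<in> carrier (free_alg g)" "q \<in> carrier (free_alg g)"
  then show "p + q \<in> carrier (free_alg g)" by (rule free_alg_closed)
next
  fix a p assume "p \<in> carrier (free_alg g)"
  then show "scal a p \<in> carrier (free_alg g)" by (rule free_alg_scal)
qed simp_all

lemma ring_free_alg: "ring (free_alg g)"
proof (rule ringI)
  interpret module complex_ring "free_alg g" by (rule module_free_alg)
  show "abelian_group (free_alg g)" by (rule M.abelian_group_axioms)
  show "monoid (free_alg g)"
  proof (rule monoidI)
    fix p q assume "p \<in> carrier (free_alg g)" "q \<in> carrier (free_alg g)"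
    then show "p \<otimes>\<^bsub>free_alg g\<^esub> q \<in> carrier (free_alg g)"
      unfolding free_alg_simps(2) by (rule free_alg_closed)
  qed (simp_all add: mult.assoc zero_free_word_def)
qed (auto simp: algebra_simps)

text \<open>Left multiplication by an arbitrary letter stays in the carrier only when all of Vir is
  allowed as alphabet.\<close>

lemma linear_rep_free_alg: "linear_rep (free_alg UNIV)"
proof (intro linear_rep.intro module_free_alg linear_rep_axioms.intro)
  fix v x a
  have "letter x * scal a v = scal a (letter x * v)"
  proof (induction v rule: lincomb_UNIV_induct)
    case (basis b s)
    then show ?case
      by (simp add: single_eq_scal_bvec[symmetric] bvec_def mult_single scal_def)
  qed (simp_all add: scal_add algebra_simps)
  then show "act (free_alg UNIV) x (a \<odot>\<^bsub>free_alg UNIV\<^esub> v) = a \<odot>\<^bsub>free_alg UNIV\<^esub> act (free_alg UNIV) x v"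
    by simp
qed (auto simp: algebra_simps)

text \<open>Scalars are realised inside the algebra, which makes every ring ideal a
  subspace.\<close>

lemma scal_eq_mult: "scal a p = scal a 1 * (p :: vir free_word lincomb)"
  by (simp add: scal_def mult_map_scale_conv_mult)

lemma ideal_scal:
  assumes "ideal I (free_alg g)" "p \<in> I"
  shows "scal a p \<in> I"
proof -
  have "scal a 1 \<in> carrier (free_alg g)"
    using keys_scal_subset[of a "1 :: vir free_word lincomb"] by (auto simp: zero_free_word_def)
  then show ?thesis
    using ideal.I_l_closed[OF assms(1) assms(2), of "scal a 1"] scal_eq_mult[of a p] by simp
qed

text \<open>The closure properties of a Lie subalgebra, in the form that keeps
  \<open>env_rels g\<close> inside \<open>free_alg g\<close>.\<close>

definition bracket_closed :: "vir set \<Rightarrow> bool"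
  where "bracket_closed g \<longleftrightarrow> (\<forall>x\<in>g. \<forall>y\<in>g. x + y \<in> g \<and> vir_bracket x y \<in> g \<and> (\<forall>a. scal a x \<in> g))"

lemma env_rels_closed:
  assumes "bracket_closed g"
  shows "env_rels g \<subseteq> carrier (free_alg g)"
proof -
  have m: "p - q \<in> carrier (free_alg g)" if "p \<in> carrier (free_alg g)" "q \<in> carrier (free_alg g)" for p q
    using free_alg_closed(1)[OF that(1) free_alg_scal[OF that(2), of "- 1"]]
    by (simp add: scal_minus_one)
  show ?thesis
    using assms unfolding env_rels_def bracket_closed_def
    by (auto intro!: m free_alg_closed free_alg_scal letter_closed simp del: free_alg_simps)
qed

lemma ideal_env_ideal: "bracket_closed g \<Longrightarrow> ideal (env_ideal g) (free_alg g)"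
  unfolding env_ideal_def by (intro ring.genideal_ideal ring_free_alg env_rels_closed)

lemma env_rels_subset: "bracket_closed g \<Longrightarrow> env_rels g \<subseteq> env_ideal g"
  unfolding env_ideal_def by (intro ring.genideal_self ring_free_alg env_rels_closed)

lemma env_ideal_minimal: "\<lbrakk>ideal I (free_alg g); env_rels g \<subseteq> I\<rbrakk> \<Longrightarrow> env_ideal g \<subseteq> I"
  unfolding env_ideal_def by (intro ring.genideal_minimal ring_free_alg)

lemma bracket_closed_UNIV: "bracket_closed UNIV"
  by (simp add: bracket_closed_def)

lemma ideal_freeI:
  assumes "I \<subseteq> carrier (free_alg g)" "0 \<in> I" "\<And>p q. \<lbrakk>p \<in> I; q \<in> I\<rbrakk> \<Longrightarrow> p + q \<in> I"
    "\<And>p q. \<lbrakk>p \<in> I; q \<in> carrier (free_alg g)\<rbrakk> \<Longrightarrow> q * p \<in> I \<and> p * q \<in> I"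
  shows "ideal I (free_alg g)"
proof (rule idealI[OF ring_free_alg])
  interpret module complex_ring "free_alg g" by (rule module_free_alg)
  show "subgroup I (add_monoid (free_alg g))"
  proof (rule M.add.subgroupI)
    fix p assume p: "p \<in> I"
    have "scal (- 1) 1 \<in> carrier (free_alg g)"
      using keys_scal_subset[of "- 1" "1 :: vir free_word lincomb"] by (auto simp: zero_free_word_def)
    then have "- p \<in> I"
      using assms(4)[OF p, of "scal (- 1) 1"] scal_eq_mult[of "- 1" p] by (simp add: scal_minus_one)
    moreover have "\<ominus>\<^bsub>free_alg g\<^esub> p = - p"
      using p assms(1) \<open>- p \<in> I\<close> by (intro M.minus_equality) auto
    ultimately show "\<ominus>\<^bsub>free_alg g\<^esub> p \<in> I" by simp
  qed (use assms in auto)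
qed (use assms in auto)

text \<open>The trace of the larger ideal on \<open>free_alg g\<close> is an ideal containing
  \<open>env_rels g\<close>, so minimality applies. This is what makes \<open>env_incl\<close>
  independent of representatives.\<close>

lemma env_ideal_mono:
  assumes "bracket_closed g"
  shows "env_ideal g \<subseteq> env_ideal UNIV"
proof -
  note I = ideal_env_ideal[OF bracket_closed_UNIV]
  have "ideal (env_ideal UNIV \<inter> carrier (free_alg g)) (free_alg g)"
  proof (rule ideal_freeI)
    show "0 \<in> env_ideal UNIV \<inter> carrier (free_alg g)"
      using additive_subgroup.zero_closed[OF ideal.axioms(1)[OF I]] by simp
    fix p q assume p: "p \<in> env_ideal UNIV \<inter> carrier (free_alg g)"
    show "p + q \<in> env_ideal UNIV \<inter> carrier (free_alg g)" if "q \<in> env_ideal UNIV \<inter> carrier (free_alg g)"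
      using p that additive_subgroup.a_closed[OF ideal.axioms(1)[OF I], of p q] free_alg_closed(1)[of p g q]
      by (auto simp del: free_alg_simps(1) simp: free_alg_simps(5))
    show "q * p \<in> env_ideal UNIV \<inter> carrier (free_alg g) \<and> p * q \<in> env_ideal UNIV \<inter> carrier (free_alg g)"
      if "q \<in> carrier (free_alg g)"
      using p that ideal.I_l_closed[OF I, of p q] ideal.I_r_closed[OF I, of p q]
        free_alg_closed(2)[of p g q] free_alg_closed(2)[of q g p]
      by simp
  qed simp
  moreover have "env_rels g \<subseteq> env_rels UNIV"
    unfolding env_rels_def by blast
  then have "env_rels g \<subseteq> env_ideal UNIV"
    using env_rels_subset[OF bracket_closed_UNIV] by (rule subset_trans)
  ultimately show ?thesis
    using env_ideal_minimal env_rels_closed[OF assms] by (metis Int_subset_iff)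
qed

lemma quot_rep_env: "quot_rep (free_alg UNIV) (env_ideal UNIV)"
proof -
  interpret M: linear_rep "free_alg UNIV" by (rule linear_rep_free_alg)
  note I = ideal_env_ideal[OF bracket_closed_UNIV]
  have "vir_submodule (env_ideal UNIV) (free_alg UNIV)"
    unfolding vir_submodule_def M.submodule_iff
    using additive_subgroup.zero_closed[OF ideal.axioms(1)[OF I]] ideal_scal[OF I]
      additive_subgroup.a_closed[OF ideal.axioms(1)[OF I]] ideal.I_l_closed[OF I]
    by simp
  then show ?thesis by unfold_locales
qed

abbreviation U where "U \<equiv> env UNIV"

interpretation U: quot_rep "free_alg UNIV" "env_ideal UNIV"
  by (rule quot_rep_env)

definition ucoset :: "vir free_word lincomb \<Rightarrow> vir free_word lincomb set"
  where "ucoset p = env_ideal UNIV +>\<^bsub>free_alg UNIV\<^esub> p"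

lemma linear_rep_U: "linear_rep U"
  unfolding env_def by (rule U.linear_rep_quot)

lemma ucoset: "ucoset p \<in> carrier U" "ucoset (p + q) = ucoset p \<oplus>\<^bsub>U\<^esub> ucoset q"
  "ucoset (scal a p) = a \<odot>\<^bsub>U\<^esub> ucoset p" "ucoset (letter x * p) = act U x (ucoset p)"
  using U.coset_closed[of p] U.coset_add[of p q] U.coset_smult[of p a] U.coset_act[of p x]
  by (simp_all add: ucoset_def env_def)

lemma ucoset_mult: "ucoset p \<otimes>\<^bsub>U\<^esub> ucoset q = ucoset (p * q)"
  using ideal.rcoset_mult_add[OF ideal_env_ideal[OF bracket_closed_UNIV], of p q]
  by (simp add: ucoset_def env_def quot_def)

lemma U_cases: "y \<in> carrier U \<Longrightarrow> \<exists>p. y = ucoset p"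
  by (auto simp: ucoset_def env_def elim: U.quot_cases)

lemma env_incl_coset:
  assumes "bracket_closed g" "q \<in> carrier (free_alg g)"
  shows "env_incl (env_ideal g +>\<^bsub>free_alg g\<^esub> q) = ucoset q"
proof -
  have "env_ideal UNIV +>\<^bsub>free_alg UNIV\<^esub> p = ucoset q" if "p \<in> env_ideal g +>\<^bsub>free_alg g\<^esub> q" for p
  proof -
    from that obtain n where "n \<in> env_ideal g" "p = n + q" by (auto simp: a_r_coset_def')
    then have "p \<in> ucoset q"
      using env_ideal_mono[OF assms(1)] by (auto simp: ucoset_def a_r_coset_def')
    then show ?thesis using U.coset_eqI[of q p] by (simp add: ucoset_def)
  qed
  moreover have "env_ideal g +>\<^bsub>free_alg g\<^esub> q \<noteq> {}"
    using additive_subgroup.zero_closed[OF ideal.axioms(1)[OF ideal_env_ideal[OF assms(1)]]]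
    by (auto simp: a_r_coset_def')
  ultimately show ?thesis unfolding env_incl_def by auto
qed

lemma env_cases: "b \<in> carrier (env g) \<Longrightarrow>
    \<exists>q\<in>carrier (free_alg g). b = env_ideal g +>\<^bsub>free_alg g\<^esub> q"
  by (auto simp: env_def quot_def A_RCOSETS_def')

section \<open>Verma modules as induced modules\<close>

locale borel_module =
  fixes c h :: complex
begin

abbreviation L where "L \<equiv> borel_line c h"

sublocale L: linear_rep L by (rule linear_rep_borel_line)

text \<open>The highest weight as a linear form. On \<open>borel\<close> it is a character of the
  Lie algebra, although it does not vanish on all brackets of Vir.\<close>

definition chi :: "vir \<Rightarrow> complex"
  where "chi x = h * Poly_Mapping.lookup x (gen_d 0) + c * Poly_Mapping.lookup x gen_C"

lemma act_L: "act L x z = chi x * z"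
  by (simp add: borel_line_def chi_def)

lemma chi_linear: "chi (x + y) = chi x + chi y" "chi (scal a x) = a * chi x" "chi 0 = 0"
  by (simp_all add: chi_def lookup_add algebra_simps)

lemma free_alg_act: "free_alg_act L p z = mlift L (\<lambda>w. foldr (act L) (letters w) z) p"
  by (simp add: free_alg_act_def mlift_def)

lemma free_alg_act_linear:
  "free_alg_act L (p + q) z = free_alg_act L p z + free_alg_act L q z"
  "free_alg_act L (scal a p) z = a * free_alg_act L p z"
  "free_alg_act L (bvec w) z = foldr (act L) (letters w) z" "free_alg_act L 0 z = 0"
  unfolding free_alg_act
  using L.mlift_add[of _ UNIV p q] L.mlift_scal[of _ UNIV p a] L.mlift_bvec by auto

lemma free_alg_act_diff: "free_alg_act L (p - q) z = free_alg_act L p z - free_alg_act L q z"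
  using free_alg_act_linear(1)[of p "scal (- 1) q" z] free_alg_act_linear(2)[of "- 1" q z]
  by (simp add: scal_minus_one)

lemma foldr_act_linear:
  "foldr (act L) xs (a * z) = a * foldr (act L) xs z"
  "foldr (act L) xs (y + z) = foldr (act L) xs y + foldr (act L) xs z"
  "foldr (act L) xs 0 = 0"
  by (induction xs) (simp_all add: act_L algebra_simps)

lemma free_alg_act_mult: "free_alg_act L (p * q) z = free_alg_act L p (free_alg_act L q z)"
proof (induction p rule: lincomb_UNIV_induct)
  case (basis a s)
  show ?case
  proof (induction q rule: lincomb_UNIV_induct)
    case (basis b r)
    have "scal a (bvec s) * scal b (bvec r) = scal (a * b) (bvec (s + r))"
      by (simp add: single_eq_scal_bvec[symmetric] mult_single)
    then show ?case
      by (simp add: free_alg_act_linear foldr_act_linear plus_free_word_def)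
  qed (simp_all add: distrib_left free_alg_act_linear foldr_act_linear algebra_simps)
qed (simp_all add: distrib_right free_alg_act_linear)

lemma free_alg_act_zero: "free_alg_act L p 0 = 0"
  by (induction p rule: lincomb_UNIV_induct)
    (simp_all add: free_alg_act_linear foldr_act_linear)

text \<open>The character \<open>chi\<close> vanishes on brackets since \<open>[d_m, d_n]\<close> has a \<open>d_0\<close> or a \<open>C\<close> component
  only if \<open>m + n = 0\<close>, that is \<open>m = n = 0\<close> for \<open>m, n \<ge> 0\<close>.\<close>

lemma bracket_borel:
  assumes "x \<in> borel" "y \<in> borel"
  shows "vir_bracket x y \<in> borel \<and> chi (vir_bracket x y) = 0"
proof -
  let ?S = "insert gen_C (gen_d ` {0..})"
  let ?P = "\<lambda>x. x \<in> borel \<and> chi x = 0"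
  have add: "?P (p + q)" if "?P p" "?P q" for p q
    using that Poly_Mapping.keys_add[of p q] by (auto simp: borel_def chi_linear)
  have scal: "?P (scal a p)" if "?P p" for a p
    using that keys_scal_subset[of a p] by (auto simp: borel_def chi_linear)
  have zero: "?P 0" by (simp add: borel_def chi_linear)
  have lin: "?P (lin_ext f p)" if "Poly_Mapping.keys p \<subseteq> ?S" "\<And>s. s \<in> ?S \<Longrightarrow> ?P (f s)" for f p
    using that(1)
  proof (induction rule: lincomb_induct)
    case zero
    then show ?case using \<open>?P 0\<close> by simp
  next
    case (add p q)
    then show ?case using \<open>\<And>p q. \<lbrakk>?P p; ?P q\<rbrakk> \<Longrightarrow> ?P (p + q)\<close> by (simp add: lin_ext_add)
  next
    case (basis a s)
    then show ?case using scal[OF that(2)] by (simp add: lin_ext_scal)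
  qed
  have basis: "?P (basis_bracket a b)" if "a \<in> ?S" "b \<in> ?S" for a b
  proof (cases "\<exists>m n. a = gen_d m \<and> b = gen_d n")
    case True
    then obtain m n where "a = gen_d m" "b = gen_d n" by blast
    with that have mn: "a = gen_d m" "b = gen_d n" "m \<ge> 0" "n \<ge> 0" by auto
    show ?thesis
    proof (cases "m + n = 0")
      case True
      then have "m = 0" "n = 0" using mn by linarith+
      then have "basis_bracket a b = 0" using mn by simp
      then show ?thesis using zero by simp
    next
      case False
      then have "basis_bracket a b = scal (of_int (n - m)) (vd (m + n))" using mn by auto
      moreover have "vd (m + n) \<in> borel" "chi (vd (m + n)) = 0"
        using mn False by (auto simp: borel_def chi_def lookup_bvec)
      ultimately show ?thesis using scal by simp
    qed
  next
    case False
    then have "basis_bracket a b = 0"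
      by (cases a; cases b) auto
    then show ?thesis using zero by simp
  qed
  show ?thesis
    unfolding vir_bracket_def using assms
    by (intro lin basis) (auto simp: borel_def)
qed

lemma bracket_closed_borel: "bracket_closed borel"
proof -
  have "x + y \<in> borel" if "x \<in> borel" "y \<in> borel" for x y
    using that Poly_Mapping.keys_add[of x y] by (auto simp: borel_def)
  moreover have "scal a x \<in> borel" if "x \<in> borel" for a x
    using that keys_scal_subset[of a x] by (auto simp: borel_def)
  ultimately show ?thesis
    using bracket_borel by (simp add: bracket_closed_def)
qed

text \<open>The elements acting by zero on the line form an ideal. It contains the relations:
  operators on a line commute, and \<open>chi\<close> vanishes on brackets of \<open>borel\<close>.
  Hence a coset acts by a single well-defined scalar.\<close>

lemma env_ideal_act_zero: "p \<in> env_ideal borel \<Longrightarrow> free_alg_act L p z = 0"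
proof -
  let ?J = "{p \<in> carrier (free_alg borel). \<forall>z. free_alg_act L p z = 0}"
  have "ideal ?J (free_alg borel)"
  proof (rule ideal_freeI)
    show "0 \<in> ?J" by (simp add: free_alg_act_linear)
    fix p q assume p: "p \<in> ?J"
    show "p + q \<in> ?J" if "q \<in> ?J"
      using p that free_alg_closed(1)[of p borel q] by (simp add: free_alg_act_linear)
    show "q * p \<in> ?J \<and> p * q \<in> ?J" if "q \<in> carrier (free_alg borel)"
      using p that free_alg_closed(2)[of p borel q] free_alg_closed(2)[of q borel p]
      by (simp add: free_alg_act_mult free_alg_act_zero)
  qed auto
  moreover have "free_alg_act L p z = 0" if "p \<in> env_rels borel" for p z
    using that unfolding env_rels_def
    by (auto simp: free_alg_act_diff free_alg_act_linear free_alg_act_mult act_L chi_linear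
        bracket_borel distrib_right mult.left_commute)
  then have "env_rels borel \<subseteq> ?J"
    using env_rels_closed[OF bracket_closed_borel] by blast
  ultimately have "env_ideal borel \<subseteq> ?J" by (rule env_ideal_minimal)
  then show "p \<in> env_ideal borel \<Longrightarrow> free_alg_act L p z = 0" by blast
qed

lemma env_act_coset:
  "env_act L (env_ideal borel +>\<^bsub>free_alg borel\<^esub> q) z = free_alg_act L q z"
proof -
  have "free_alg_act L p z = free_alg_act L q z" if "p \<in> env_ideal borel +>\<^bsub>free_alg borel\<^esub> q" for p
    using that by (auto simp: a_r_coset_def' free_alg_act_linear env_ideal_act_zero)
  moreover have "env_ideal borel +>\<^bsub>free_alg borel\<^esub> q \<noteq> {}"
    using additive_subgroup.zero_closed[OF ideal.axioms(1)[OF ideal_env_ideal[OF bracket_closed_borel]]]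
    by (auto simp: a_r_coset_def')
  ultimately have "(\<lambda>p. free_alg_act L p z) ` (env_ideal borel +>\<^bsub>free_alg borel\<^esub> q) = {free_alg_act L q z}"
    by auto
  then show ?thesis by (simp add: env_act_def)
qed

abbreviation left_act :: "vir \<Rightarrow> vir free_word lincomb set \<times> complex \<Rightarrow> (vir free_word lincomb set \<times> complex) lincomb"
  where "left_act \<equiv> \<lambda>x (y, w). bvec (act U x y, w)"

sublocale U: linear_rep U by (rule linear_rep_U)

text \<open>Left multiplication by an element of Vir commutes with right multiplication by
  U(\<open>borel\<close>), by associativity. It therefore sends each balancing relation to a
  balancing relation, and each bilinearity relation to one of its own kind.\<close>

sublocale verma: tensor_quot U L left_act "balance_rels borel L"
proof
  fix x and s :: "vir free_word lincomb set \<times> complex" assume "s \<in> carrier U \<times> carrier L"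
  then show "Poly_Mapping.keys (left_act x s) \<subseteq> carrier U \<times> carrier L"
    by (auto simp: U.act_closed)
next
  have mult_closed: "y \<otimes>\<^bsub>U\<^esub> env_incl b \<in> carrier U" if "y \<in> carrier U" "b \<in> carrier (env borel)" for y b
    using U_cases[OF that(1)] env_cases[OF that(2)]
    by (auto simp del: free_alg_simps simp: env_incl_coset[OF bracket_closed_borel] ucoset_mult ucoset)
  have act_mult: "act U x (y \<otimes>\<^bsub>U\<^esub> env_incl b) = act U x y \<otimes>\<^bsub>U\<^esub> env_incl b"
    if "y \<in> carrier U" "b \<in> carrier (env borel)" for x y b
    using U_cases[OF that(1)] env_cases[OF that(2)]
    by (auto simp del: free_alg_simps simp: env_incl_coset[OF bracket_closed_borel] ucoset_mult
        ucoset(4)[symmetric] mult.assoc)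
  show bal: "Poly_Mapping.keys r \<subseteq> carrier U \<times> carrier L" if "r \<in> balance_rels borel L" for r
    using that mult_closed unfolding balance_rels_def
    by (auto simp: in_keys_iff lookup_minus lookup_bvec split: if_splits)
  fix r x assume r: "r \<in> tensor_rels U L \<union> balance_rels borel L"
  let ?R = "tensor_rels U L \<union> balance_rels borel L"
  let ?F = "free_rep (carrier U \<times> carrier L) left_act"
  from r consider
    (1) v v' w where "v \<in> carrier U" "v' \<in> carrier U" "w \<in> carrier L"
      "r = bvec (v \<oplus>\<^bsub>U\<^esub> v', w) - bvec (v, w) - bvec (v', w)"
  | (2) v w w' where "v \<in> carrier U" "w \<in> carrier L" "w' \<in> carrier L"
      "r = bvec (v, w \<oplus>\<^bsub>L\<^esub> w') - bvec (v, w) - bvec (v, w')"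
  | (3) a v w where "v \<in> carrier U" "w \<in> carrier L" "r = bvec (a \<odot>\<^bsub>U\<^esub> v, w) - scal a (bvec (v, w))"
  | (4) a v w where "v \<in> carrier U" "w \<in> carrier L" "r = bvec (v, a \<odot>\<^bsub>L\<^esub> w) - scal a (bvec (v, w))"
  | (5) y b w where "y \<in> carrier U" "b \<in> carrier (env borel)" "w \<in> carrier L"
      "r = bvec (y \<otimes>\<^bsub>U\<^esub> env_incl b, w) - bvec (y, env_act L b w)"
    unfolding tensor_rels_def balance_rels_def by auto
  then have "lin_ext (left_act x) r \<in> ?R"
  proof cases
    case 1
    then show ?thesis
      using tensor_rels_intros(1)[of "act U x v" U "act U x v'" w L]
      by (simp add: lin_ext_diff U.act_add U.act_closed)
  next
    case 2
    then show ?thesis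
      using tensor_rels_intros(2)[of "act U x v" U w L w'] by (simp add: lin_ext_diff U.act_closed)
  next
    case 3
    then show ?thesis
      using tensor_rels_intros(3)[of "act U x v" U w L a]
      by (simp add: lin_ext_diff lin_ext_scal U.act_smult U.act_closed)
  next
    case 4
    then show ?thesis
      using tensor_rels_intros(4)[of "act U x v" U w L a]
      by (simp add: lin_ext_diff lin_ext_scal U.act_closed)
  next
    case 5
    then show ?thesis
      unfolding balance_rels_def
      by (simp add: lin_ext_diff act_mult) (blast intro: U.act_closed)
  qed
  moreover have "?R \<subseteq> subspace_gen ?F ?R"
    unfolding subspace_gen_def by blast
  ultimately show "lin_ext (left_act x) r \<in> subspace_gen ?F ?R" by blast
qed

lemma verma_eq: "verma.T = verma c h"
  by (simp add: verma.T_def verma.K_def verma.F_def verma_def induced_def Let_def)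

lemma act_verma_t: "\<lbrakk>y \<in> carrier U; z \<in> carrier L\<rbrakk> \<Longrightarrow> act verma.T x (verma.t y z) = verma.t (act U x y) z"
  by (simp add: verma.act_t) (simp add: verma.t_def)

text \<open>The canonical generator 1 \<otimes> u of the Verma module.\<close>

definition vac where "vac = verma.t (ucoset 1) 1"

lemma vac_closed: "vac \<in> carrier verma.T"
  unfolding vac_def by (rule verma.t_closed) (simp_all add: ucoset)

text \<open>For n \<ge> 1 the element d_n lies in \<open>borel\<close>, so balancing moves it across
  the tensor sign, where it acts by \<open>chi\<close> of d_n, which is 0.\<close>

lemma vac_killed:
  assumes "n \<ge> 1"
  shows "act verma.T (vd n) vac = \<zero>\<^bsub>verma.T\<^esub>"
proof -
  let ?b = "env_ideal borel +>\<^bsub>free_alg borel\<^esub> letter (vd n)"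
  have l: "letter (vd n) \<in> carrier (free_alg borel)"
    using assms by (intro letter_closed) (auto simp: borel_def)
  then have b: "?b \<in> carrier (env borel)"
    by (auto simp: env_def quot_def A_RCOSETS_def' simp del: free_alg_simps(1))
  have incl: "ucoset 1 \<otimes>\<^bsub>U\<^esub> env_incl ?b = act U (vd n) (ucoset 1)"
    using env_incl_coset[OF bracket_closed_borel l] by (simp add: ucoset_mult ucoset(4)[symmetric])
  have "env_act L ?b 1 = 0"
    using assms by (simp add: env_act_coset free_alg_act_linear act_L chi_def lookup_bvec)
  then have "bvec (act U (vd n) (ucoset 1), 1) - bvec (ucoset 1, 0) \<in> balance_rels borel L"
    unfolding balance_rels_def using b ucoset(1)[of 1] incl
    by (intro CollectI exI[of _ "ucoset 1"] exI[of _ ?b] exI[of _ 1]) simp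
  then have "verma.t (act U (vd n) (ucoset 1)) 1 = verma.t (ucoset 1) 0"
    unfolding verma.t_def using verma.R_subset
    by (intro verma.coset_eq_diff) (auto simp: ucoset U.act_closed)
  also have "\<dots> = \<zero>\<^bsub>verma.T\<^esub>"
    using verma.t_zero_right[of "ucoset 1"] by (simp add: ucoset)
  finally show ?thesis by (simp add: vac_def act_verma_t ucoset)
qed

text \<open>Words span the enveloping algebra, and a word applied to the generator is obtained by
  acting with its letters one at a time; a submodule containing \<open>vac\<close> contains all of
  these.\<close>

lemma vac_generates: "generated_by vac verma.T"
  unfolding generated_by_def
proof (intro conjI allI impI vac_closed)
  fix S assume S: "vir_submodule S verma.T" and "vac \<in> S"
  then have sub: "submodule S complex_ring verma.T" and act: "\<And>x v. v \<in> S \<Longrightarrow> act verma.T x v \<in> S"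
    by (auto simp: vir_submodule_def)
  note SD = sub[unfolded verma.T.submodule_iff]
  have word: "verma.t (ucoset (bvec (Free_Word xs))) z \<in> S" for xs z
  proof (induction xs)
    case Nil
    have "bvec (Free_Word []) = (1 :: vir free_word lincomb)"
      by (metis bvec_def single_one zero_free_word_def)
    then have "verma.t (ucoset (bvec (Free_Word []))) z = z \<odot>\<^bsub>verma.T\<^esub> vac"
      using verma.t_smult_right[of "ucoset 1" 1 z] by (simp add: vac_def ucoset)
    then show ?case using SD \<open>vac \<in> S\<close> by simp
  next
    case (Cons x xs)
    have "bvec (Free_Word (x # xs)) = letter x * bvec (Free_Word xs)"
      by (simp add: bvec_def mult_single plus_free_word_def)
    then have "verma.t (ucoset (bvec (Free_Word (x # xs)))) z
        = act verma.T x (verma.t (ucoset (bvec (Free_Word xs))) z)"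
      by (simp add: act_verma_t ucoset)
    with Cons act show ?case by simp
  qed
  show "S = carrier verma.T"
  proof (rule verma.T_submodule_eq[OF sub])
    fix y z assume "y \<in> carrier U" "z \<in> carrier L"
    then obtain p where y: "y = ucoset p" using U_cases by blast
    have "verma.t (ucoset p) z \<in> S"
    proof (induction p rule: lincomb_UNIV_induct)
      case zero
      have "ucoset 0 = 0 \<odot>\<^bsub>U\<^esub> ucoset 0" by (simp add: ucoset(3)[symmetric])
      then have "ucoset 0 = \<zero>\<^bsub>U\<^esub>" using U.smult_l_null[of "ucoset 0"] by (simp add: ucoset)
      then show ?case using SD verma.t_zero_left[of z] by simp
    next
      case (add p q)
      then show ?case using SD by (simp add: ucoset verma.t_add_left)
    next
      case (basis a s)
      then show ?case
        using SD word[of "letters s" z] by (simp add: ucoset verma.t_smult_left)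
    qed
    with y show "verma.t y z \<in> S" by simp
  qed
qed

end

section \<open>Highest weight vectors and local nilpotency\<close>

lemma generated_by_image:
  assumes "linear_rep M" "linear_rep N" "f \<in> vir_hom M N" "f ` carrier M = carrier N" "generated_by u M"
  shows "generated_by (f u) N"
  unfolding generated_by_def
proof (intro conjI allI impI)
  show "f u \<in> carrier N" using assms by (auto simp: generated_by_def)
  fix S assume S: "vir_submodule S N" "f u \<in> S"
  interpret M: linear_rep M by fact
  have "submodule {v \<in> carrier M. f v \<in> S} complex_ring M"
    using assms S by (intro lin_hom_vimage) (auto simp: vir_hom_iff vir_submodule_def)
  then have "vir_submodule {v \<in> carrier M. f v \<in> S} M"
    using assms(3) S(1) by (auto simp: vir_submodule_def vir_hom_iff M.act_closed)
  with assms(5) S(2) have "{v \<in> carrier M. f v \<in> S} = carrier M"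
    unfolding generated_by_def by blast
  then have "f ` carrier M \<subseteq> S" by auto
  moreover have "S \<subseteq> carrier N" using S(1) by (simp add: vir_submodule_def)
  ultimately show "S = carrier N" using assms(4) by simp
qed

text \<open>The vector is the image of \<open>vac\<close> under the surjection from the Verma module
  onto \<open>V\<close>. It is nonzero because a zero generator would make \<open>V\<close> the zero
  module.\<close>

lemma highest_weight_vector:
  assumes V: "highest_weight_module V"
  obtains u where "generated_by u V" "u \<noteq> \<zero>\<^bsub>V\<^esub>" "\<And>n. n \<ge> 1 \<Longrightarrow> act V (vd n) u = \<zero>\<^bsub>V\<^esub>"
proof -
  obtain c h N where N: "vir_submodule N (verma c h)" and iso: "vir_iso V (quot (verma c h) N)"
    and V': "vir_module V" "carrier V \<noteq> {\<zero>\<^bsub>V\<^esub>}"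
    using V by (auto simp: highest_weight_module_def)
  interpret V: linear_rep V using V'(1) by (rule vir_module.linear_rep)
  interpret B: borel_module c h .
  interpret Q: quot_rep "verma c h" N
    using B.verma.T.linear_rep_axioms N unfolding B.verma_eq
    by (intro quot_rep.intro quot_rep_axioms.intro)
  obtain f g where fg: "f \<in> vir_hom V (quot (verma c h) N)" "g \<in> vir_hom (quot (verma c h) N) V"
    "\<And>v. v \<in> carrier V \<Longrightarrow> g (f v) = v" "\<And>v. v \<in> carrier (quot (verma c h) N) \<Longrightarrow> f (g v) = v"
    by (rule vir_iso_inverse[OF V.linear_rep_axioms iso]) (rule that)
  define p where "p v = g (N +>\<^bsub>verma c h\<^esub> v)" for v
  have p: "p \<in> vir_hom (verma c h) V"
    unfolding p_def by (rule vir_hom_comp[OF Q.coset_hom fg(2)])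
  have surj: "p ` carrier (verma c h) = carrier V"
  proof (intro antisym image_subsetI subsetI)
    fix v assume v: "v \<in> carrier V"
    then have "f v \<in> carrier (quot (verma c h) N)" using fg(1) by (auto simp: vir_hom_def)
    then obtain w where "w \<in> carrier (verma c h)" "f v = N +>\<^bsub>verma c h\<^esub> w" by (rule Q.quot_cases)
    with fg(3)[OF v] show "v \<in> p ` carrier (verma c h)" by (auto simp: p_def image_iff)
  qed (use p in \<open>auto simp: vir_hom_def\<close>)
  let ?u = "p B.vac"
  have gen: "generated_by ?u V"
    using generated_by_image[OF Q.linear_rep_axioms V.linear_rep_axioms p surj]
      B.vac_generates B.verma_eq by simp
  have "?u \<noteq> \<zero>\<^bsub>V\<^esub>"
  proof
    assume "?u = \<zero>\<^bsub>V\<^esub>"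
    moreover have "vir_submodule {\<zero>\<^bsub>V\<^esub>} V"
      by (simp add: vir_submodule_def V.submodule_iff V.act_zero V.smult_r_null[simplified])
    ultimately have "{\<zero>\<^bsub>V\<^esub>} = carrier V" using gen by (simp add: generated_by_def)
    with V'(2) show False by simp
  qed
  moreover have "act V (vd n) ?u = \<zero>\<^bsub>V\<^esub>" if "n \<ge> 1" for n
  proof -
    have "act V (vd n) ?u = p (act (verma c h) (vd n) B.vac)"
      using p B.vac_closed by (simp add: vir_hom_iff B.verma_eq)
    also have "\<dots> = \<zero>\<^bsub>V\<^esub>"
      using B.vac_killed[OF that] lin_hom_zero[OF Q.linear_rep_axioms V.linear_rep_axioms, of p] p
      by (simp add: B.verma_eq vir_hom_iff)
    finally show ?thesis .
  qed
  ultimately show ?thesis using gen that by blast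
qed

lemma vir_bracket_bvec: "vir_bracket (bvec a) (bvec b) = basis_bracket a b"
  by (simp add: vir_bracket_def)

text \<open>The vectors killed by d_n for all large n form a submodule that contains the generator.
  Stability under x rests on the bracket relation: for large n, d_n x v equals [d_n, x] v, and for x
  = d_m this bracket is a multiple of d_{n+m}.\<close>

lemma highest_weight_nilpotent:
  assumes "highest_weight_module V" "v \<in> carrier V"
  shows "\<exists>N. \<forall>n\<ge>N. act V (vd n) v = \<zero>\<^bsub>V\<^esub>"
proof -
  interpret V: vir_module V using assms by (simp add: highest_weight_module_def)
  interpret L: linear_rep V by (rule V.linear_rep)
  obtain u where u: "generated_by u V" "\<And>n. n \<ge> 1 \<Longrightarrow> act V (vd n) u = \<zero>\<^bsub>V\<^esub>"
    by (rule highest_weight_vector[OF assms(1)]) (rule that)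
  define S where "S = {v \<in> carrier V. \<exists>N. \<forall>n\<ge>N. act V (vd n) v = \<zero>\<^bsub>V\<^esub>}"
  have SI: "v \<in> S" if "v \<in> carrier V" "\<And>n. n \<ge> N \<Longrightarrow> act V (vd n) v = \<zero>\<^bsub>V\<^esub>" for v N
    using that by (auto simp: S_def)
  have S_closed: "v \<in> S \<Longrightarrow> v \<in> carrier V" for v by (simp add: S_def)
  have SE: "\<exists>N. \<forall>n\<ge>N. act V (vd n) v = \<zero>\<^bsub>V\<^esub>" if "v \<in> S" for v using that by (simp add: S_def)
  have add: "v \<oplus>\<^bsub>V\<^esub> w \<in> S" if vw: "v \<in> S" "w \<in> S" for v w
  proof -
    from SE[OF vw(1)] obtain N where "\<forall>n\<ge>N. act V (vd n) v = \<zero>\<^bsub>V\<^esub>" ..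
    moreover from SE[OF vw(2)] obtain N' where "\<forall>n\<ge>N'. act V (vd n) w = \<zero>\<^bsub>V\<^esub>" ..
    ultimately show ?thesis
      using S_closed[OF vw(1)] S_closed[OF vw(2)] by (intro SI[of _ "max N N'"]) (auto simp: L.act_add)
  qed
  have smult: "a \<odot>\<^bsub>V\<^esub> v \<in> S" if v: "v \<in> S" for a v
  proof -
    from SE[OF v] obtain N where "\<forall>n\<ge>N. act V (vd n) v = \<zero>\<^bsub>V\<^esub>" ..
    then show ?thesis
      using S_closed[OF v]
      by (intro SI[of _ N]) (auto simp: L.act_smult L.smult_closed' V.smult_r_null[simplified])
  qed
  have zero_in: "\<zero>\<^bsub>V\<^esub> \<in> S" by (rule SI[of _ 0]) (simp_all add: L.act_zero)
  have act_0: "act V 0 v = \<zero>\<^bsub>V\<^esub>" if "v \<in> carrier V" for v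
    using V.scal_act[OF that, of 0 0] V.smult_l_null[of "act V 0 v"] that by (simp add: L.act_closed)
  have basis: "act V (bvec b) v \<in> S" if v: "v \<in> S" for b v
  proof -
    note vc = S_closed[OF v]
    from SE[OF v] obtain N where N: "\<forall>n\<ge>N. act V (vd n) v = \<zero>\<^bsub>V\<^esub>" ..
    have comm: "act V (vd n) (act V (bvec b) v) = act V (vir_bracket (vd n) (bvec b)) v"
      if "n \<ge> N" for n
      using V.bracket_act[OF vc, of "vd n" "bvec b"] N that vc
      by (simp add: L.act_zero L.act_closed V.M.minus_eq)
    show ?thesis
    proof (cases b)
      case (gen_d m)
      \<comment> \<open>The bound puts both n and n + m beyond \<open>N\<close> and keeps n + m
        positive, so that the bracket has no central term.\<close>
      show ?thesis
      proof (rule SI[of _ "max N (\<bar>m\<bar> + 1) + \<bar>m\<bar>"])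
        fix n assume n: "n \<ge> max N (\<bar>m\<bar> + 1) + \<bar>m\<bar>"
        then have "n \<ge> N" "n + m \<ge> N" "m \<noteq> - n" by auto
        then have "vir_bracket (vd n) (bvec b) = scal (of_int (m - n)) (vd (n + m))"
          by (simp add: vir_bracket_bvec gen_d)
        then show "act V (vd n) (act V (bvec b) v) = \<zero>\<^bsub>V\<^esub>"
          using comm[OF \<open>n \<ge> N\<close>] N \<open>n + m \<ge> N\<close> V.scal_act[OF vc] V.smult_r_null by simp
      qed (simp add: L.act_closed vc)
    next
      case gen_C
      then show ?thesis
        using comm by (intro SI[of _ N]) (simp_all add: L.act_closed vc vir_bracket_bvec act_0)
    qed
  qed
  have "act V x v \<in> S" if v: "v \<in> S" for x v
  proof (induction x rule: lincomb_UNIV_induct)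
    case zero
    then show ?case using zero_in act_0 S_closed[OF v] by simp
  next
    case (add x y)
    then show ?case using \<open>\<And>v w. \<lbrakk>v \<in> S; w \<in> S\<rbrakk> \<Longrightarrow> v \<oplus>\<^bsub>V\<^esub> w \<in> S\<close> V.add_act[OF S_closed[OF v]] by simp
  next
    case (basis a s)
    then show ?case using smult \<open>\<And>v b. v \<in> S \<Longrightarrow> act V (bvec b) v \<in> S\<close> v V.scal_act[OF S_closed[OF v]] by simp
  qed
  then have "vir_submodule S V"
    using add smult zero_in S_closed unfolding vir_submodule_def L.submodule_iff by blast
  moreover have "u \<in> S" using u by (intro SI[of _ 1]) (auto simp: generated_by_def)
  ultimately have "S = carrier V" using u(1) by (simp add: generated_by_def)
  with assms(2) SE show ?thesis by blast
qed

theorem theorem2: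
  fixes V :: "'a vir_rep" and V\<^sub>1 :: "'b vir_rep"
    and \<alpha> \<beta> \<alpha>\<^sub>1 \<beta>\<^sub>1 :: complex
  assumes "highest_weight_module V" and "highest_weight_module V\<^sub>1"
    and "0 \<le> Re \<alpha>" and "Re \<alpha> < 1" and "0 \<le> Re \<alpha>\<^sub>1" and "Re \<alpha>\<^sub>1 < 1"
    and "\<beta> \<noteq> 1" and "\<beta>\<^sub>1 \<noteq> 1"
  shows "vir_iso (vir_tensor V (int_series' \<alpha> \<beta>)) (vir_tensor V\<^sub>1 (int_series' \<alpha>\<^sub>1 \<beta>\<^sub>1)) \<longleftrightarrow>
    vir_iso V V\<^sub>1 \<and> vir_iso (int_series' \<alpha> \<beta>) (int_series' \<alpha>\<^sub>1 \<beta>\<^sub>1)"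
proof -
  let ?W = "int_series' \<alpha> \<beta>" and ?W1 = "int_series' \<alpha>\<^sub>1 \<beta>\<^sub>1"
  have V: "linear_rep V" "linear_rep V\<^sub>1"
    using assms(1,2) by (auto simp: highest_weight_module_def intro: vir_module.linear_rep)
  obtain coef e where W: "series ?W \<alpha> \<beta> coef e" by (rule int_series'_series)
  obtain coef1 e1 where W1: "series ?W1 \<alpha>\<^sub>1 \<beta>\<^sub>1 coef1 e1" by (rule int_series'_series)
  note lW = series.axioms(1)[OF W] and lW1 = series.axioms(1)[OF W1]
  have TS: "tensor_series V ?W \<alpha> \<beta> coef e" "tensor_series V\<^sub>1 ?W1 \<alpha>\<^sub>1 \<beta>\<^sub>1 coef1 e1"
    using V W W1 lW lW1 by (auto intro!: tensor_series.intro tensor.intro)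
  obtain u where u: "generated_by u V" "u \<noteq> \<zero>\<^bsub>V\<^esub>" "\<And>n. n \<ge> 1 \<Longrightarrow> act V (vd n) u = \<zero>\<^bsub>V\<^esub>"
    by (rule highest_weight_vector[OF assms(1)]) (rule that)
  have T_eq: "vir_tensor V ?W = tensor_quot.T V ?W (leibniz V ?W) {}"
    "vir_tensor V\<^sub>1 ?W1 = tensor_quot.T V\<^sub>1 ?W1 (leibniz V\<^sub>1 ?W1) {}"
    using tensor.T_eq[OF tensor_series.axioms(1)[OF TS(1)]] tensor.T_eq[OF tensor_series.axioms(1)[OF TS(2)]]
    by simp_all
  show ?thesis
  proof
    assume "vir_iso V V\<^sub>1 \<and> vir_iso ?W ?W1"
    then show "vir_iso (vir_tensor V ?W) (vir_tensor V\<^sub>1 ?W1)"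
      using vir_iso_tensor V lW lW1 by blast
  next
    assume "vir_iso (vir_tensor V ?W) (vir_tensor V\<^sub>1 ?W1)"
    then obtain f where f: "f \<in> vir_hom (vir_tensor V ?W) (vir_tensor V\<^sub>1 ?W1)"
      "bij_betw f (carrier (vir_tensor V ?W)) (carrier (vir_tensor V\<^sub>1 ?W1))"
      by (auto simp: vir_iso_def)
    have "tensor_series_iso V ?W \<alpha> \<beta> coef e V\<^sub>1 ?W1 \<alpha>\<^sub>1 \<beta>\<^sub>1 coef1 e1 u f"
      using TS u f assms highest_weight_nilpotent[OF assms(2)] unfolding T_eq
      by (intro tensor_series_iso.intro tensor_series_iso_axioms.intro) auto
    from tensor_series_iso.parameters_eq[OF this] have eq: "\<alpha>\<^sub>1 = \<alpha>" "\<beta>\<^sub>1 = \<beta>" by simp_all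
    \<comment> \<open>The equations in \<open>eq\<close> rewrite the second series module into the
      first, so the same \<open>coef\<close> and \<open>e\<close> serve on both sides and the second
      stage of the argument applies to the same \<open>f\<close>.\<close>
    have "tensor_series V\<^sub>1 ?W \<alpha> \<beta> coef e"
      using V W lW by (intro tensor_series.intro tensor.intro)
    then have "tensor_series_iso_same V ?W \<alpha> \<beta> coef e V\<^sub>1 u f"
      using TS u f assms highest_weight_nilpotent[OF assms(2)] unfolding eq T_eq[unfolded eq]
      by (intro tensor_series_iso_same.intro tensor_series_iso.intro tensor_series_iso_axioms.intro) auto
    then have "vir_iso V V\<^sub>1" by (rule tensor_series_iso_same.vir_iso_factors)
    moreover have "vir_iso ?W ?W1"
      unfolding eq by (rule vir_isoI[of "\<lambda>v. v" _ _ "\<lambda>v. v"]) (auto simp: vir_hom_def)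
    ultimately show "vir_iso V V\<^sub>1 \<and> vir_iso ?W ?W1" by simp
  qed
qed

end
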